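(* Weighted Ricci curvature is an affine invariant: let $(M,F)$ and $(M,F')$ be affinely equivalent Berwald spaces of dimension $n$ and let $\mathbf{m}$ be a smooth measure on $M$. Then for every $N\in[n,\infty]$ the $N$-weighted Ricci curvatures of $(M,F,\mathbf{m})$ and $(M,F',\mathbf{m})$ agree, i.e. $\operatorname{Ric}_N^{F}(v)=\operatorname{Ric}_N^{F'}(v)$ for all tangent vectors $v$.
   Context: Manifolds are connected, smooth and finite-dimensional. A Finsler structure on $M$ is a function $F:TM\to[0,\infty)$, $C^\infty$ off the zero section, with $F(\lambda v)=\lambda F(v)$ for $\lambda>0$, such that for each $v\in T_xM\setminus\{0\}$ the Hessian $g_v$ of $\frac12F^2|_{T_xM}$ at $v$ is a positive definite inner product on $T_xM$. $(M,F)$ is a Berwald space if there is a (necessarily unique) torsion-free affine connection on $M$, called the induced connection, whose parallel transport preserves $F$. Geodesics are the auto-parallel curves of the induced connection. Two Berwald structures on $M$ are affinely equivalent if their induced connections agree. Ricci curvature: for $v\in T_xM\setminus\{0\}$, extend $v$ to a local nowhere vanishing vector field $V$ whose integral curves are geodesics; $\operatorname{Ric}(v)$ is the Ricci tensor of the Riemannian metric $g_V$ evaluated at $(v,v)$ (independent of the extension); $\operatorname{Ric}(0)=0$. Let $\operatorname{vol}_F$ be the Busemann–Hausdorff measure of $F$, i.e. the measure with smooth positive density normalized so that on each $T_xM$ the set $\{v\in T_xM:F(v)<1\}$ has the volume of the Euclidean unit ball of $\mathbb{R}^n$. A smooth measure $\mathbf{m}$ (with positive smooth density) is written $\mathbf{m}=e^{-\Psi}\operatorname{vol}_F$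 with $\Psi:M\to\mathbb{R}$ smooth. For a tangent vector $v$, let $\eta$ be the geodesic with $\dot\eta(0)=v$, and set $\operatorname{Ric}_n(v)=\operatorname{Ric}(v)+(\Psi\circ\eta)''(0)$ if $(\Psi\circ\eta)'(0)=0$ and $\operatorname{Ric}_n(v)=-\infty$ otherwise; $\operatorname{Ric}_N(v)=\operatorname{Ric}(v)+(\Psi\circ\eta)''(0)+\frac{((\Psi\circ\eta)'(0))^2}{N-n}$ for $N\in(n,\infty)$; $\operatorname{Ric}_\infty(v)=\operatorname{Ric}(v)+(\Psi\circ\eta)''(0)$. *)

theory Defs
  imports "HOL-Analysis.Analysis"
begin

section \<open>Smooth maps between open subsets of vector spaces\<close>

abbreviation deriv_at ::
  "('a::real_normed_vector \<Rightarrow> 'b::real_normed_vector) \<Rightarrow> 'a \<Rightarrow> 'a \<Rightarrow> 'b"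
  where "deriv_at f x a \<equiv> frechet_derivative f (at x) a"

abbreviation deriv2_at ::
  "('a::real_normed_vector \<Rightarrow> 'b::real_normed_vector) \<Rightarrow> 'a \<Rightarrow> 'a \<Rightarrow> 'a \<Rightarrow> 'b"
  where "deriv2_at f x a b \<equiv> deriv_at (\<lambda>y. deriv_at f y b) x a"

text \<open>Only used for open \<open>S\<close>.\<close>

primrec Ck_on ::
  "nat \<Rightarrow> 'a::real_normed_vector set \<Rightarrow> ('a \<Rightarrow> 'b::real_normed_vector) \<Rightarrow> bool" where
  "Ck_on 0 S f \<longleftrightarrow> continuous_on S f"
| "Ck_on (Suc k) S f \<longleftrightarrow>
     (\<forall>x\<in>S. f differentiable (at x)) \<and> (\<forall>a. Ck_on k S (\<lambda>x. deriv_at f x a))"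

definition smooth_on ::
  "'a::real_normed_vector set \<Rightarrow> ('a \<Rightarrow> 'b::real_normed_vector) \<Rightarrow> bool"
  where "smooth_on S f \<longleftrightarrow> (\<forall>k. Ck_on k S f)"


section \<open>Manifolds and tangent vectors\<close>

text \<open>A chart is a domain together with a coordinate map; the values of the map outside the
  domain are irrelevant. The underlying set of the manifold is the whole type \<open>'m\<close>, and its
  dimension is \<open>DIM('e)\<close>.\<close>

type_synonym ('m, 'e) chart = "'m set \<times> ('m \<Rightarrow> 'e)"

abbreviation cdom :: "('m, 'e) chart \<Rightarrow> 'm set"
  where "cdom c \<equiv> fst c"

abbreviation coord :: "('m, 'e) chart \<Rightarrow> 'm \<Rightarrow> 'e"
  where "coord c \<equiv> snd c"

definition crange :: "('m, 'e) chart \<Rightarrow> 'e set"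
  where "crange c = coord c ` cdom c"

definition param :: "('m, 'e) chart \<Rightarrow> 'e \<Rightarrow> 'm"
  where "param c = inv_into (cdom c) (coord c)"

definition transition :: "('m, 'e) chart \<Rightarrow> ('m, 'e) chart \<Rightarrow> 'e \<Rightarrow> 'e"
  where "transition c c' = coord c' \<circ> param c"

definition smooth_manifold ::
  "('m::{t2_space,second_countable_topology}, 'e::euclidean_space) chart set \<Rightarrow> bool"
  where "smooth_manifold A \<longleftrightarrow>
    connected (UNIV :: 'm set) \<and>
    (\<Union>c\<in>A. cdom c) = UNIV \<and>
    (\<forall>c\<in>A. open (cdom c) \<and> open (crange c) \<and>
       homeomorphism (cdom c) (crange c) (coord c) (param c)) \<and>
    (\<forall>c\<in>A. \<forall>c'\<in>A. smooth_on (coord c ` (cdom c \<inter> cdom c')) (transition c c'))"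

definition smooth_fun ::
  "('m, 'e::euclidean_space) chart set \<Rightarrow> ('m \<Rightarrow> real) \<Rightarrow> bool"
  where "smooth_fun A f \<longleftrightarrow> (\<forall>c\<in>A. smooth_on (crange c) (f \<circ> param c))"

text \<open>A tangent vector is a base point together with the family of its components in all charts
  around that point, which transform by the derivatives of the coordinate changes. Components in
  all other charts are set to zero, so that tangent vectors are equal iff their base points
  and components are.\<close>

type_synonym ('m, 'e) tangent = "'m \<times> (('m, 'e) chart \<Rightarrow> 'e)"

abbreviation base :: "('m, 'e) tangent \<Rightarrow> 'm"
  where "base v \<equiv> fst v"

abbreviation comp_in :: "('m, 'e) chart \<Rightarrow> ('m, 'e) tangent \<Rightarrow> 'e"
  where "comp_in c v \<equiv> snd v c"

definition tangent_bundle ::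
  "('m, 'e::euclidean_space) chart set \<Rightarrow> ('m, 'e) tangent set"
  where "tangent_bundle A = {v.
    (\<forall>c\<in>A. \<forall>c'\<in>A. base v \<in> cdom c \<inter> cdom c' \<longrightarrow>
       comp_in c' v = deriv_at (transition c c') (coord c (base v)) (comp_in c v)) \<and>
    (\<forall>c. \<not> (c \<in> A \<and> base v \<in> cdom c) \<longrightarrow> comp_in c v = 0)}"

definition scale_tangent :: "real \<Rightarrow> ('m, 'e::real_vector) tangent \<Rightarrow> ('m, 'e) tangent"
  where "scale_tangent r v = (base v, \<lambda>c. r *\<^sub>R comp_in c v)"

definition zero_tangent :: "'m \<Rightarrow> ('m, 'e::real_vector) tangent"
  where "zero_tangent p = (p, \<lambda>c. 0)"

text \<open>The tangent vector at the point with coordinates \<open>x\<close> in the chart \<open>c\<close> whose component in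
  \<open>c\<close> is \<open>w\<close>.\<close>

definition tangent_of ::
  "('m, 'e::euclidean_space) chart set \<Rightarrow> ('m, 'e) chart \<Rightarrow> 'e \<Rightarrow> 'e \<Rightarrow> ('m, 'e) tangent"
  where "tangent_of A c x w = (param c x,
    \<lambda>c'. if c' \<in> A \<and> param c x \<in> cdom c' then deriv_at (transition c c') x w else 0)"

definition open_interval :: "real set \<Rightarrow> bool"
  where "open_interval J \<longleftrightarrow> open J \<and> is_interval J"

definition smooth_curve ::
  "('m::topological_space, 'e::euclidean_space) chart set \<Rightarrow> real set \<Rightarrow> (real \<Rightarrow> 'm) \<Rightarrow> bool"
  where "smooth_curve A J \<gamma> \<longleftrightarrow> open_interval J \<and> continuous_on J \<gamma> \<and>
    (\<forall>c\<in>A. smooth_on {t \<in> J. \<gamma> t \<in> cdom c} (coord c \<circ> \<gamma>))"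

definition velocity ::
  "('m, 'e::euclidean_space) chart set \<Rightarrow> (real \<Rightarrow> 'm) \<Rightarrow> real \<Rightarrow> ('m, 'e) tangent"
  where "velocity A \<gamma> t = (\<gamma> t,
    \<lambda>c. if c \<in> A \<and> \<gamma> t \<in> cdom c then vector_derivative (coord c \<circ> \<gamma>) (at t) else 0)"

definition smooth_vector_field ::
  "('m::topological_space, 'e::euclidean_space) chart set \<Rightarrow> 'm set \<Rightarrow>
    ('m \<Rightarrow> ('m, 'e) tangent) \<Rightarrow> bool"
  where "smooth_vector_field A U V \<longleftrightarrow> open U \<and>
    (\<forall>p\<in>U. V p \<in> tangent_bundle A \<and> base (V p) = p) \<and>
    (\<forall>c\<in>A. smooth_on (coord c ` (U \<inter> cdom c)) (\<lambda>x. comp_in c (V (param c x))))"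


section \<open>Affine connections\<close>

text \<open>A connection is given by its Christoffel symbols: in the chart \<open>c\<close>, the covariant derivative
  of a vector field \<open>Y\<close> in direction \<open>a\<close> at \<open>x\<close> is \<open>deriv_at Y x a + G c x a (Y x)\<close>. The third
  clause is the transformation law which makes this independent of the chart. The last clause
  only normalizes irrelevant values, so that equal connections are equal functions.\<close>

type_synonym ('m, 'e) christoffel = "('m, 'e) chart \<Rightarrow> 'e \<Rightarrow> 'e \<Rightarrow> 'e \<Rightarrow> 'e"

definition affine_connection ::
  "('m, 'e::euclidean_space) chart set \<Rightarrow> ('m, 'e) christoffel \<Rightarrow> bool"
  where "affine_connection A G \<longleftrightarrow>
    (\<forall>c\<in>A. \<forall>x\<in>crange c. bilinear (G c x)) \<and>
    (\<forall>c\<in>A. \<forall>a b. smooth_on (crange c) (\<lambda>x. G c x a b)) \<and>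
    (\<forall>c\<in>A. \<forall>c'\<in>A. \<forall>x\<in>coord c ` (cdom c \<inter> cdom c'). \<forall>a b.
       deriv_at (transition c c') x (G c x a b) =
         deriv2_at (transition c c') x a b +
         G c' (transition c c' x) (deriv_at (transition c c') x a) (deriv_at (transition c c') x b)) \<and>
    (\<forall>c x. \<not> (c \<in> A \<and> x \<in> crange c) \<longrightarrow> G c x = (\<lambda>a b. 0))"

definition torsion_free ::
  "('m, 'e::euclidean_space) chart set \<Rightarrow> ('m, 'e) christoffel \<Rightarrow> bool"
  where "torsion_free A G \<longleftrightarrow> (\<forall>c\<in>A. \<forall>x\<in>crange c. \<forall>a b. G c x a b = G c x b a)"

definition parallel_along ::
  "('m, 'e::euclidean_space) chart set \<Rightarrow> ('m, 'e) christoffel \<Rightarrow> real set \<Rightarrow> (real \<Rightarrow> 'm) \<Rightarrow>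
    (real \<Rightarrow> ('m, 'e) tangent) \<Rightarrow> bool"
  where "parallel_along A G J \<gamma> X \<longleftrightarrow>
    (\<forall>t\<in>J. X t \<in> tangent_bundle A \<and> base (X t) = \<gamma> t) \<and>
    (\<forall>c\<in>A. \<forall>t\<in>J. \<gamma> t \<in> cdom c \<longrightarrow>
       (\<lambda>s. comp_in c (X s)) differentiable (at t) \<and>
       vector_derivative (\<lambda>s. comp_in c (X s)) (at t) +
         G c (coord c (\<gamma> t)) (comp_in c (velocity A \<gamma> t)) (comp_in c (X t)) = 0)"

definition geodesic ::
  "('m::topological_space, 'e::euclidean_space) chart set \<Rightarrow> ('m, 'e) christoffel \<Rightarrow> real set \<Rightarrow>
    (real \<Rightarrow> 'm) \<Rightarrow> bool"
  where "geodesic A G J \<gamma> \<longleftrightarrow> smooth_curve A J \<gamma> \<and> parallel_along A G J \<gamma> (velocity A \<gamma>)"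


section \<open>Finsler structures and Berwald spaces\<close>

definition in_chart ::
  "('m, 'e::euclidean_space) chart set \<Rightarrow> (('m, 'e) tangent \<Rightarrow> real) \<Rightarrow> ('m, 'e) chart \<Rightarrow>
    'e \<Rightarrow> 'e \<Rightarrow> real"
  where "in_chart A F c x w = F (tangent_of A c x w)"

text \<open>The inner product \<open>g\<^sub>v\<close> for the vector \<open>v\<close> at \<open>x\<close> with component \<open>w\<close>, in the chart \<open>c\<close>.\<close>

definition fundamental_tensor ::
  "('m, 'e::euclidean_space) chart set \<Rightarrow> (('m, 'e) tangent \<Rightarrow> real) \<Rightarrow> ('m, 'e) chart \<Rightarrow>
    'e \<Rightarrow> 'e \<Rightarrow> 'e \<Rightarrow> 'e \<Rightarrow> real"
  where "fundamental_tensor A F c x w a b = deriv2_at (\<lambda>u. (in_chart A F c x u)\<^sup>2 / 2) w a b"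

definition finsler ::
  "('m, 'e::euclidean_space) chart set \<Rightarrow> (('m, 'e) tangent \<Rightarrow> real) \<Rightarrow> bool"
  where "finsler A F \<longleftrightarrow>
    (\<forall>v\<in>tangent_bundle A. 0 \<le> F v) \<and>
    (\<forall>c\<in>A. smooth_on (crange c \<times> (UNIV - {0})) (\<lambda>(x, w). in_chart A F c x w)) \<and>
    (\<forall>v\<in>tangent_bundle A. \<forall>r>0. F (scale_tangent r v) = r * F v) \<and>
    (\<forall>c\<in>A. \<forall>x\<in>crange c. \<forall>w. w \<noteq> 0 \<longrightarrow>
       (\<forall>a. a \<noteq> 0 \<longrightarrow> fundamental_tensor A F c x w a a > 0))"

text \<open>Since the curves are defined on open intervals, the condition covers parallel transport
  along all smooth curves on compact intervals.\<close>

definition transport_preserves ::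
  "('m::topological_space, 'e::euclidean_space) chart set \<Rightarrow> ('m, 'e) christoffel \<Rightarrow>
    (('m, 'e) tangent \<Rightarrow> real) \<Rightarrow> bool"
  where "transport_preserves A G F \<longleftrightarrow>
    (\<forall>J \<gamma> X. smooth_curve A J \<gamma> \<and> parallel_along A G J \<gamma> X \<longrightarrow> (\<forall>s\<in>J. \<forall>t\<in>J. F (X s) = F (X t)))"

definition is_induced_connection ::
  "('m::topological_space, 'e::euclidean_space) chart set \<Rightarrow> (('m, 'e) tangent \<Rightarrow> real) \<Rightarrow>
    ('m, 'e) christoffel \<Rightarrow> bool"
  where "is_induced_connection A F G \<longleftrightarrow>
    affine_connection A G \<and> torsion_free A G \<and> transport_preserves A G F"

definition berwald ::
  "('m::topological_space, 'e::euclidean_space) chart set \<Rightarrow> (('m, 'e) tangent \<Rightarrow> real) \<Rightarrow> bool"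
  where "berwald A F \<longleftrightarrow> finsler A F \<and> (\<exists>G. is_induced_connection A F G)"

definition induced_connection ::
  "('m::topological_space, 'e::euclidean_space) chart set \<Rightarrow> (('m, 'e) tangent \<Rightarrow> real) \<Rightarrow>
    ('m, 'e) christoffel"
  where "induced_connection A F = (THE G. is_induced_connection A F G)"

definition affinely_equivalent ::
  "('m::topological_space, 'e::euclidean_space) chart set \<Rightarrow> (('m, 'e) tangent \<Rightarrow> real) \<Rightarrow>
    (('m, 'e) tangent \<Rightarrow> real) \<Rightarrow> bool"
  where "affinely_equivalent A F F' \<longleftrightarrow> induced_connection A F = induced_connection A F'"


section \<open>Ricci curvature\<close>

text \<open>Here \<open>g\<close> is a Riemannian metric in local coordinates. The Levi-Civita Christoffel symbols
  are given by the Koszul formula for constant vector fields.\<close>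

definition levi_civita ::
  "('e::euclidean_space \<Rightarrow> 'e \<Rightarrow> 'e \<Rightarrow> real) \<Rightarrow> 'e \<Rightarrow> 'e \<Rightarrow> 'e \<Rightarrow> 'e"
  where "levi_civita g x a b = (THE z. \<forall>d. 2 * g x z d =
    deriv_at (\<lambda>y. g y b d) x a + deriv_at (\<lambda>y. g y a d) x b - deriv_at (\<lambda>y. g y a b) x d)"

definition curvature ::
  "('e::euclidean_space \<Rightarrow> 'e \<Rightarrow> 'e \<Rightarrow> 'e) \<Rightarrow> 'e \<Rightarrow> 'e \<Rightarrow> 'e \<Rightarrow> 'e \<Rightarrow> 'e"
  where "curvature G x a b d =
    deriv_at (\<lambda>y. G y b d) x a - deriv_at (\<lambda>y. G y a d) x b + G x a (G x b d) - G x b (G x a d)"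

definition ricci_tensor ::
  "('e::euclidean_space \<Rightarrow> 'e \<Rightarrow> 'e \<Rightarrow> real) \<Rightarrow> 'e \<Rightarrow> 'e \<Rightarrow> 'e \<Rightarrow> real"
  where "ricci_tensor g x a b = (\<Sum>i\<in>Basis. curvature (levi_civita g) x i a b \<bullet> i)"

definition geodesic_extension ::
  "('m::topological_space, 'e::euclidean_space) chart set \<Rightarrow> (('m, 'e) tangent \<Rightarrow> real) \<Rightarrow>
    ('m, 'e) tangent \<Rightarrow> 'm set \<Rightarrow> ('m \<Rightarrow> ('m, 'e) tangent) \<Rightarrow> bool"
  where "geodesic_extension A F v U V \<longleftrightarrow>
    smooth_vector_field A U V \<and> base v \<in> U \<and> V (base v) = v \<and>
    (\<forall>p\<in>U. V p \<noteq> zero_tangent p) \<and>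
    (\<forall>J \<gamma>. smooth_curve A J \<gamma> \<and> (\<forall>t\<in>J. \<gamma> t \<in> U \<and> velocity A \<gamma> t = V (\<gamma> t)) \<longrightarrow>
       geodesic A (induced_connection A F) J \<gamma>)"

definition finsler_ricci ::
  "('m::topological_space, 'e::euclidean_space) chart set \<Rightarrow> (('m, 'e) tangent \<Rightarrow> real) \<Rightarrow>
    ('m, 'e) tangent \<Rightarrow> real"
  where "finsler_ricci A F v =
    (if v = zero_tangent (base v) then 0
     else THE r. \<exists>U V. \<exists>c\<in>A. geodesic_extension A F v U V \<and> base v \<in> cdom c \<and>
       r = ricci_tensor (\<lambda>x. fundamental_tensor A F c x (comp_in c (V (param c x))))
             (coord c (base v)) (comp_in c v) (comp_in c v))"


section \<open>Smooth measures and weighted Ricci curvature\<close>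

definition smooth_density ::
  "'m::topological_space measure \<Rightarrow> ('m, 'e::euclidean_space) chart \<Rightarrow> ('e \<Rightarrow> real) \<Rightarrow> bool"
  where "smooth_density \<mu> c \<rho> \<longleftrightarrow>
    smooth_on (crange c) \<rho> \<and> (\<forall>x\<in>crange c. 0 < \<rho> x) \<and>
    (\<forall>B\<in>sets borel. B \<subseteq> cdom c \<longrightarrow>
       emeasure \<mu> B = (\<integral>\<^sup>+x. ennreal (\<rho> x) * indicator (coord c ` B) x \<partial>lborel))"

definition smooth_measure ::
  "('m::topological_space, 'e::euclidean_space) chart set \<Rightarrow> 'm measure \<Rightarrow> bool"
  where "smooth_measure A \<mu> \<longleftrightarrow> sets \<mu> = sets borel \<and> (\<forall>c\<in>A. \<exists>\<rho>. smooth_density \<mu> c \<rho>)"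

definition busemann_hausdorff ::
  "('m::topological_space, 'e::euclidean_space) chart set \<Rightarrow> (('m, 'e) tangent \<Rightarrow> real) \<Rightarrow>
    'm measure"
  where "busemann_hausdorff A F = (THE \<mu>. sets \<mu> = sets borel \<and>
    (\<forall>c\<in>A. \<exists>\<rho>. smooth_density \<mu> c \<rho> \<and>
       (\<forall>x\<in>crange c. \<rho> x * measure lborel {w. in_chart A F c x w < 1} =
          measure lborel (ball (0::'e) 1))))"

definition weight_function ::
  "('m::topological_space, 'e::euclidean_space) chart set \<Rightarrow> (('m, 'e) tangent \<Rightarrow> real) \<Rightarrow>
    'm measure \<Rightarrow> 'm \<Rightarrow> real"
  where "weight_function A F m = (THE \<Psi>. smooth_fun A \<Psi> \<and>
    m = density (busemann_hausdorff A F) (\<lambda>p. ennreal (exp (- \<Psi> p))))"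

text \<open>Geodesics with the same initial vector agree near \<open>0\<close>, so the derivatives at \<open>0\<close> below
  do not depend on the choice.\<close>

definition geodesic_from ::
  "('m::topological_space, 'e::euclidean_space) chart set \<Rightarrow> (('m, 'e) tangent \<Rightarrow> real) \<Rightarrow>
    ('m, 'e) tangent \<Rightarrow> real \<Rightarrow> 'm"
  where "geodesic_from A F v =
    (SOME \<eta>. \<exists>J. 0 \<in> J \<and> geodesic A (induced_connection A F) J \<eta> \<and> velocity A \<eta> 0 = v)"

text \<open>Only meaningful for \<open>DIM('e) \<le> N\<close>. The last term is added here, whereas many authors subtract it.\<close>

definition weighted_ricci ::
  "('m::topological_space, 'e::euclidean_space) chart set \<Rightarrow> (('m, 'e) tangent \<Rightarrow> real) \<Rightarrow>
    'm measure \<Rightarrow> ereal \<Rightarrow> ('m, 'e) tangent \<Rightarrow> ereal"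
  where "weighted_ricci A F m N v =
    (let n = real DIM('e);
         h = weight_function A F m \<circ> geodesic_from A F v;
         h1 = deriv h 0;
         h2 = deriv (deriv h) 0
     in if N = ereal n then
          (if h1 = 0 then ereal (finsler_ricci A F v + h2) else - \<infinity>)
        else if N = \<infinity> then ereal (finsler_ricci A F v + h2)
        else ereal (finsler_ricci A F v + h2 + h1\<^sup>2 / (real_of_ereal N - n)))"

end

theory Submission
  imports Defs
begin

text \<open>Let \<open>\<nabla>\<close> be the common induced connection. In a chart, \<open>F\<close> is annihilated by the horizontal
  derivatives of \<open>\<nabla>\<close>; this determines \<open>\<nabla>\<close>, so the induced connection is well-defined.

  For a nonvanishing geodesic field \<open>W\<close>, the Levi-Civita connection of \<open>g\<^sub>W\<close> differs from \<open>\<nabla>\<close> by a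
  tensor annihilating \<open>W\<close>, whence \<open>Ric(v)\<close> is the trace of \<open>a \<mapsto> R(a, v)v\<close> for the curvature \<open>R\<close>
  of \<open>\<nabla>\<close> and does not involve \<open>F\<close>.

  The volume of the unit ball of \<open>F\<close> at \<open>x\<close> has logarithmic derivative \<open>- tr G x a\<close>, where \<open>G\<close> are the
  Christoffel symbols of \<open>\<nabla>\<close>. So the Busemann-Hausdorff measures of \<open>F\<close> and \<open>F'\<close> are proportional
  and the weight functions differ by a constant, which disappears in the derivatives.\<close>

section \<open>Calculus of smooth maps\<close>

text \<open>The induced connection, the Busemann-Hausdorff measure and the weight function are
  descriptions that have to be resolved by existence and uniqueness. The Ricci curvature and the
  initial geodesic are chosen by predicates that turn out to be equivalent for \<open>F\<close> and
  \<open>F'\<close>, so that it suffices to compare the predicates.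

  No measure is glued together from charts. Since \<open>m\<close> is already a global measure, the
  Busemann-Hausdorff measure is obtained from it by a density, and the point is that this density
  does not depend on the chart; small balls of \<open>F\<close> around a point serve as test sets
  for that.

  The volume of the unit ball is not differentiated under an integral sign. Parallel transport is
  linear and maps unit balls to unit balls, so its first-order part \<open>w - G x a w\<close> maps
  the unit ball at \<open>x\<close> onto a set lying between two multiples, close to 1, of the unit
  ball at \<open>x + a\<close>. The volume of that set is given by a determinant, which is where the
  trace comes from. As the trace is smooth in \<open>x\<close>, the formula for the first derivative
  also yields smoothness of the logarithmic volume.\<close>

lemma has_derivative_deriv_at:
  assumes "f differentiable (at x)"
  shows "(f has_derivative (\<lambda>a. deriv_at f x a)) (at x)"
  using assms frechet_derivative_works by blast

lemma deriv_at_eqI: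
  assumes "(f has_derivative f') (at x)"
  shows "deriv_at f x a = f' a"
  using frechet_derivative_at[OF assms] by simp

lemma deriv_at_cong:
  assumes "open S" "x \<in> S" "\<And>y. y \<in> S \<Longrightarrow> f y = g y"
  shows "deriv_at f x a = deriv_at g x a"
proof -
  have "(f has_derivative D) (at x) \<longleftrightarrow> (g has_derivative D) (at x)" for D
    using has_derivative_transform_within_open[of f D x UNIV S g]
      has_derivative_transform_within_open[of g D x UNIV S f] assms by auto
  then show ?thesis by (simp add: frechet_derivative_def)
qed

section \<open>Differentiability classes of finite order\<close>

lemma Ck_on_subset: "Ck_on k S f \<Longrightarrow> T \<subseteq> S \<Longrightarrow> Ck_on k T f"
  by (induction k arbitrary: f) (auto intro: continuous_on_subset)

lemma Ck_on_cong:
  assumes "open S" "\<And>x. x \<in> S \<Longrightarrow> f x = g x" "Ck_on k S f"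
  shows "Ck_on k S g"
  using assms(2,3)
proof (induction k arbitrary: f g)
  case 0
  then show ?case by (simp cong: continuous_on_cong)
next
  case (Suc k)
  have "g differentiable (at x)" if x: "x \<in> S" for x
  proof -
    obtain D where "(f has_derivative D) (at x)"
      using Suc.prems(2) x by (auto simp: differentiable_def)
    then show ?thesis
      using has_derivative_transform_within_open[of f D x UNIV S g] Suc.prems(1) that assms(1)
      by (auto simp: differentiable_def)
  qed
  moreover have "Ck_on k S (\<lambda>x. deriv_at g x a)" for a
  proof (rule Suc.IH)
    show "deriv_at f x a = deriv_at g x a" if "x \<in> S" for x
      using deriv_at_cong[OF assms(1) that Suc.prems(1)] .
  qed (use Suc.prems(2) in auto)
  ultimately show ?case by simp
qed

lemma Ck_on_imp_continuous_on: "Ck_on k S f \<Longrightarrow> continuous_on S f"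
  by (cases k) (auto simp: continuous_on_eq_continuous_within
      intro!: continuous_at_imp_continuous_at_within[OF differentiable_imp_continuous_within])

lemma Ck_on_SucD: "Ck_on (Suc k) S f \<Longrightarrow> Ck_on k S f"
proof (induction k arbitrary: f)
  case 0
  then show ?case using Ck_on_imp_continuous_on[of "Suc 0"] by simp
qed auto

text \<open>Replaces \<open>frechet_derivative\<close> by any explicit formula for the derivative.
  Most closure properties below are inductions on \<open>k\<close> whose step is this rule.\<close>

lemma Ck_on_SucI:
  assumes "open S" "\<And>x. x \<in> S \<Longrightarrow> (f has_derivative f' x) (at x)"
    "\<And>a. Ck_on k S (\<lambda>x. f' x a)"
  shows "Ck_on (Suc k) S f"
proof -
  have "Ck_on k S (\<lambda>x. deriv_at f x a)" for a
    by (rule Ck_on_cong[OF assms(1) _ assms(3)[of a]]) (use assms(2) deriv_at_eqI in metis)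
  then show ?thesis using assms(2) by (auto simp: differentiable_def)
qed

lemma Ck_on_const: "open S \<Longrightarrow> Ck_on k S (\<lambda>x. c)"
proof (induction k arbitrary: c)
  case (Suc k)
  show ?case by (rule Ck_on_SucI[where f' = "\<lambda>x a. 0"]) (use Suc in auto)
qed simp

lemma Ck_on_bounded_linear:
  assumes "open S" "bounded_linear l"
  shows "Ck_on k S l"
proof (cases k)
  case 0
  then show ?thesis using assms by (simp add: linear_continuous_on)
next
  case (Suc k')
  show ?thesis unfolding Suc
    by (rule Ck_on_SucI[where f' = "\<lambda>x. l"])
      (use assms in \<open>auto intro: Ck_on_const bounded_linear_imp_has_derivative\<close>)
qed

lemma Ck_on_bounded_linear_compose:
  assumes "open S" "bounded_linear l" "Ck_on k S f"
  shows "Ck_on k S (\<lambda>x. l (f x))"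
  using assms(3)
proof (induction k arbitrary: f)
  case 0
  then show ?case using assms(2) by (simp add: bounded_linear.continuous_on)
next
  case (Suc k)
  show ?case
    by (rule Ck_on_SucI[OF assms(1), where f' = "\<lambda>x a. l (deriv_at f x a)"])
      (use Suc assms(2) in \<open>auto intro: bounded_linear.has_derivative has_derivative_deriv_at\<close>)
qed

lemma Ck_on_add:
  assumes "open S" "Ck_on k S f" "Ck_on k S g"
  shows "Ck_on k S (\<lambda>x. f x + g x)"
  using assms(2,3)
proof (induction k arbitrary: f g)
  case 0
  then show ?case by (simp add: continuous_on_add)
next
  case (Suc k)
  show ?case
    by (rule Ck_on_SucI[OF assms(1), where f' = "\<lambda>x a. deriv_at f x a + deriv_at g x a"])
      (use Suc in \<open>auto intro!: has_derivative_add[OF has_derivative_deriv_at has_derivative_deriv_at]\<close>)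
qed

lemma Ck_on_bounded_bilinear:
  assumes "open S" "bounded_bilinear m" "Ck_on k S f" "Ck_on k S g"
  shows "Ck_on k S (\<lambda>x. m (f x) (g x))"
  using assms(3,4)
proof (induction k arbitrary: f g)
  case 0
  then show ?case using assms(2) by (simp add: bounded_bilinear.continuous_on)
next
  case (Suc k)
  show ?case
  proof (rule Ck_on_SucI[OF assms(1), where f' =
      "\<lambda>x a. m (f x) (deriv_at g x a) + m (deriv_at f x a) (g x)"])
    show "((\<lambda>x. m (f x) (g x)) has_derivative
        (\<lambda>a. m (f x) (deriv_at g x a) + m (deriv_at f x a) (g x))) (at x)" if "x \<in> S" for x
      by (rule bounded_bilinear.FDERIV[OF assms(2)])
        (use Suc.prems that in \<open>auto intro: has_derivative_deriv_at\<close>)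
    show "Ck_on k S (\<lambda>x. m (f x) (deriv_at g x a) + m (deriv_at f x a) (g x))" for a
      using Suc.prems Ck_on_SucD[OF Suc.prems(1)] Ck_on_SucD[OF Suc.prems(2)]
      by (intro Ck_on_add assms(1) Suc.IH) auto
  qed
qed

lemma Ck_on_sum:
  assumes "open S" "\<And>i. i \<in> I \<Longrightarrow> Ck_on k S (f i)"
  shows "Ck_on k S (\<lambda>x. \<Sum>i\<in>I. f i x)"
  using assms(2) by (induction I rule: infinite_finite_induct)
    (auto intro!: Ck_on_const Ck_on_add assms(1))

lemma linear_expansion:
  assumes "linear f"
  shows "f u = (\<Sum>i\<in>Basis. (u \<bullet> i) *\<^sub>R f i)"
proof -
  have "f u = f (\<Sum>i\<in>Basis. (u \<bullet> i) *\<^sub>R i)" by (simp only: euclidean_representation)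
  also have "\<dots> = (\<Sum>i\<in>Basis. (u \<bullet> i) *\<^sub>R f i)"
    by (simp only: linear_sum[OF assms] linear_scale[OF assms])
  finally show ?thesis .
qed

text \<open>In the chain rule the direction \<open>deriv_at g x a\<close> varies with
  \<open>x\<close>, whereas \<open>Ck_on\<close> speaks of derivatives in fixed directions.
  Expanding the direction in a basis reduces to these, which is why \<open>g\<close> takes values in
  a Euclidean space.\<close>

lemma Ck_on_compose:
  fixes g :: "'a::real_normed_vector \<Rightarrow> 'b::euclidean_space"
  assumes "open S" "open T" "g ` S \<subseteq> T" "Ck_on k T f" "Ck_on k S g"
  shows "Ck_on k S (\<lambda>x. f (g x))"
  using assms(4,5)
proof (induction k arbitrary: f)
  case 0
  then show ?case using assms(3) by (auto intro: continuous_on_compose2)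
next
  case (Suc k)
  show ?case
  proof (rule Ck_on_SucI[OF assms(1), where
        f' = "\<lambda>x a. \<Sum>i\<in>Basis. (deriv_at g x a \<bullet> i) *\<^sub>R deriv_at f (g x) i"])
    show "((\<lambda>x. f (g x)) has_derivative
        (\<lambda>a. \<Sum>i\<in>Basis. (deriv_at g x a \<bullet> i) *\<^sub>R deriv_at f (g x) i)) (at x)" if "x \<in> S" for x
    proof -
      have f: "(f has_derivative deriv_at f (g x)) (at (g x))"
        using Suc.prems that assms(3) by (intro has_derivative_deriv_at) auto
      have "linear (deriv_at f (g x))" using f has_derivative_linear by blast
      then have "(\<lambda>a. deriv_at f (g x) (deriv_at g x a)) =
          (\<lambda>a. \<Sum>i\<in>Basis. (deriv_at g x a \<bullet> i) *\<^sub>R deriv_at f (g x) i)"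
        by (intro ext linear_expansion)
      moreover have "((\<lambda>x. f (g x)) has_derivative (\<lambda>a. deriv_at f (g x) (deriv_at g x a))) (at x)"
        using diff_chain_at[OF has_derivative_deriv_at[of g x] f] Suc.prems that
        by (auto simp: o_def)
      ultimately show ?thesis by (metis has_derivative_eq_rhs)
    qed
    show "Ck_on k S (\<lambda>x. \<Sum>i\<in>Basis. (deriv_at g x a \<bullet> i) *\<^sub>R deriv_at f (g x) i)" for a
      using Suc.prems Ck_on_SucD[OF Suc.prems(2)]
      by (intro Ck_on_sum assms(1) Ck_on_bounded_bilinear[OF assms(1) bounded_bilinear_scaleR] Suc.IH
          Ck_on_bounded_linear_compose[OF assms(1) bounded_linear_inner_left]) auto
  qed
qed

section \<open>Smooth maps, with the exponential, inverse and logarithm\<close>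

lemma smooth_on_subset: "smooth_on S f \<Longrightarrow> T \<subseteq> S \<Longrightarrow> smooth_on T f"
  by (auto simp: smooth_on_def intro: Ck_on_subset)

lemma smooth_on_cong: "open S \<Longrightarrow> (\<And>x. x \<in> S \<Longrightarrow> f x = g x) \<Longrightarrow> smooth_on S f \<Longrightarrow> smooth_on S g"
  unfolding smooth_on_def using Ck_on_cong[of S f g] by blast

lemma smooth_on_has_derivative:
  "smooth_on S f \<Longrightarrow> x \<in> S \<Longrightarrow> (f has_derivative (\<lambda>a. deriv_at f x a)) (at x)"
  using has_derivative_deriv_at[of f x] by (auto simp: smooth_on_def dest: spec[of _ "Suc 0"])

lemma linear_deriv_at: "smooth_on S f \<Longrightarrow> x \<in> S \<Longrightarrow> linear (\<lambda>a. deriv_at f x a)"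
  using smooth_on_has_derivative has_derivative_linear by blast

lemma smooth_on_continuous_on: "smooth_on S f \<Longrightarrow> continuous_on S f"
  by (auto simp: smooth_on_def dest: spec[of _ 0])

lemma smooth_on_deriv_at: "smooth_on S f \<Longrightarrow> smooth_on S (\<lambda>x. deriv_at f x a)"
  unfolding smooth_on_def by (metis Ck_on.simps(2))

lemma smooth_onI:
  assumes "open S" "\<And>x. x \<in> S \<Longrightarrow> (f has_derivative f' x) (at x)"
    "\<And>a. smooth_on S (\<lambda>x. f' x a)"
  shows "smooth_on S f"
  unfolding smooth_on_def
  using Ck_on_SucI[of S f f'] assms Ck_on_SucD unfolding smooth_on_def by blast

lemma smooth_on_const: "open S \<Longrightarrow> smooth_on S (\<lambda>x. c)"
  by (simp add: smooth_on_def Ck_on_const)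

lemma smooth_on_bounded_linear: "open S \<Longrightarrow> bounded_linear l \<Longrightarrow> smooth_on S l"
  by (simp add: smooth_on_def Ck_on_bounded_linear)

lemma smooth_on_bounded_linear_compose:
  "open S \<Longrightarrow> bounded_linear l \<Longrightarrow> smooth_on S f \<Longrightarrow> smooth_on S (\<lambda>x. l (f x))"
  by (simp add: smooth_on_def Ck_on_bounded_linear_compose)

lemma smooth_on_add:
  "open S \<Longrightarrow> smooth_on S f \<Longrightarrow> smooth_on S g \<Longrightarrow> smooth_on S (\<lambda>x. f x + g x)"
  by (simp add: smooth_on_def Ck_on_add)

lemma smooth_on_minus:
  "open S \<Longrightarrow> smooth_on S f \<Longrightarrow> smooth_on S (\<lambda>x. - f x)"
  by (rule smooth_on_bounded_linear_compose[of S uminus]) (auto simp: bounded_linear_minus)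

lemma smooth_on_diff:
  "open S \<Longrightarrow> smooth_on S f \<Longrightarrow> smooth_on S g \<Longrightarrow> smooth_on S (\<lambda>x. f x - g x)"
  using smooth_on_add[OF _ _ smooth_on_minus, of S f g] by simp

lemma smooth_on_sum:
  "open S \<Longrightarrow> (\<And>i. i \<in> I \<Longrightarrow> smooth_on S (f i)) \<Longrightarrow> smooth_on S (\<lambda>x. \<Sum>i\<in>I. f i x)"
  by (simp add: smooth_on_def Ck_on_sum)

lemma smooth_on_bounded_bilinear:
  "open S \<Longrightarrow> bounded_bilinear m \<Longrightarrow> smooth_on S f \<Longrightarrow> smooth_on S g \<Longrightarrow>
    smooth_on S (\<lambda>x. m (f x) (g x))"
  by (simp add: smooth_on_def Ck_on_bounded_bilinear)

lemmas smooth_on_mult = smooth_on_bounded_bilinear[OF _ bounded_bilinear_mult]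
  and smooth_on_scaleR = smooth_on_bounded_bilinear[OF _ bounded_bilinear_scaleR]

lemma smooth_on_compose:
  fixes g :: "'a::real_normed_vector \<Rightarrow> 'b::euclidean_space"
  shows "open S \<Longrightarrow> open T \<Longrightarrow> g ` S \<subseteq> T \<Longrightarrow> smooth_on T f \<Longrightarrow> smooth_on S g \<Longrightarrow>
    smooth_on S (\<lambda>x. f (g x))"
  by (simp add: smooth_on_def Ck_on_compose)

lemma smooth_on_exp: "smooth_on UNIV (exp :: real \<Rightarrow> real)"
proof -
  have "Ck_on k UNIV (exp :: real \<Rightarrow> real)" for k
  proof (induction k)
    case (Suc k)
    show ?case
      by (rule Ck_on_SucI[where f' = "\<lambda>x a. a * exp x"])
        (auto intro!: Ck_on_bounded_linear_compose[OF _ bounded_linear_mult_right] Suc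
          derivative_eq_intros)
  qed (simp add: continuous_on_exp)
  then show ?thesis by (simp add: smooth_on_def)
qed

lemma smooth_on_inverse: "smooth_on {0<..} (inverse :: real \<Rightarrow> real)"
proof -
  have "Ck_on k {0<..} (inverse :: real \<Rightarrow> real)" for k
  proof (induction k)
    case (Suc k)
    show ?case
    proof (rule Ck_on_SucI[where f' = "\<lambda>x a. - a * (inverse x * inverse x)"])
      show "(inverse has_derivative (\<lambda>a. - a * (inverse x * inverse x))) (at x)"
        if "x \<in> {0<..}" for x :: real
        using that by (auto intro!: derivative_eq_intros simp: algebra_simps)
      show "Ck_on k {0<..} (\<lambda>x. - a * (inverse x * inverse x))" for a :: real
        by (intro Ck_on_bounded_linear_compose[OF _ bounded_linear_mult_right]
            Ck_on_bounded_bilinear[OF _ bounded_bilinear_mult] Suc) auto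
    qed auto
  qed (auto intro!: continuous_intros)
  then show ?thesis by (simp add: smooth_on_def)
qed

lemma smooth_on_ln: "smooth_on {0<..} (ln :: real \<Rightarrow> real)"
  by (rule smooth_onI[where f' = "\<lambda>x a. a * inverse x"])
    (auto intro!: derivative_eq_intros smooth_on_bounded_linear_compose[OF _ bounded_linear_mult_right]
      smooth_on_inverse simp: divide_inverse)

text \<open>Evaluating the second difference quotient by two mean value theorems in either order
  yields both iterated derivatives as limits.\<close>

lemma deriv_at_commute:
  fixes f :: "'a::real_normed_vector \<Rightarrow> real"
  assumes "open S" "smooth_on S f" "x \<in> S"
  shows "deriv2_at f x a b = deriv2_at f x b a"
proof -
  have *: "\<exists>p\<in>ball x d. (f (x + s *\<^sub>R a + s *\<^sub>R b) - f (x + s *\<^sub>R a) - f (x + s *\<^sub>R b) + f x) =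
      s * s * deriv2_at f p b a"
    if d: "ball x d \<subseteq> S" and s: "0 < s" "s * (norm a + norm b) < d" for s d a b
  proof -
    have inS: "x + p *\<^sub>R a + q *\<^sub>R b \<in> ball x d" if "0 \<le> p" "p \<le> s" "0 \<le> q" "q \<le> s" for p q
    proof -
      have "norm (p *\<^sub>R a + q *\<^sub>R b) \<le> s * norm a + s * norm b"
        using that by (intro order_trans[OF norm_triangle_ineq] add_mono) (auto intro: mult_right_mono)
      then show ?thesis using s norm_minus_cancel[of "p *\<^sub>R a + q *\<^sub>R b"]
        by (simp add: dist_norm algebra_simps)
    qed
    have D: "((\<lambda>p. h (z + p *\<^sub>R u)) has_real_derivative deriv_at h (z + p *\<^sub>R u) u) (at p)"
      if h: "smooth_on S h" and z: "z + p *\<^sub>R u \<in> S" for h z u p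
    proof -
      have "((\<lambda>p. h (z + p *\<^sub>R u)) has_derivative (\<lambda>r. deriv_at h (z + p *\<^sub>R u) (r *\<^sub>R u))) (at p)"
        by (rule has_derivative_compose[of "\<lambda>p. z + p *\<^sub>R u" "\<lambda>r. r *\<^sub>R u" p UNIV h])
          (use smooth_on_has_derivative[OF h z] in \<open>auto intro!: derivative_eq_intros\<close>)
      then show ?thesis
        using linear_scale[OF linear_deriv_at[OF h z]]
        by (auto intro: has_derivative_imp_has_field_derivative)
    qed
    have S: "x + p *\<^sub>R a + q *\<^sub>R b \<in> S" "x + q *\<^sub>R b + p *\<^sub>R a \<in> S" "x + p *\<^sub>R a \<in> S"
      if "0 \<le> p" "p \<le> s" "0 \<le> q" "q \<le> s" for p q
      using inS[OF that] inS[of p 0] that d by (auto simp: add_ac)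
    define \<phi> where "\<phi> p = f (x + s *\<^sub>R b + p *\<^sub>R a) - f (x + p *\<^sub>R a)" for p
    have "\<exists>p. 0 < p \<and> p < s \<and>
        \<phi> s - \<phi> 0 = (s - 0) * (deriv_at f (x + s *\<^sub>R b + p *\<^sub>R a) a - deriv_at f (x + p *\<^sub>R a) a)"
      unfolding \<phi>_def using s S by (intro MVT2 DERIV_diff D assms(2)) auto
    then obtain p where p: "0 < p" "p < s"
      "\<phi> s - \<phi> 0 = s * (deriv_at f (x + s *\<^sub>R b + p *\<^sub>R a) a - deriv_at f (x + p *\<^sub>R a) a)" by auto
    have "\<exists>q. 0 < q \<and> q < s \<and>
        deriv_at f (x + p *\<^sub>R a + s *\<^sub>R b) a - deriv_at f (x + p *\<^sub>R a + 0 *\<^sub>R b) a =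
        (s - 0) * deriv2_at f (x + p *\<^sub>R a + q *\<^sub>R b) b a"
      using s p S by (intro MVT2 D smooth_on_deriv_at assms(2)) auto
    then obtain q where q: "0 < q" "q < s"
      "deriv_at f (x + p *\<^sub>R a + s *\<^sub>R b) a - deriv_at f (x + p *\<^sub>R a) a =
        s * deriv2_at f (x + p *\<^sub>R a + q *\<^sub>R b) b a" by auto
    have comm: "x + p *\<^sub>R a + s *\<^sub>R b = x + s *\<^sub>R b + p *\<^sub>R a"
      "x + s *\<^sub>R a + s *\<^sub>R b = x + s *\<^sub>R b + s *\<^sub>R a" by (simp_all add: add_ac)
    show ?thesis
      using inS[of p q] p q unfolding comm
      by (intro bexI[of _ "x + p *\<^sub>R a + q *\<^sub>R b"]) (auto simp: \<phi>_def)
  qed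
  have cont: "isCont (\<lambda>x. deriv2_at f x a b) x" for a b
    using smooth_on_continuous_on[OF smooth_on_deriv_at[OF smooth_on_deriv_at[OF assms(2)]]] assms(1,3)
    by (simp add: continuous_on_eq_continuous_at)
  have "\<bar>deriv2_at f x a b - deriv2_at f x b a\<bar> \<le> 0 + e" if "e > 0" for e
  proof -
    have ev: "\<forall>\<^sub>F p in nhds x. \<bar>deriv2_at f p a b - deriv2_at f x a b\<bar> < e / 2" for a b
    proof -
      have "((\<lambda>x. deriv2_at f x a b) \<longlongrightarrow> deriv2_at f x a b) (nhds x)"
        using cont[of b a] tendsto_at_iff_tendsto_nhds[of "\<lambda>x. deriv2_at f x a b" x]
        by (simp add: isCont_def)
      from tendstoD[OF this, of "e / 2"] that show ?thesis by (simp add: dist_real_def)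
    qed
    have "\<forall>\<^sub>F p in nhds x. p \<in> S \<and> \<bar>deriv2_at f p a b - deriv2_at f x a b\<bar> < e / 2 \<and>
      \<bar>deriv2_at f p b a - deriv2_at f x b a\<bar> < e / 2"
      using assms(1,3) ev by (intro eventually_conj) (auto intro: eventually_nhds_in_open)
    then obtain d where d: "d > 0" "\<And>p. p \<in> ball x d \<Longrightarrow> p \<in> S \<and> \<bar>deriv2_at f p a b - deriv2_at f x a b\<bar> <
        e / 2 \<and>
      \<bar>deriv2_at f p b a - deriv2_at f x b a\<bar> < e / 2"
      by (auto simp: eventually_nhds_metric dist_commute)
    \<comment> \<open>The summand 1 keeps \<open>K\<close> positive for \<open>a = b = 0\<close>;
      the choice of \<open>s\<close> below makes the parallelogram with sides
      \<open>s *\<^sub>R a\<close> and \<open>s *\<^sub>R b\<close> fit into the ball.\<close>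
    define K where "K = norm a + norm b + 1"
    have K: "K > 0" "norm a + norm b < K"
      using norm_ge_zero[of a] norm_ge_zero[of b] unfolding K_def by linarith+
    define s where "s = d / (2 * K)"
    have s: "0 < s" "s * (norm a + norm b) < d"
    proof -
      show "0 < s" using d K by (simp add: s_def)
      have "s * (norm a + norm b) < s * K" using \<open>0 < s\<close> K by simp
      also have "\<dots> = d / 2" using K by (simp add: s_def)
      finally show "s * (norm a + norm b) < d" using d by simp
    qed
    have sub: "ball x d \<subseteq> S" using d by blast
    obtain p where p: "p \<in> ball x d" "f (x + s *\<^sub>R a + s *\<^sub>R b) - f (x + s *\<^sub>R a) - f (x + s *\<^sub>R b) + f x =
        s * s * deriv2_at f p b a"
      using *[OF sub s] by blast
    obtain q where q: "q \<in> ball x d" "f (x + s *\<^sub>R b + s *\<^sub>R a) - f (x + s *\<^sub>R b) - f (x + s *\<^sub>R a) + f x =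
        s * s * deriv2_at f q a b"
      using *[OF sub, of s b a] s by (auto simp: add.commute)
    have "s * s * deriv2_at f p b a = s * s * deriv2_at f q a b"
      using p(2) q(2) by (simp add: algebra_simps)
    then have eq: "deriv2_at f p b a = deriv2_at f q a b"
      using s(1) mult_cancel_left[of "s * s"] by simp
    have "\<bar>deriv2_at f p b a - deriv2_at f x b a\<bar> < e / 2" using d(2)[OF p(1)] by blast
    moreover have "\<bar>deriv2_at f q a b - deriv2_at f x a b\<bar> < e / 2" using d(2)[OF q(1)] by blast
    ultimately show ?thesis unfolding eq by linarith
  qed
  then have "\<bar>deriv2_at f x a b - deriv2_at f x b a\<bar> \<le> 0"
    by (rule field_le_epsilon)
  then show ?thesis by simp
qed

section \<open>Ordinary differential equations\<close>

text \<open>The operator norm of the derivative is at most the sum of the norms of the partial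
  derivatives. This sum is continuous, hence bounded on a compact ball, and the ball is
  convex.\<close>

lemma smooth_on_imp_lipschitz_on_cball:
  fixes f :: "'a::euclidean_space \<Rightarrow> 'b::real_normed_vector"
  assumes "open S" "smooth_on S f" "x \<in> S"
  obtains r L where "r > 0" "cball x r \<subseteq> S" "L-lipschitz_on (cball x r) f"
proof -
  obtain r where r: "r > 0" "cball x r \<subseteq> S"
    using assms open_contains_cball by blast
  have "continuous_on (cball x r) (\<lambda>y. \<Sum>i\<in>Basis. norm (deriv_at f y i))"
    by (intro continuous_on_sum continuous_on_norm
        continuous_on_subset[OF smooth_on_continuous_on[OF smooth_on_deriv_at[OF assms(2)]] r(2)])
  then have "bdd_above ((\<lambda>y. \<Sum>i\<in>Basis. norm (deriv_at f y i)) ` cball x r)"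
    by (intro bounded_imp_bdd_above compact_imp_bounded compact_continuous_image compact_cball)
  then obtain B where B: "\<And>y. y \<in> cball x r \<Longrightarrow> (\<Sum>i\<in>Basis. norm (deriv_at f y i)) \<le> B"
    unfolding bdd_above_def by blast
  have B0: "0 \<le> B"
    using B[of x] r sum_nonneg[of Basis "\<lambda>i. norm (deriv_at f x i)"] by (auto intro: order_trans)
  have "norm (f y - f z) \<le> B * norm (y - z)" if "y \<in> cball x r" "z \<in> cball x r" for y z
  proof (rule differentiable_bound[OF convex_cball _ _ that])
    show "(f has_derivative (\<lambda>a. deriv_at f y a)) (at y within cball x r)" if "y \<in> cball x r" for y
      using smooth_on_has_derivative[OF assms(2)] r that has_derivative_at_withinI by blast
    show "onorm (\<lambda>a. deriv_at f y a) \<le> B" if "y \<in> cball x r" for y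
    proof (rule onorm_le)
      fix u
      have lin: "linear (\<lambda>a. deriv_at f y a)"
        using linear_deriv_at[OF assms(2)] that r by blast
      have "norm (deriv_at f y u) = norm (\<Sum>i\<in>Basis. (u \<bullet> i) *\<^sub>R deriv_at f y i)"
        using linear_expansion[OF lin, of u] by (rule arg_cong)
      also have "\<dots> \<le> (\<Sum>i\<in>Basis. norm (deriv_at f y i) * norm u)"
      proof (rule sum_norm_le)
        fix i :: 'a assume "i \<in> Basis"
        then show "norm ((u \<bullet> i) *\<^sub>R deriv_at f y i) \<le> norm (deriv_at f y i) * norm u"
          using Basis_le_norm[of i u] by (simp add: mult.commute mult_right_mono)
      qed
      also have "\<dots> \<le> B * norm u"
        using B[OF that] by (simp add: sum_distrib_right[symmetric] mult_right_mono)
      finally show "norm (deriv_at f y u) \<le> B * norm u" .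
    qed
  qed
  then have "B-lipschitz_on (cball x r) f"
    using B0 by (auto simp: lipschitz_on_def dist_norm)
  with r show ?thesis using that by blast
qed

text \<open>Picard's theorem from Banach's fixed point theorem in the space of bounded continuous
  functions on the line. The global bound \<open>B\<close> on the field keeps the solution within
  distance \<open>e\<close> of \<open>x\<close>.\<close>

lemma ode_exists_lipschitz:
  fixes f :: "'a::euclidean_space \<Rightarrow> 'a"
  assumes "L-lipschitz_on UNIV f" "\<And>y. norm (f y) \<le> B" "e > 0"
  obtains d y where "d > 0" "y 0 = x"
    "\<And>t. t \<in> {-d<..<d} \<Longrightarrow> (y has_vector_derivative f (y t)) (at t)"
    "\<And>t. t \<in> {-d<..<d} \<Longrightarrow> y t \<in> cball x e"
proof -
  have L: "0 \<le> L" and B: "0 \<le> B"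
    using lipschitz_on_nonneg[OF assms(1)] order_trans[OF norm_ge_zero assms(2)] by auto
  \<comment> \<open>The operator \<open>T\<close> contains two integrals over intervals of length at
    most \<open>2 * d\<close>, hence the contraction constant \<open>4 * d * L\<close> and the
    displacement \<open>4 * d * B\<close>. The summand 1 avoids division by zero.\<close>
  define d where "d = min (1 / (8 * (L + 1))) (e / (4 * (B + 1)))"
  have d: "d > 0" "4 * d * L < 1" "4 * d * B \<le> e"
  proof -
    show "d > 0" using L B assms(3) by (simp add: d_def)
    have "d * (8 * (L + 1)) \<le> 1" "d * (4 * (B + 1)) \<le> e"
      using L B by (simp_all add: d_def flip: pos_le_divide_eq)
    then show "4 * d * L < 1" "4 * d * B \<le> e"
      using \<open>d > 0\<close> L B mult_nonneg_nonneg[of d L] by (auto simp: algebra_simps)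
  qed
  \<comment> \<open>Clamping time to \<open>{-d..d}\<close> turns the integral operator into one on
    functions on the whole line, as the type of bounded continuous functions demands.\<close>
  define c where "c t = max (-d) (min d t)" for t :: real
  have c: "c t \<in> {-d..d}" "t \<in> {-d..d} \<Longrightarrow> c t = t" for t
    using d by (auto simp: c_def)
  have fc: "continuous_on A f" for A
    using lipschitz_on_continuous_on[OF assms(1)] continuous_on_subset by blast
  have gcont: "continuous_on A (\<lambda>s. f (apply_bcontfun y s))" for y :: "real \<Rightarrow>\<^sub>C 'a" and A
    by (intro continuous_on_compose2[OF fc[of UNIV]]) auto
  have gint: "(\<lambda>s. f (apply_bcontfun y s)) integrable_on {-d..t}" for y :: "real \<Rightarrow>\<^sub>C 'a" and t
    by (rule integrable_continuous_interval[OF gcont])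
  define I where "I y t = integral {-d..t} (\<lambda>s. f (apply_bcontfun y s))" for y t
  \<comment> \<open>The difference \<open>I y (c t) - I y 0\<close> is the oriented integral from 0
    to \<open>c t\<close>, for either sign of \<open>t\<close>.\<close>
  define T where "T y t = x + I y (c t) - I y 0" for y t
  have Ivd: "(I y has_vector_derivative f (apply_bcontfun y t)) (at t within {-d..d})" if "t \<in> {-d..d}"
      for y t
    unfolding I_def using integral_has_vector_derivative[OF gcont that] .
  have Icont: "continuous_on {-d..d} (I y)" for y
    by (rule continuous_on_vector_derivative[OF Ivd])
  have Ibd: "norm (I y t) \<le> B * (2 * d)" if "t \<in> {-d..d}" for y t
  proof -
    have "norm (I y t) \<le> B * (t - (-d))"
      unfolding I_def using that assms(2)
      by (intro integral_bound gcont) auto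
    also have "\<dots> \<le> B * (2 * d)" using that B by (intro mult_left_mono) auto
    finally show ?thesis .
  qed
  have Idiff: "norm (I y t - I z t) \<le> (L * dist y z) * (2 * d)" if "t \<in> {-d..d}" for y z t
  proof -
    have "I y t - I z t = integral {-d..t} (\<lambda>s. f (apply_bcontfun y s) - f (apply_bcontfun z s))"
      unfolding I_def by (intro integral_diff[symmetric] gint)
    also have "norm \<dots> \<le> (L * dist y z) * (t - (-d))"
    proof (intro integral_bound continuous_on_diff gcont ballI)
      fix s
      have "norm (f (apply_bcontfun y s) - f (apply_bcontfun z s)) \<le>
          L * dist (apply_bcontfun y s) (apply_bcontfun z s)"
        using assms(1) by (auto simp: lipschitz_on_def dist_norm)
      also have "\<dots> \<le> L * dist y z" using L dist_bounded by (intro mult_left_mono) auto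
      finally show "norm (f (apply_bcontfun y s) - f (apply_bcontfun z s)) \<le> L * dist y z" .
    qed (use that in auto)
    also have "\<dots> \<le> (L * dist y z) * (2 * d)" using that L by (intro mult_left_mono) auto
    finally show ?thesis .
  qed
  have Tb: "T y \<in> bcontfun" for y
  proof (rule bcontfun_normI)
    have "continuous_on UNIV c" unfolding c_def by (intro continuous_intros)
    then show "continuous_on UNIV (T y)" unfolding T_def
      by (intro continuous_intros continuous_on_compose2[OF Icont]) (use c in auto)
    show "norm (T y t) \<le> norm x + B * (2 * d) + B * (2 * d)" for t
      unfolding T_def using Ibd[OF c(1), of y t] Ibd[of 0 y] d
        norm_triangle_ineq4[of "x + I y (c t)" "I y 0"] norm_triangle_ineq[of x "I y (c t)"] by auto
  qed
  have "\<exists>!y. Bcontfun (T y) = y"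
  proof (rule banach_fix_type[of "4 * d * L"])
    show "\<forall>y z. dist (Bcontfun (T y)) (Bcontfun (T z)) \<le> 4 * d * L * dist y z"
    proof (intro allI dist_bound)
      fix y z t
      have "dist (T y t) (T z t) = norm ((I y (c t) - I z (c t)) - (I y 0 - I z 0))"
        by (simp add: T_def dist_norm algebra_simps)
      also have "\<dots> \<le> norm (I y (c t) - I z (c t)) + norm (I y 0 - I z 0)"
        by (rule norm_triangle_ineq4)
      also have "\<dots> \<le> (L * dist y z) * (2 * d) + (L * dist y z) * (2 * d)"
        using d by (intro add_mono Idiff c) auto
      finally show "dist (apply_bcontfun (Bcontfun (T y)) t) (apply_bcontfun (Bcontfun (T z)) t) \<le>
          4 * d * L * dist y z"
        by (simp add: Bcontfun_inverse[OF Tb] algebra_simps)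
    qed
  qed (use L d in auto)
  then obtain y where "Bcontfun (T y) = y" by blast
  then have y: "apply_bcontfun y t = T y t" for t
    using Bcontfun_inverse[OF Tb] by metis
  show ?thesis
  proof (rule that)
    show "apply_bcontfun y 0 = x" using c(2)[of 0] d by (simp add: y T_def)
    show "(apply_bcontfun y has_vector_derivative f (apply_bcontfun y t)) (at t)" if t: "t \<in> {-d<..<d}"
        for t
    proof -
      have "(I y has_vector_derivative f (apply_bcontfun y t)) (at t)"
        using Ivd[of t y] t at_within_interior[of t "{-d..d}"] by simp
      then have "((\<lambda>t. x + I y t - I y 0) has_vector_derivative f (apply_bcontfun y t)) (at t)"
        by (auto intro!: derivative_eq_intros)
      then show ?thesis
        by (rule has_vector_derivative_transform_within_open[of _ _ _ "{-d<..<d}"])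
          (use t c in \<open>auto simp: y T_def\<close>)
    qed
    show "apply_bcontfun y t \<in> cball x e" if "t \<in> {-d<..<d}" for t
    proof -
      have "norm (I y (c t) - I y 0) \<le> B * (2 * d) + B * (2 * d)"
        using norm_triangle_ineq4[of "I y (c t)" "I y 0"] Ibd[OF c(1), of y t] Ibd[of 0 y] d by auto
      also have "\<dots> \<le> e" using d by (simp add: algebra_simps)
      finally show ?thesis
        by (simp add: y T_def dist_norm norm_minus_commute[of "I y 0"])
    qed
  qed (use d in auto)
qed

text \<open>Composing the field with the nearest-point projection onto a closed ball, which has
  Lipschitz constant 1, makes it globally Lipschitz and bounded. The solution stays in the ball,
  where the projection is the identity, so it solves the original equation.\<close>

lemma ode_exists:
  fixes f :: "'a::euclidean_space \<Rightarrow> 'a"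
  assumes "open S" "smooth_on S f" "x \<in> S"
  obtains d y where "d > 0" "y 0 = x"
    "\<And>t. t \<in> {-d<..<d} \<Longrightarrow> y t \<in> S"
    "\<And>t. t \<in> {-d<..<d} \<Longrightarrow> (y has_vector_derivative f (y t)) (at t)"
proof -
  obtain r L where r: "r > 0" "cball x r \<subseteq> S" "L-lipschitz_on (cball x r) f"
    using smooth_on_imp_lipschitz_on_cball[OF assms] .
  define p where "p = closest_point (cball x r)"
  have p: "p y \<in> cball x r" "y \<in> cball x r \<Longrightarrow> p y = y" for y
    using r closest_point_in_set[of "cball x r" y] closest_point_self[of y "cball x r"]
        by (auto simp: p_def)
  have lip: "L-lipschitz_on UNIV (\<lambda>y. f (p y))"
  proof (rule lipschitz_onI)
    fix y z
    have "dist (f (p y)) (f (p z)) \<le> L * dist (p y) (p z)"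
      using r(3) p lipschitz_onD by blast
    also have "\<dots> \<le> L * dist y z"
      unfolding p_def using r lipschitz_on_nonneg[OF r(3)]
      by (intro mult_left_mono closest_point_lipschitz) auto
    finally show "dist (f (p y)) (f (p z)) \<le> L * dist y z" .
  qed (use lipschitz_on_nonneg[OF r(3)] in auto)
  have "bounded (f ` cball x r)"
    using r(2) smooth_on_continuous_on[OF assms(2)] continuous_on_subset
    by (intro compact_imp_bounded compact_continuous_image) auto
  then obtain B where B: "\<And>y. norm (f (p y)) \<le> B"
    using p(1) unfolding bounded_iff by (meson image_eqI)
  obtain d y where dy: "d > 0" "y 0 = x"
    "\<And>t. t \<in> {-d<..<d} \<Longrightarrow> (y has_vector_derivative f (p (y t))) (at t)"
    "\<And>t. t \<in> {-d<..<d} \<Longrightarrow> y t \<in> cball x r"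
    using ode_exists_lipschitz[OF lip B r(1)] by blast
  show ?thesis
  proof (rule that[of d y])
    show "d > 0" "y 0 = x" using dy by auto
    show "y t \<in> S" if "t \<in> {-d<..<d}" for t using dy(4)[OF that] r by blast
    show "(y has_vector_derivative f (y t)) (at t)" if "t \<in> {-d<..<d}" for t
      using dy(3,4)[OF that] p(2) by metis
  qed
qed

text \<open>Bootstrapping: if \<open>y\<close> is of class \<open>k\<close>, so is
  \<open>f (y t)\<close>, which is the derivative of \<open>y\<close>.\<close>

lemma smooth_on_ode_solution:
  fixes f :: "'a::euclidean_space \<Rightarrow> 'a"
  assumes "open S" "smooth_on S f" "open J" "y ` J \<subseteq> S"
    "\<And>t. t \<in> J \<Longrightarrow> (y has_vector_derivative f (y t)) (at t)"
  shows "smooth_on J y"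
proof -
  have "Ck_on k J y" for k
  proof (induction k)
    case 0
    have "isCont y t" if "t \<in> J" for t
      using has_vector_derivative_continuous[OF assms(5)[OF that]] .
    then show ?case by (simp add: continuous_at_imp_continuous_on)
  next
    case (Suc k)
    show ?case
    proof (rule Ck_on_SucI[OF assms(3), where f' = "\<lambda>t r. r *\<^sub>R f (y t)"])
      show "(y has_derivative (\<lambda>r. r *\<^sub>R f (y t))) (at t)" if "t \<in> J" for t
        using assms(5)[OF that] unfolding has_vector_derivative_def .
      show "Ck_on k J (\<lambda>t. r *\<^sub>R f (y t))" for r
        by (rule Ck_on_bounded_linear_compose[OF assms(3) bounded_linear_scaleR_right
              Ck_on_compose[OF assms(3,1,4) _ Suc]])
          (use assms(2) in \<open>simp add: smooth_on_def\<close>)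
    qed
  qed
  then show ?thesis by (simp add: smooth_on_def)
qed

section \<open>Charts and tangent vectors\<close>

text \<open>Expanding the moving direction \<open>u s\<close> in a basis separates it from the
  moving base point \<open>y s\<close>, so that the product rule applies to each summand.\<close>

lemma has_derivative_deriv_at_pair:
  fixes f :: "'a::euclidean_space \<Rightarrow> 'b::real_normed_vector"
    and y u :: "'c::real_normed_vector \<Rightarrow> 'a"
  assumes "open S" "smooth_on S f" "y t \<in> S"
    and y: "(y has_derivative y') (at t)" and u: "(u has_derivative u') (at t)"
  shows "((\<lambda>s. deriv_at f (y s) (u s)) has_derivative
    (\<lambda>r. deriv2_at f (y t) (y' r) (u t) + deriv_at f (y t) (u' r))) (at t)"
proof -
  have exp: "deriv_at f z w = (\<Sum>i\<in>Basis. (w \<bullet> i) *\<^sub>R deriv_at f z i)" if "z \<in> S" for z w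
    using linear_expansion[OF linear_deriv_at[OF assms(2) that]] .
  have D2: "(\<Sum>i\<in>Basis. (w \<bullet> i) *\<^sub>R deriv2_at f z a i) = deriv2_at f z a w" if z: "z \<in> S" for z a w
  proof -
    have "((\<lambda>z. \<Sum>i\<in>Basis. (w \<bullet> i) *\<^sub>R deriv_at f z i) has_derivative
        (\<lambda>a. \<Sum>i\<in>Basis. (w \<bullet> i) *\<^sub>R deriv2_at f z a i)) (at z)"
      by (intro has_derivative_sum has_derivative_scaleR_right smooth_on_has_derivative[OF _ z]
          smooth_on_deriv_at assms(2))
    from deriv_at_eqI[OF this, of a] show ?thesis
      using deriv_at_cong[OF assms(1) z exp[of _ w]] by simp
  qed
  have "((\<lambda>s. \<Sum>i\<in>Basis. (u s \<bullet> i) *\<^sub>R deriv_at f (y s) i) has_derivative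
      (\<lambda>r. \<Sum>i\<in>Basis. (u t \<bullet> i) *\<^sub>R deriv2_at f (y t) (y' r) i + (u' r \<bullet> i) *\<^sub>R deriv_at f (y t) i)) (at t)"
    by (intro has_derivative_sum has_derivative_scaleR has_derivative_inner_left u
        has_derivative_compose[OF y smooth_on_has_derivative[OF smooth_on_deriv_at[OF assms(2)] assms(3)]])
  moreover have "(\<lambda>r. \<Sum>i\<in>Basis. (u t \<bullet> i) *\<^sub>R deriv2_at f (y t) (y' r) i + (u' r \<bullet> i) *\<^sub>R deriv_at f (y t) i)
      = (\<lambda>r. deriv2_at f (y t) (y' r) (u t) + deriv_at f (y t) (u' r))"
    by (rule ext) (simp only: sum.distrib D2[OF assms(3)] exp[OF assms(3), symmetric])
  moreover have "\<forall>\<^sub>F s in at t. (\<Sum>i\<in>Basis. (u s \<bullet> i) *\<^sub>R deriv_at f (y s) i) = deriv_at f (y s) (u s)"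
  proof -
    have "\<forall>\<^sub>F s in at t. y s \<in> S"
      using has_derivative_continuous[OF y] assms(1,3)
      by (auto simp: continuous_at intro: topological_tendstoD)
    then show ?thesis by eventually_elim (rule exp[symmetric])
  qed
  ultimately show ?thesis
    using has_derivative_transform_eventually[of "\<lambda>s. \<Sum>i\<in>Basis. (u s \<bullet> i) *\<^sub>R deriv_at f (y s) i" _ t UNIV
        "\<lambda>s. deriv_at f (y s) (u s)"] exp[OF assms(3), of "u t", symmetric] by simp
qed

section \<open>Coordinate changes and tangent vectors\<close>

locale manifold =
  fixes A :: "('m::{t2_space,second_countable_topology}, 'e::euclidean_space) chart set"
  assumes smooth_manifold: "smooth_manifold A"
begin

lemma open_cdom: "c \<in> A \<Longrightarrow> open (cdom c)"
  and open_crange: "c \<in> A \<Longrightarrow> open (crange c)"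
  and homeomorphism_chart: "c \<in> A \<Longrightarrow> homeomorphism (cdom c) (crange c) (coord c) (param c)"
  and smooth_on_transition_image:
    "c \<in> A \<Longrightarrow> c' \<in> A \<Longrightarrow> smooth_on (coord c ` (cdom c \<inter> cdom c')) (transition c c')"
  using smooth_manifold unfolding smooth_manifold_def by blast+

lemma ex_chart: obtains c where "c \<in> A" "p \<in> cdom c"
  using smooth_manifold unfolding smooth_manifold_def by blast

lemma param_in_cdom: "c \<in> A \<Longrightarrow> x \<in> crange c \<Longrightarrow> param c x \<in> cdom c"
  and coord_param: "c \<in> A \<Longrightarrow> x \<in> crange c \<Longrightarrow> coord c (param c x) = x"
  and coord_in_crange: "p \<in> cdom c \<Longrightarrow> coord c p \<in> crange c"
  and param_coord: "c \<in> A \<Longrightarrow> p \<in> cdom c \<Longrightarrow> param c (coord c p) = p"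
  and continuous_on_param: "c \<in> A \<Longrightarrow> continuous_on (crange c) (param c)"
  and continuous_on_coord: "c \<in> A \<Longrightarrow> continuous_on (cdom c) (coord c)"
  using homeomorphism_chart[of c] by (auto simp: homeomorphism_def crange_def)

lemma in_coord_image_iff:
  assumes "c \<in> A"
  shows "x \<in> coord c ` (U \<inter> cdom c) \<longleftrightarrow> x \<in> crange c \<and> param c x \<in> U"
proof
  assume "x \<in> coord c ` (U \<inter> cdom c)"
  then show "x \<in> crange c \<and> param c x \<in> U"
    using param_coord[OF assms] coord_in_crange[of _ c] by auto
next
  assume "x \<in> crange c \<and> param c x \<in> U"
  then have "param c x \<in> U \<inter> cdom c" "coord c (param c x) = x"
    using param_in_cdom[OF assms] coord_param[OF assms] by auto
  then show "x \<in> coord c ` (U \<inter> cdom c)" by (metis image_eqI)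
qed

lemma open_coord_image:
  assumes "c \<in> A" "open U"
  shows "open (coord c ` (U \<inter> cdom c))"
proof -
  have "coord c ` (U \<inter> cdom c) = crange c \<inter> param c -` U"
    using in_coord_image_iff[OF assms(1), of _ U] by auto
  then show ?thesis
    using continuous_open_preimage[OF continuous_on_param open_crange] assms by simp
qed

definition overlap :: "('m, 'e) chart \<Rightarrow> ('m, 'e) chart \<Rightarrow> 'e set"
  where "overlap c c' = {x \<in> crange c. param c x \<in> cdom c'}"

lemma overlap_eq: "c \<in> A \<Longrightarrow> overlap c c' = coord c ` (cdom c \<inter> cdom c')"
  using in_coord_image_iff[of c _ "cdom c'"] by (auto simp: overlap_def Int_commute)

lemma open_overlap: "c \<in> A \<Longrightarrow> c' \<in> A \<Longrightarrow> open (overlap c c')"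
  using open_coord_image[of c "cdom c'"] open_cdom[of c'] by (simp add: overlap_eq Int_commute)

lemma smooth_on_transition: "c \<in> A \<Longrightarrow> c' \<in> A \<Longrightarrow> smooth_on (overlap c c') (transition c c')"
  using smooth_on_transition_image by (simp add: overlap_eq)

lemma overlapD:
  assumes "c \<in> A" "c' \<in> A" "x \<in> overlap c c'"
  shows "x \<in> crange c" "param c x \<in> cdom c'" "param c' (transition c c' x) = param c x"
    "transition c c' x \<in> crange c'" "transition c c' x \<in> overlap c' c"
  using assms param_coord coord_in_crange param_in_cdom
  by (auto simp: overlap_def transition_def)

lemma transition_self: "c \<in> A \<Longrightarrow> x \<in> crange c \<Longrightarrow> transition c c x = x"
  by (simp add: transition_def coord_param)

lemma overlap_self: "c \<in> A \<Longrightarrow> overlap c c = crange c"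
  by (auto simp: overlap_def param_in_cdom)

lemma transition_transition:
  assumes "c \<in> A" "c' \<in> A" "x \<in> overlap c c'"
  shows "transition c' c'' (transition c c' x) = transition c c'' x"
  using overlapD(3)[OF assms] by (simp add: transition_def)

lemma deriv_at_transition_self: "c \<in> A \<Longrightarrow> x \<in> crange c \<Longrightarrow> deriv_at (transition c c) x w = w"
  using deriv_at_cong[OF open_crange, of c x "transition c c" "\<lambda>x. x" w] transition_self
    deriv_at_eqI[OF has_derivative_ident, of x w] by simp

lemma deriv_at_transition_transition:
  assumes "c \<in> A" "c' \<in> A" "c'' \<in> A" "x \<in> overlap c c'" "x \<in> overlap c c''"
  shows "deriv_at (transition c' c'') (transition c c' x) (deriv_at (transition c c') x w) =
    deriv_at (transition c c'') x w"
proof -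
  have x: "transition c c' x \<in> overlap c' c''"
    using overlapD[OF assms(1,2,4)] overlapD(2)[OF assms(1,3,5)] by (simp add: overlap_def)
  have "((\<lambda>x. transition c' c'' (transition c c' x)) has_derivative
      (\<lambda>w. deriv_at (transition c' c'') (transition c c' x) (deriv_at (transition c c') x w))) (at x)"
    using has_derivative_compose[OF smooth_on_has_derivative[OF smooth_on_transition[OF assms(1,2)]
        assms(4)]
      smooth_on_has_derivative[OF smooth_on_transition[OF assms(2,3)] x]] .
  then have "deriv_at (\<lambda>x. transition c' c'' (transition c c' x)) x w =
      deriv_at (transition c' c'') (transition c c' x) (deriv_at (transition c c') x w)"
    by (rule deriv_at_eqI)
  then show ?thesis
    by (simp only: deriv_at_cong[OF open_overlap[OF assms(1,2)] assms(4)
        transition_transition[OF assms(1,2)]])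
qed

lemma base_tangent_of: "base (tangent_of A c x w) = param c x"
  by (simp add: tangent_of_def)

lemma comp_in_tangent_of:
  assumes "c \<in> A" "c' \<in> A" "x \<in> overlap c c'"
  shows "comp_in c' (tangent_of A c x w) = deriv_at (transition c c') x w"
  using assms by (simp add: tangent_of_def overlap_def)

lemma tangent_of_in_tangent_bundle:
  assumes "c \<in> A" "x \<in> crange c"
  shows "tangent_of A c x w \<in> tangent_bundle A"
proof -
  have "deriv_at (transition c' c'') (coord c' (param c x)) (deriv_at (transition c c') x w) =
      deriv_at (transition c c'') x w"
    if "c' \<in> A" "c'' \<in> A" "param c x \<in> cdom c'" "param c x \<in> cdom c''" for c' c''
  proof -
    have "coord c' (param c x) = transition c c' x" by (simp add: transition_def)
    then show ?thesis
      using deriv_at_transition_transition[of c c' c'' x w] that assms by (simp add: overlap_def)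
  qed
  then show ?thesis by (auto simp: tangent_bundle_def tangent_of_def)
qed

lemma tangent_of_transition:
  assumes "c \<in> A" "c' \<in> A" "x \<in> overlap c c'"
  shows "tangent_of A c' (transition c c' x) (deriv_at (transition c c') x w) = tangent_of A c x w"
proof -
  have "deriv_at (transition c' c'') (transition c c' x) (deriv_at (transition c c') x w) =
      deriv_at (transition c c'') x w" if "c'' \<in> A" "param c x \<in> cdom c''" for c''
    using deriv_at_transition_transition[of c c' c'' x w] that assms by (simp add: overlap_def)
  then show ?thesis
    using overlapD(3)[OF assms] by (auto simp: tangent_of_def)
qed

lemma tangent_of_comp_in:
  assumes "c \<in> A" "v \<in> tangent_bundle A" "base v \<in> cdom c"
  shows "tangent_of A c (coord c (base v)) (comp_in c v) = v"
proof (rule prod_eqI)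
  show "snd (tangent_of A c (coord c (base v)) (comp_in c v)) = snd v"
  proof
    fix c'
    show "comp_in c' (tangent_of A c (coord c (base v)) (comp_in c v)) = comp_in c' v"
    proof (cases "c' \<in> A \<and> base v \<in> cdom c'")
      case True
      then have "comp_in c' v = deriv_at (transition c c') (coord c (base v)) (comp_in c v)"
        using assms unfolding tangent_bundle_def by blast
      from this[symmetric] show ?thesis
        using True by (simp add: tangent_of_def param_coord assms)
    next
      case False
      then have "comp_in c' v = 0" using assms unfolding tangent_bundle_def by blast
      then show ?thesis using False by (auto simp: tangent_of_def param_coord assms)
    qed
  qed
qed (simp add: base_tangent_of param_coord assms)

lemma tangent_of_zero:
  assumes "c \<in> A" "x \<in> crange c"
  shows "tangent_of A c x 0 = zero_tangent (param c x)"
proof -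
  have "deriv_at (transition c c') x 0 = 0" if "c' \<in> A" "param c x \<in> cdom c'" for c'
    using linear_deriv_at[OF smooth_on_transition[OF assms(1) that(1)], of x] assms that
    by (simp add: overlap_def linear_0)
  then show ?thesis by (auto simp: tangent_of_def zero_tangent_def)
qed

lemma scale_tangent_tangent_of:
  assumes "c \<in> A" "x \<in> crange c"
  shows "scale_tangent r (tangent_of A c x w) = tangent_of A c x (r *\<^sub>R w)"
proof -
  have "deriv_at (transition c c') x (r *\<^sub>R w) = r *\<^sub>R deriv_at (transition c c') x w"
    if "c' \<in> A" "param c x \<in> cdom c'" for c'
    using linear_deriv_at[OF smooth_on_transition[OF assms(1) that(1)], of x] assms that
    by (simp add: overlap_def linear_scale)
  then show ?thesis by (auto simp: tangent_of_def scale_tangent_def)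
qed

section \<open>Curves and parallel fields inside one chart\<close>

context
  fixes c :: "('m, 'e) chart" and J :: "real set" and y :: "real \<Rightarrow> 'e"
  assumes c: "c \<in> A" and J: "open_interval J" and y: "smooth_on J y" "y ` J \<subseteq> crange c"
begin

lemma open_J: "open J" using J by (simp add: open_interval_def)

lemma y_vector_derivative:
  "t \<in> J \<Longrightarrow> (y has_derivative (\<lambda>r. r *\<^sub>R vector_derivative y (at t))) (at t)"
  using smooth_on_has_derivative[OF y(1)] has_vector_derivative_def vector_derivative_works
    differentiableI by metis

lemma open_curve_overlap: "c' \<in> A \<Longrightarrow> open {t \<in> J. y t \<in> overlap c c'}"
  using continuous_open_preimage[OF smooth_on_continuous_on[OF y(1)] open_J open_overlap[OF c], of c']
  by (simp only: vimage_def Int_def mem_Collect_eq)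

lemma smooth_curve_param: "smooth_curve A J (\<lambda>t. param c (y t))"
proof -
  have "continuous_on J (\<lambda>t. param c (y t))"
    using continuous_on_compose2[OF continuous_on_param[OF c] smooth_on_continuous_on[OF y(1)] y(2)] .
  moreover have "smooth_on {t \<in> J. param c (y t) \<in> cdom c'} (coord c' \<circ> (\<lambda>t. param c (y t)))"
    if c': "c' \<in> A" for c'
  proof -
    have eq: "{t \<in> J. param c (y t) \<in> cdom c'} = {t \<in> J. y t \<in> overlap c c'}"
      using y(2) by (auto simp: overlap_def)
    have "smooth_on {t \<in> J. y t \<in> overlap c c'} (\<lambda>t. transition c c' (y t))"
      by (intro smooth_on_compose[OF open_curve_overlap[OF c'] open_overlap[OF c c'] _
          smooth_on_transition[OF c c']]
          smooth_on_subset[OF y(1)]) auto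
    then show ?thesis unfolding eq by (simp add: o_def transition_def)
  qed
  ultimately show ?thesis using J by (simp add: smooth_curve_def)
qed

lemma velocity_param:
  assumes t: "t \<in> J"
  shows "velocity A (\<lambda>t. param c (y t)) t = tangent_of A c (y t) (vector_derivative y (at t))"
proof -
  have "vector_derivative (coord c' \<circ> (\<lambda>t. param c (y t))) (at t) =
      deriv_at (transition c c') (y t) (vector_derivative y (at t))"
    if "c' \<in> A" "param c (y t) \<in> cdom c'" for c'
  proof -
    have yt: "y t \<in> overlap c c'" using that y(2) t by (auto simp: overlap_def)
    have D: "(transition c c' has_derivative deriv_at (transition c c') (y t)) (at (y t))"
      using smooth_on_has_derivative[OF smooth_on_transition[OF c that(1)] yt] .
    have "((\<lambda>t. transition c c' (y t)) has_derivative
        (\<lambda>r. deriv_at (transition c c') (y t) (r *\<^sub>R vector_derivative y (at t)))) (at t)"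
      using has_derivative_compose[OF y_vector_derivative[OF t] D] .
    then have "((\<lambda>t. transition c c' (y t)) has_vector_derivative
        deriv_at (transition c c') (y t) (vector_derivative y (at t))) (at t)"
      using linear_scale[OF has_derivative_linear[OF D]] by (simp add: has_vector_derivative_def)
    then show ?thesis using vector_derivative_at by (simp add: o_def transition_def)
  qed
  then show ?thesis by (auto simp: velocity_def tangent_of_def)
qed

text \<open>It is enough to solve the transport equation in one chart: in any other chart, the
  second derivative of the coordinate change produced by the product rule cancels against the
  inhomogeneous term in the transformation law of the Christoffel symbols.\<close>

lemma parallel_along_param:
  assumes G: "affine_connection A G"
    and u: "\<And>t. t \<in> J \<Longrightarrow> (u has_vector_derivative - G c (y t) (vector_derivative y (at t)) (u t)) (at t)"
  shows "parallel_along A G J (\<lambda>t. param c (y t)) (\<lambda>t. tangent_of A c (y t) (u t))"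
  unfolding parallel_along_def
proof (intro conjI ballI impI)
  fix t assume "t \<in> J"
  then show "tangent_of A c (y t) (u t) \<in> tangent_bundle A"
      "base (tangent_of A c (y t) (u t)) = param c (y t)"
    using tangent_of_in_tangent_bundle c y(2) base_tangent_of by blast+
next
  fix c' t assume c': "c' \<in> A" and t: "t \<in> J" and "param c (y t) \<in> cdom c'"
  then have yt: "y t \<in> overlap c c'" using y(2) by (auto simp: overlap_def)
  define T where "T = transition c c'"
  define w where "w = vector_derivative y (at t)"
  have ov: "overlap c c' = coord c ` (cdom c \<inter> cdom c')" using overlap_eq[OF c] .
  have ut: "(u has_derivative (\<lambda>r. r *\<^sub>R (- G c (y t) w (u t)))) (at t)"
    using u[OF t] by (simp add: has_vector_derivative_def w_def)
  have lin: "linear (deriv_at T (y t))" "linear (\<lambda>r. deriv2_at T (y t) r (u t))"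
    using linear_deriv_at[OF smooth_on_transition[OF c c'] yt]
      linear_deriv_at[OF smooth_on_deriv_at[OF smooth_on_transition[OF c c']] yt]
    by (auto simp: T_def)
  have "((\<lambda>s. deriv_at T (y s) (u s)) has_derivative
      (\<lambda>r. deriv2_at T (y t) (r *\<^sub>R w) (u t) + deriv_at T (y t) (r *\<^sub>R (- G c (y t) w (u t))))) (at t)"
    unfolding T_def
    using has_derivative_deriv_at_pair[OF open_overlap[OF c c'] smooth_on_transition[OF c c'] yt
        y_vector_derivative[OF t] ut] by (simp only: w_def)
  moreover have "(\<lambda>r. deriv2_at T (y t) (r *\<^sub>R w) (u t) + deriv_at T (y t) (r *\<^sub>R (- G c (y t) w (u t))))
      = (\<lambda>r. r *\<^sub>R (- G c' (T (y t)) (deriv_at T (y t) w) (deriv_at T (y t) (u t))))"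
  proof
    fix r
    have "deriv_at T (y t) (G c (y t) w (u t)) =
        deriv2_at T (y t) w (u t) + G c' (T (y t)) (deriv_at T (y t) w) (deriv_at T (y t) (u t))"
      using G c c' yt unfolding affine_connection_def ov T_def by blast
    moreover have "deriv2_at T (y t) (r *\<^sub>R w) (u t) = r *\<^sub>R deriv2_at T (y t) w (u t)"
      using linear_scale[OF lin(2)] .
    moreover have "deriv_at T (y t) (r *\<^sub>R (- G c (y t) w (u t))) =
        r *\<^sub>R (- deriv_at T (y t) (G c (y t) w (u t)))"
      using linear_scale[OF lin(1)] linear_neg[OF lin(1)] by simp
    ultimately show "deriv2_at T (y t) (r *\<^sub>R w) (u t) + deriv_at T (y t) (r *\<^sub>R (- G c (y t) w (u t))) =
        r *\<^sub>R (- G c' (T (y t)) (deriv_at T (y t) w) (deriv_at T (y t) (u t)))"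
      by (simp only:) (simp add: algebra_simps)
  qed
  ultimately have "((\<lambda>s. deriv_at T (y s) (u s)) has_vector_derivative
      (- G c' (T (y t)) (deriv_at T (y t) w) (deriv_at T (y t) (u t)))) (at t)"
    by (simp add: has_vector_derivative_def)
  then have D: "((\<lambda>s. comp_in c' (tangent_of A c (y s) (u s))) has_vector_derivative
      (- G c' (T (y t)) (deriv_at T (y t) w) (deriv_at T (y t) (u t)))) (at t)"
    by (rule has_vector_derivative_transform_within_open[OF _ open_curve_overlap[OF c']])
      (use t yt c c' in \<open>auto simp: comp_in_tangent_of T_def\<close>)
  then show "(\<lambda>s. comp_in c' (tangent_of A c (y s) (u s))) differentiable at t"
    by (auto simp: has_vector_derivative_def differentiable_def)
  have "coord c' (param c (y t)) = T (y t)" by (simp add: T_def transition_def)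
  then show "vector_derivative (\<lambda>s. comp_in c' (tangent_of A c (y s) (u s))) (at t) +
      G c' (coord c' (param c (y t))) (comp_in c' (velocity A (\<lambda>t. param c (y t)) t))
       (comp_in c' (tangent_of A c (y t) (u t))) = 0"
    using vector_derivative_at[OF D] c c' yt t
    by (simp add: velocity_param comp_in_tangent_of T_def w_def)
qed

end

end

section \<open>Parallel transport in a chart\<close>

text \<open>Uncurried, so that base and fibre derivatives become directional derivatives along
  \<open>(a, 0)\<close> and \<open>(0, b)\<close>.\<close>

definition in_chart_pair ::
  "('m, 'e::euclidean_space) chart set \<Rightarrow> (('m, 'e) tangent \<Rightarrow> real) \<Rightarrow> ('m, 'e) chart \<Rightarrow>
    'e \<times> 'e \<Rightarrow> real"
  where "in_chart_pair A F c = (\<lambda>(x, w). in_chart A F c x w)"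

lemma smooth_on_fst: "open S \<Longrightarrow> smooth_on S (\<lambda>z. fst z)"
  and smooth_on_snd: "open S \<Longrightarrow> smooth_on S (\<lambda>z. snd z)"
  using smooth_on_bounded_linear[OF _ bounded_linear_fst] smooth_on_bounded_linear[OF _ bounded_linear_snd]
  by auto

lemma has_vector_derivative_fst_snd:
  assumes "(z has_vector_derivative d) F"
  shows "((\<lambda>t. fst (z t)) has_vector_derivative fst d) F" "((\<lambda>t. snd (z t)) has_vector_derivative snd d) F"
  using bounded_linear.has_vector_derivative[OF bounded_linear_fst assms]
    bounded_linear.has_vector_derivative[OF bounded_linear_snd assms] by auto

context manifold
begin

text \<open>Differentiating the constancy of \<open>F\<close> along the parallel field with initial value \<open>w\<close> over
  the coordinate line in direction \<open>a\<close>.\<close>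

lemma transport_preserves_imp_horizontal:
  assumes F: "finsler A F" and G: "affine_connection A G" "transport_preserves A G F"
    and c: "c \<in> A" "x \<in> crange c" "w \<noteq> 0"
  shows "deriv_at (in_chart_pair A F c) (x, w) (a, 0) =
    deriv_at (in_chart_pair A F c) (x, w) (0, G c x a w)"
proof -
  define S where "S = crange c \<times> (UNIV :: 'e set)"
  have S: "open S" unfolding S_def by (intro open_Times open_crange c) auto
  \<comment> \<open>Coordinate line and parallel field are solved together as one autonomous system
    for \<open>(x, w)\<close>. The basis expansion makes the field smooth in both variables jointly,
    although smoothness of \<open>G\<close> is given in \<open>x\<close> only.\<close>
  define f where "f z = (a, 0) + (0, - (\<Sum>i\<in>Basis. (snd z \<bullet> i) *\<^sub>R G c (fst z) a i))" for z :: "'e \<times> 'e"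
  have bil: "bilinear (G c z)" if "z \<in> crange c" for z
    using G(1) c that by (auto simp: affine_connection_def)
  have feq: "f z = (a, - G c (fst z) a (snd z))" if "z \<in> S" for z
    using linear_expansion[of "G c (fst z) a" "snd z"] bil[of "fst z"] that
    by (auto simp: f_def bilinear_def S_def)
  have G_smooth: "smooth_on S (\<lambda>z. G c (fst z) a i)" for i
    by (rule smooth_on_compose[OF S open_crange[OF c(1)] _ _ smooth_on_fst[OF S], of "\<lambda>x. G c x a i"])
      (use G(1) c in \<open>auto simp: affine_connection_def S_def\<close>)
  have "bounded_linear (\<lambda>u::'e. (0::'e, - u))"
    by (intro bounded_linear_Pair bounded_linear_zero bounded_linear_minus bounded_linear_ident)
  then have "smooth_on S f" unfolding f_def
    by (intro smooth_on_add S smooth_on_const smooth_on_bounded_linear_compose[of S "\<lambda>u::'e. (0::'e, - u)"]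
        smooth_on_sum smooth_on_scaleR smooth_on_bounded_linear_compose[OF S bounded_linear_inner_left]
        smooth_on_snd G_smooth)
  moreover have "(x, w) \<in> S" using c by (simp add: S_def)
  ultimately obtain d z where d: "d > 0" "z 0 = (x, w)" "\<And>t. t \<in> {-d<..<d} \<Longrightarrow> z t \<in> S"
    "\<And>t. t \<in> {-d<..<d} \<Longrightarrow> (z has_vector_derivative f (z t)) (at t)"
    using ode_exists[OF S] by blast
  define J where "J = {-d<..<d}"
  have J: "open_interval J" "0 \<in> J" "open J"
    using d(1) by (auto simp: J_def open_interval_def is_interval_oo)
  have z: "smooth_on J z"
    by (rule smooth_on_ode_solution[OF S \<open>smooth_on S f\<close> J(3)]) (use d in \<open>auto simp: J_def\<close>)
  define y u where "y = (\<lambda>t. fst (z t))" and "u = (\<lambda>t. snd (z t))"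
  have y: "smooth_on J y" "y ` J \<subseteq> crange c"
    using smooth_on_bounded_linear_compose[OF J(3) bounded_linear_fst z] d(3)
    by (auto simp: y_def S_def J_def mem_Times_iff)
  have yd: "(y has_vector_derivative a) (at t)" if "t \<in> J" for t
    using has_vector_derivative_fst_snd(1)[OF d(4), of t] that feq[OF d(3), of t] by (simp add: y_def J_def)
  have ud: "(u has_vector_derivative - G c (y t) a (u t)) (at t)" if "t \<in> J" for t
    using has_vector_derivative_fst_snd(2)[OF d(4), of t] that feq[OF d(3), of t]
        by (simp add: u_def y_def J_def)
  have "parallel_along A G J (\<lambda>t. param c (y t)) (\<lambda>t. tangent_of A c (y t) (u t))"
    using parallel_along_param[OF c(1) J(1) y G(1)] ud vector_derivative_at[OF yd] by simp
  then have const: "F (tangent_of A c (y s) (u s)) = F (tangent_of A c (y t) (u t))" if "s \<in> J" "t \<in> J"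
      for s t
    using G(2) smooth_curve_param[OF c(1) J(1) y] that unfolding transport_preserves_def by blast
  have smF: "smooth_on (crange c \<times> (UNIV - {0})) (in_chart_pair A F c)"
    using F c(1) by (simp add: finsler_def in_chart_pair_def)
  have DF: "(in_chart_pair A F c has_derivative deriv_at (in_chart_pair A F c) (x, w)) (at (x, w))"
    using smooth_on_has_derivative[OF smF, of "(x, w)"] c by simp
  have zd: "(z has_derivative (\<lambda>r. r *\<^sub>R (a, - G c x a w))) (at 0)"
    using d(4)[of 0] J(2) feq[OF \<open>(x, w) \<in> S\<close>] d(1,2) by (simp add: has_vector_derivative_def)
  have "((\<lambda>t. in_chart_pair A F c (z t)) has_derivative
      (\<lambda>r. deriv_at (in_chart_pair A F c) (x, w) (r *\<^sub>R (a, - G c x a w)))) (at 0)"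
    by (rule has_derivative_compose[OF zd]) (simp add: d(2) DF)
  moreover have "((\<lambda>t. in_chart_pair A F c (z t)) has_derivative (\<lambda>r. 0)) (at 0)"
    by (rule has_derivative_transform_within_open[OF has_derivative_const J(3,2), of
        "in_chart_pair A F c (z 0)"])
      (use const[OF J(2)] in \<open>simp add: in_chart_pair_def in_chart_def y_def u_def case_prod_unfold\<close>)
  ultimately have "(\<lambda>r. deriv_at (in_chart_pair A F c) (x, w) (r *\<^sub>R (a, - G c x a w))) = (\<lambda>r. 0)"
    by (rule has_derivative_unique)
  then have "deriv_at (in_chart_pair A F c) (x, w) (1 *\<^sub>R (a, - G c x a w)) = 0" by metis
  then have "deriv_at (in_chart_pair A F c) (x, w) ((a, 0) - (0, G c x a w)) = 0" by simp
  then show ?thesis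
    unfolding linear_diff[OF has_derivative_linear[OF DF]] by simp
qed

text \<open>An integral curve of \<open>W\<close> starting at \<open>x\<close> exists by
  \<open>ode_exists\<close> and is a geodesic by hypothesis. Its velocity is \<open>W\<close> along
  the curve, so its geodesic equation at time 0 is the claim. This turns the condition on curves
  into a differential equation for the field.\<close>

lemma geodesic_field_imp_autoparallel:
  assumes V: "smooth_vector_field A U V"
    and geo: "\<And>J \<gamma>. smooth_curve A J \<gamma> \<Longrightarrow> (\<And>t. t \<in> J \<Longrightarrow> \<gamma> t \<in> U \<and> velocity A \<gamma> t = V (\<gamma> t)) \<Longrightarrow>
      geodesic A G J \<gamma>"
    and c: "c \<in> A" "x \<in> coord c ` (U \<inter> cdom c)"
  defines "W \<equiv> \<lambda>x. comp_in c (V (param c x))"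
  shows "deriv_at W x (W x) + G c x (W x) (W x) = 0"
proof -
  define S where "S = coord c ` (U \<inter> cdom c)"
  have S: "open S" unfolding S_def using V
      by (intro open_coord_image c) (auto simp: smooth_vector_field_def)
  have W: "smooth_on S W" using V c(1) by (simp add: smooth_vector_field_def W_def S_def)
  have x: "x \<in> S" using c by (simp add: S_def)
  have S_D: "z \<in> crange c" "param c z \<in> U" if "z \<in> S" for z
    using that in_coord_image_iff[OF c(1)] unfolding S_def by blast+
  obtain d y where d: "d > 0" "y 0 = x" "\<And>t. t \<in> {-d<..<d} \<Longrightarrow> y t \<in> S"
    "\<And>t. t \<in> {-d<..<d} \<Longrightarrow> (y has_vector_derivative W (y t)) (at t)"
    using ode_exists[OF S W x] by blast
  define J where "J = {-d<..<d}"
  have J: "open_interval J" "0 \<in> J" "open J"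
    using d(1) by (auto simp: J_def open_interval_def is_interval_oo)
  have "y ` J \<subseteq> S" using d(3) by (auto simp: J_def)
  then have y: "smooth_on J y" "y ` J \<subseteq> crange c"
    using smooth_on_ode_solution[OF S W J(3)] d(4) S_D by (auto simp: J_def)
  let ?\<gamma> = "\<lambda>t. param c (y t)"
  have vel: "velocity A ?\<gamma> t = V (param c (y t))" if t: "t \<in> J" for t
  proof -
    have yt: "y t \<in> S" using d(3) t by (simp add: J_def)
    have b: "V (param c (y t)) \<in> tangent_bundle A" "base (V (param c (y t))) = param c (y t)"
      using V S_D[OF yt] by (auto simp: smooth_vector_field_def)
    have "vector_derivative y (at t) = W (y t)" using vector_derivative_at[OF d(4)] t by (simp add: J_def)
    then show ?thesis
      using velocity_param[OF c(1) J(1) y t] tangent_of_comp_in[OF c(1) b(1)] b(2) S_D[OF yt]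
        param_in_cdom[OF c(1)] coord_param[OF c(1)] by (simp add: W_def)
  qed
  have "geodesic A G J ?\<gamma>"
    by (rule geo) (use smooth_curve_param[OF c(1) J(1) y] vel S_D d(3) in \<open>auto simp: J_def\<close>)
  then have "vector_derivative (\<lambda>s. comp_in c (velocity A ?\<gamma> s)) (at 0) +
      G c (coord c (param c (y 0))) (comp_in c (velocity A ?\<gamma> 0))
        (comp_in c (velocity A ?\<gamma> 0)) = 0"
    using J(2) c(1) param_in_cdom[OF c(1)] S_D[OF x] d(2)
    unfolding geodesic_def parallel_along_def by blast
  moreover have "((\<lambda>s. comp_in c (velocity A ?\<gamma> s)) has_vector_derivative
      deriv_at W x (W x)) (at 0)"
  proof (rule has_vector_derivative_transform_within_open[OF _ J(3,2)])
    have D: "(W has_derivative deriv_at W x) (at (y 0))"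
      using smooth_on_has_derivative[OF W x] d(2) by simp
    have "((\<lambda>s. W (y s)) has_derivative (\<lambda>r. deriv_at W x (r *\<^sub>R W x))) (at 0)"
      by (rule has_derivative_compose[of y "\<lambda>r. r *\<^sub>R W x" 0 UNIV W, OF _ D])
        (use d(4)[of 0] d(1,2) in \<open>simp add: has_vector_derivative_def\<close>)
    then show "((\<lambda>s. W (y s)) has_vector_derivative deriv_at W x (W x)) (at 0)"
      using linear_scale[OF has_derivative_linear[OF D]] by (simp add: has_vector_derivative_def)
  qed (simp add: vel W_def)
  ultimately show ?thesis
    using vector_derivative_at vel[OF J(2)] d(2) coord_param[OF c(1)] S_D[OF x] by (metis W_def)
qed

end

section \<open>Families of linear equations\<close>

text \<open>At a zero of \<open>k\<close> the product rule needs only continuity of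
  \<open>\<psi>\<close>: the remainder \<open>k y *\<^sub>R (\<psi> y - \<psi> x)\<close> is bounded
  by a multiple of \<open>norm (y - x)\<close> times a factor tending to 0.\<close>

lemma has_derivative_scaleR_zero:
  fixes k :: "'a::real_normed_vector \<Rightarrow> real" and \<psi> :: "'a \<Rightarrow> 'b::real_normed_vector"
  assumes k: "(k has_derivative k') (at x)" "k x = 0" and \<psi>: "isCont \<psi> x"
  shows "((\<lambda>y. k y *\<^sub>R \<psi> y) has_derivative (\<lambda>h. k' h *\<^sub>R \<psi> x)) (at x)"
proof -
  have bl: "bounded_linear k'" using k has_derivative_bounded_linear by blast
  then obtain B where B: "\<And>h. norm (k' h) \<le> norm h * B" using bounded_linear.bounded by blast
  have "((\<lambda>y. (norm (k y - k x - k' (y - x)) / norm (y - x) + B) * norm (\<psi> y - \<psi> x)) \<longlongrightarrow> (0 + B) * 0) (at x)"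
    using k(1) \<psi> by (intro tendsto_intros tendsto_norm_zero)
      (auto simp: has_derivative_iff_norm isCont_def LIM_zero)
  then have lim: "((\<lambda>y. (norm (k y - k x - k' (y - x)) / norm (y - x) + B) * norm (\<psi> y - \<psi> x)) \<longlongrightarrow> 0) (at x)"
    by simp
  have "((\<lambda>y. norm (k y *\<^sub>R (\<psi> y - \<psi> x) - 0 - 0) / norm (y - x)) \<longlongrightarrow> 0) (at x)"
  proof (rule tendsto_sandwich[OF _ _ tendsto_const lim])
    show "\<forall>\<^sub>F y in at x. norm (k y *\<^sub>R (\<psi> y - \<psi> x) - 0 - 0) / norm (y - x) \<le>
        (norm (k y - k x - k' (y - x)) / norm (y - x) + B) * norm (\<psi> y - \<psi> x)"
    proof (rule eventually_mono[OF eventually_neq_at_within[of x]])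
      fix y assume "y \<noteq> x"
      then have pos: "norm (y - x) > 0" by simp
      have "\<bar>k y\<bar> \<le> norm (k y - k x - k' (y - x)) + norm (k' (y - x))"
        using norm_triangle_ineq[of "k y - k x - k' (y - x)" "k' (y - x)"] k(2) by simp
      also have "\<dots> \<le> (norm (k y - k x - k' (y - x)) / norm (y - x) + B) * norm (y - x)"
        using B[of "y - x"] pos by (simp add: field_simps)
      finally have "\<bar>k y\<bar> / norm (y - x) \<le> norm (k y - k x - k' (y - x)) / norm (y - x) + B"
        using pos by (simp add: pos_divide_le_eq)
      from mult_right_mono[OF this norm_ge_zero[of "\<psi> y - \<psi> x"]]
      show "norm (k y *\<^sub>R (\<psi> y - \<psi> x) - 0 - 0) / norm (y - x) \<le>
          (norm (k y - k x - k' (y - x)) / norm (y - x) + B) * norm (\<psi> y - \<psi> x)"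
        by simp
    qed
  qed auto
  then have "((\<lambda>y. k y *\<^sub>R (\<psi> y - \<psi> x)) has_derivative (\<lambda>h. 0)) (at x)"
    using k(2) by (simp add: has_derivative_iff_norm)
  from has_derivative_add[OF has_derivative_scaleR_left[OF k(1), of "\<psi> x"] this]
  show ?thesis by (simp add: algebra_simps)
qed

text \<open>Each basis component of \<open>h\<close> vanishes at \<open>x\<close>, so
  \<open>has_derivative_scaleR_zero\<close> applies to every summand of the expansion.\<close>

lemma has_derivative_linear_family_zero:
  fixes \<phi> :: "'a::real_normed_vector \<Rightarrow> 'b::euclidean_space \<Rightarrow> 'c::real_normed_vector"
  assumes lin: "\<And>y. y \<in> U \<Longrightarrow> linear (\<phi> y)" and U: "open U" "x \<in> U"
    and cont: "\<And>i. isCont (\<lambda>y. \<phi> y i) x"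
    and h: "(h has_derivative h') (at x)" "h x = 0"
  shows "((\<lambda>y. \<phi> y (h y)) has_derivative (\<lambda>r. \<phi> x (h' r))) (at x)"
proof -
  have "((\<lambda>y. \<Sum>i\<in>Basis. (h y \<bullet> i) *\<^sub>R \<phi> y i) has_derivative (\<lambda>r. \<Sum>i\<in>Basis. (h' r \<bullet> i) *\<^sub>R \<phi> x i)) (at x)"
    by (intro has_derivative_sum has_derivative_scaleR_zero cont has_derivative_inner_left h)
      (simp add: h(2))
  then have "((\<lambda>y. \<Sum>i\<in>Basis. (h y \<bullet> i) *\<^sub>R \<phi> y i) has_derivative (\<lambda>r. \<phi> x (h' r))) (at x)"
    by (simp only: linear_expansion[OF lin[OF U(2)], symmetric])
  then show ?thesis
    by (rule has_derivative_transform_within_open[OF _ U])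
      (simp only: linear_expansion[OF lin, symmetric])
qed

text \<open>By definiteness, the linear map sending \<open>z\<close> to the functional
  \<open>B z\<close> is injective, hence surjective by dimension; functionals are encoded by their
  values on the basis. This gives the Koszul formula its unique solution.\<close>

lemma positive_definite_ex1:
  fixes B :: "'e::euclidean_space \<Rightarrow> 'e \<Rightarrow> real"
  assumes B: "bilinear B" "\<And>a. a \<noteq> 0 \<Longrightarrow> B a a > 0" and \<phi>: "linear \<phi>"
  shows "\<exists>!z. \<forall>d. B z d = \<phi> d"
proof -
  define f where "f z = (\<Sum>i\<in>Basis. B z i *\<^sub>R i)" for z
  have lB: "linear (B z)" "linear (\<lambda>z. B z d)" for z d using B(1) by (auto simp: bilinear_def)
  have fi: "f z \<bullet> i = B z i" if "i \<in> Basis" for z i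
    using that by (simp add: f_def inner_sum_left inner_Basis if_distrib cong: if_cong)
  have eq: "B z = \<phi>" if "f z = (\<Sum>i\<in>Basis. \<phi> i *\<^sub>R i)" for z
  proof (rule linear_eq_stdbasis[OF lB(1) \<phi>])
    fix i :: 'e assume i: "i \<in> Basis"
    then show "B z i = \<phi> i" using fi[OF i, of z] that
      by (simp add: inner_sum_left inner_Basis if_distrib cong: if_cong)
  qed
  have "linear f" unfolding f_def
    by (rule linearI) (simp_all add: linear_add[OF lB(2)] linear_scale[OF lB(2)] sum.distrib
        scaleR_left_distrib scaleR_sum_right)
  moreover have "inj f"
  proof (rule linear_injective_0[THEN iffD2, OF \<open>linear f\<close>, rule_format])
    fix z assume "f z = 0"
    then have "B z = (\<lambda>d. 0)"
      using fi[of _ z] by (intro linear_eq_stdbasis[OF lB(1)]) (auto simp: module_hom_zero)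
    then show "z = 0" using B(2)[of z] by force
  qed
  ultimately have "surj f" using linear_injective_imp_surjective by blast
  then obtain z where "f z = (\<Sum>i\<in>Basis. \<phi> i *\<^sub>R i)" by (metis surjD)
  then have z: "\<forall>d. B z d = \<phi> d" using eq by simp
  moreover have "z' = z" if "\<forall>d. B z' d = \<phi> d" for z'
  proof -
    have "B (z' - z) (z' - z) = 0"
      using linear_diff[OF lB(2)] that z by simp
    then show ?thesis using B(2)[of "z' - z"] by force
  qed
  ultimately show ?thesis by blast
qed

text \<open>\<open>B x\<close> is coercive with a constant \<open>m\<close>, its minimum on the unit
  sphere, and by continuity of the entries \<open>B y\<close> is coercive with \<open>m / 2\<close>
  for \<open>y\<close> near \<open>x\<close>. Testing the equation at \<open>y\<close> with
  \<open>z y - z x\<close> bounds the norm of this difference by \<open>2 / m\<close> times the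
  residual \<open>R y\<close> of \<open>z x\<close> in the equation at \<open>y\<close>, and the
  residual tends to 0.\<close>

lemma isCont_positive_definite_solution:
  fixes B :: "'a::metric_space \<Rightarrow> 'e::euclidean_space \<Rightarrow> 'e \<Rightarrow> real"
  assumes U: "open U" "x \<in> U"
    and B: "\<And>y. y \<in> U \<Longrightarrow> bilinear (B y)" "\<And>a. a \<noteq> 0 \<Longrightarrow> B x a a > 0"
    and cont: "\<And>a b. isCont (\<lambda>y. B y a b) x" "\<And>d. isCont (\<lambda>y. \<phi> y d) x"
    and z: "\<And>y d. y \<in> U \<Longrightarrow> B y (z y) d = \<phi> y d"
  shows "isCont z x"
proof -
  have expB: "B y a b = (\<Sum>i\<in>Basis. \<Sum>j\<in>Basis. (a \<bullet> i) * (b \<bullet> j) * B y i j)" if "y \<in> U" for y a b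
  proof -
    have l: "linear (B y a)" "linear (\<lambda>a. B y a j)" for a j using B(1)[OF that] by (auto simp: bilinear_def)
    have "B y a b = (\<Sum>j\<in>Basis. (b \<bullet> j) *\<^sub>R (\<Sum>i\<in>Basis. (a \<bullet> i) *\<^sub>R B y i j))"
      using linear_expansion[OF l(1), of a b] linear_expansion[OF l(2), of a] by simp
    also have "\<dots> = (\<Sum>i\<in>Basis. \<Sum>j\<in>Basis. (a \<bullet> i) * (b \<bullet> j) * B y i j)"
      by (subst sum.swap) (simp add: sum_distrib_left mult_ac)
    finally show ?thesis .
  qed
  obtain m where m: "m > 0" "\<And>u. norm u = 1 \<Longrightarrow> m \<le> B x u u"
  proof -
    have "continuous_on (sphere 0 1) (\<lambda>u. \<Sum>i\<in>Basis. \<Sum>j\<in>Basis. (u \<bullet> i) * (u \<bullet> j) * B x i j)"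
      by (intro continuous_intros)
    then have "continuous_on (sphere 0 1) (\<lambda>u. B x u u)"
      by (rule continuous_on_eq) (rule expB[OF U(2), symmetric])
    moreover have "sphere (0::'e) 1 \<noteq> {}" by simp
    ultimately obtain u where u: "u \<in> sphere 0 1" "\<forall>v\<in>sphere 0 1. B x u u \<le> B x v v"
      using continuous_attains_inf[OF compact_sphere] by blast
    then have "u \<noteq> 0" by auto
    then show ?thesis using that[of "B x u u"] B(2)[of u] u(2) by simp
  qed
  have coercive: "m * (norm u)\<^sup>2 \<le> B x u u" for u
  proof (cases "u = 0")
    case False
    have bx: "linear (B x a)" "linear (\<lambda>a. B x a b)" for a b using B(1)[OF U(2)]
        by (auto simp: bilinear_def)
    have "m \<le> B x (inverse (norm u) *\<^sub>R u) (inverse (norm u) *\<^sub>R u)" using m(2) False by simp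
    also have "\<dots> = B x u u / (norm u)\<^sup>2"
      by (simp add: linear_scale[OF bx(1)] linear_scale[OF bx(2)] power2_eq_square divide_inverse)
    finally show ?thesis using False by (simp add: pos_le_divide_eq)
  qed (use B(1)[OF U(2)] in \<open>simp add: bilinear_lzero\<close>)
  define E where "E y = (\<Sum>i\<in>Basis. \<Sum>j\<in>Basis. \<bar>B y i j - B x i j\<bar>)" for y
  have E: "\<bar>B y u u - B x u u\<bar> \<le> E y * (norm u)\<^sup>2" if "y \<in> U" for y u
  proof -
    have "B y u u - B x u u = (\<Sum>i\<in>Basis. \<Sum>j\<in>Basis. (u \<bullet> i) * (u \<bullet> j) * (B y i j - B x i j))"
      by (simp only: expB[OF that, of u u] expB[OF U(2), of u u] right_diff_distrib sum_subtractf)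
    also have "\<bar>\<dots>\<bar> \<le> (\<Sum>i\<in>Basis. \<Sum>j\<in>Basis. \<bar>B y i j - B x i j\<bar> * (norm u)\<^sup>2)"
    proof (intro order_trans[OF sum_abs] sum_mono)
      fix i j :: 'e assume "i \<in> Basis" "j \<in> Basis"
      then have "\<bar>u \<bullet> i\<bar> * \<bar>u \<bullet> j\<bar> \<le> norm u * norm u" by (intro mult_mono Basis_le_norm) auto
      from mult_right_mono[OF this abs_ge_zero[of "B y i j - B x i j"]]
      show "\<bar>(u \<bullet> i) * (u \<bullet> j) * (B y i j - B x i j)\<bar> \<le> \<bar>B y i j - B x i j\<bar> * (norm u)\<^sup>2"
        by (simp add: abs_mult power2_eq_square mult_ac)
    qed
    also have "\<dots> = E y * (norm u)\<^sup>2" by (simp add: E_def sum_distrib_right)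
    finally show ?thesis .
  qed
  have E0: "(E \<longlongrightarrow> 0) (at x)"
  proof -
    have "(E \<longlongrightarrow> (\<Sum>i\<in>Basis. \<Sum>j\<in>Basis. \<bar>B x i j - B x i j\<bar>)) (at x)"
      unfolding E_def using cont(1) by (intro tendsto_intros) (simp add: isCont_def)
    then show ?thesis by simp
  qed
  define R where "R y = (\<Sum>i\<in>Basis. \<bar>\<phi> y i - B y (z x) i\<bar>)" for y
  have R0: "(R \<longlongrightarrow> 0) (at x)"
  proof -
    have "(R \<longlongrightarrow> (\<Sum>i\<in>Basis. \<bar>\<phi> x i - B x (z x) i\<bar>)) (at x)"
      unfolding R_def using cont by (intro tendsto_intros) (simp_all add: isCont_def)
    then show ?thesis using z[OF U(2)] by simp
  qed
  have "((\<lambda>y. 2 / m * R y) \<longlongrightarrow> 2 / m * 0) (at x)" by (intro tendsto_intros R0)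
  then have lim: "((\<lambda>y. 2 / m * R y) \<longlongrightarrow> 0) (at x)" by simp
  have "\<forall>\<^sub>F y in at x. E y < m / 2" using order_tendstoD(2)[OF E0, of "m / 2"] m by simp
  moreover have "\<forall>\<^sub>F y in at x. y \<in> U" using U by (simp add: eventually_at_in_open')
  ultimately have "\<forall>\<^sub>F y in at x. norm (z y - z x) \<le> 2 / m * R y"
  proof eventually_elim
    case (elim y)
    define u where "u = z y - z x"
    have l: "linear (B y a)" "linear (\<lambda>a. B y a b)" for a b using B(1)[OF elim(2)]
        by (auto simp: bilinear_def)
    have R': "R y \<ge> 0" by (simp add: R_def sum_nonneg)
    have "m * (norm u)\<^sup>2 - m / 2 * (norm u)\<^sup>2 \<le> B x u u - E y * (norm u)\<^sup>2"
      using coercive[of u] elim(1) by (intro diff_mono mult_right_mono) auto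
    also have "\<dots> \<le> B y u u" using E[OF elim(2), of u] by linarith
    also have "B y u u = (\<Sum>i\<in>Basis. (u \<bullet> i) *\<^sub>R B y u i)"
      by (rule linear_expansion[OF l(1)])
    also have "\<dots> = (\<Sum>i\<in>Basis. (u \<bullet> i) * (\<phi> y i - B y (z x) i))"
      using z[OF elim(2)] linear_diff[OF l(2)] by (simp add: u_def)
    also have "\<dots> \<le> (\<Sum>i\<in>Basis. norm u * \<bar>\<phi> y i - B y (z x) i\<bar>)"
    proof (rule sum_mono)
      fix i :: 'e assume "i \<in> Basis"
      then show "(u \<bullet> i) * (\<phi> y i - B y (z x) i) \<le> norm u * \<bar>\<phi> y i - B y (z x) i\<bar>"
        using Basis_le_norm[of i u] mult_right_mono[of "\<bar>u \<bullet> i\<bar>" "norm u" "\<bar>\<phi> y i - B y (z x) i\<bar>"]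
        by (auto simp: abs_mult[symmetric] intro: order_trans[OF abs_ge_self])
    qed
    also have "\<dots> = norm u * R y" by (simp add: R_def sum_distrib_left)
    finally have "norm u * (m / 2 * norm u) \<le> norm u * R y"
      by (simp add: power2_eq_square algebra_simps)
    then have "m / 2 * norm u \<le> R y"
      using R' by (cases "norm u = 0") auto
    then show ?case using m(1) by (simp add: u_def field_simps)
  qed
  then have "((\<lambda>y. z y - z x) \<longlongrightarrow> 0) (at x)"
    by (rule tendsto_norm_zero_cancel[OF tendsto_sandwich[OF _ _ tendsto_const lim], rotated]) auto
  then show ?thesis by (simp add: isCont_def LIM_zero_iff)
qed

section \<open>Finsler metrics in a chart\<close>

text \<open>Serves to differentiate identities in which \<open>w\<close> occurs both in the base
  point and, through \<open>l\<close>, in the direction: Euler's relations, where \<open>l\<close>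
  is the identity, and horizontality, where \<open>l\<close> is \<open>G x a\<close>.\<close>

lemma deriv_at_vertical_linear:
  fixes f g :: "'e::euclidean_space \<times> 'e \<Rightarrow> real"
  assumes f: "open D" "smooth_on D f" "(x, w) \<in> D" and l: "linear l"
  shows "((\<lambda>w. deriv_at f (x, w) (0, l w)) has_derivative
    (\<lambda>b. deriv2_at f (x, w) (0, b) (0, l w) + deriv_at f (x, w) (0, l b))) (at w)"
proof -
  have "bounded_linear l" using l linear_conv_bounded_linear by blast
  then have "((\<lambda>w. (0 :: 'e, l w)) has_derivative (\<lambda>b. (0, l b))) (at w)"
    by (intro has_derivative_Pair has_derivative_const bounded_linear_imp_has_derivative)
  moreover have "((\<lambda>w. (x, w)) has_derivative (\<lambda>b. (0, b))) (at w)"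
    by (intro has_derivative_Pair has_derivative_const has_derivative_ident)
  ultimately show ?thesis
    using has_derivative_deriv_at_pair[OF f(1,2), of "\<lambda>w. (x, w)" w "\<lambda>b. (0, b)" "\<lambda>w. (0, l w)"] f(3)
    by simp
qed

lemma deriv_at_vertical:
  fixes f :: "'e::euclidean_space \<times> 'e \<Rightarrow> real"
  assumes "smooth_on D f" "(x, w) \<in> D"
  shows "((\<lambda>w. f (x, w)) has_derivative (\<lambda>b. deriv_at f (x, w) (0, b))) (at w)"
proof -
  have "((\<lambda>w. (x, w)) has_derivative (\<lambda>b. (0, b))) (at w)"
    by (intro has_derivative_Pair has_derivative_const has_derivative_ident)
  from has_derivative_compose[OF this smooth_on_has_derivative[OF assms]] show ?thesis .
qed

section \<open>Fibre derivatives of a Finsler function: fundamental tensor, Cartan tensor, Euler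
  relations\<close>

locale finsler_chart =
  fixes \<Omega> :: "'e::euclidean_space set" and F :: "'e \<times> 'e \<Rightarrow> real"
  assumes open_base: "open \<Omega>"
    and smooth: "smooth_on (\<Omega> \<times> (UNIV - {0})) F"
    and homogeneous: "\<And>x w r. x \<in> \<Omega> \<Longrightarrow> r > 0 \<Longrightarrow> F (x, r *\<^sub>R w) = r * F (x, w)"
    and nonneg: "\<And>x w. x \<in> \<Omega> \<Longrightarrow> 0 \<le> F (x, w)"
    and definite: "\<And>x w a. x \<in> \<Omega> \<Longrightarrow> w \<noteq> 0 \<Longrightarrow> a \<noteq> 0 \<Longrightarrow>
      deriv2_at (\<lambda>u. (F (x, u))\<^sup>2 / 2) w a a > 0"
begin

abbreviation "D \<equiv> \<Omega> \<times> (UNIV - {0 :: 'e})"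

definition L :: "'e \<times> 'e \<Rightarrow> real" where "L z = (F z)\<^sup>2 / 2"

abbreviation dL :: "'e \<Rightarrow> 'e \<times> 'e \<Rightarrow> real"
  where "dL b \<equiv> \<lambda>z. deriv_at L z (0, b)"

definition g :: "'e \<times> 'e \<Rightarrow> 'e \<Rightarrow> 'e \<Rightarrow> real"
  where "g z a b = deriv2_at L z (0, a) (0, b)"

text \<open>Twice the Cartan tensor.\<close>

definition C :: "'e \<times> 'e \<Rightarrow> 'e \<Rightarrow> 'e \<Rightarrow> 'e \<Rightarrow> real"
  where "C z b d e = deriv2_at (dL b) z (0, d) (0, e)"

lemma open_D: "open D" by (intro open_Times open_base open_Diff) auto

lemma smooth_L: "smooth_on D L"
proof -
  have "smooth_on D (\<lambda>z. (F z * F z) * (1 / 2))"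
    by (intro smooth_on_mult open_D smooth smooth_on_const)
  then show ?thesis
    by (rule smooth_on_cong[OF open_D, rotated]) (simp add: L_def power2_eq_square)
qed

lemmas smooth_dL = smooth_on_deriv_at[OF smooth_L]
lemmas smooth_d2L = smooth_on_deriv_at[OF smooth_dL]

text \<open>Identities valid on \<open>D\<close> may be differentiated along the fibre, since the
  part of the fibre over \<open>x\<close> in \<open>D\<close> is open.\<close>

lemma vertical_eqI:
  assumes "(x, w) \<in> D" "\<And>w. (x, w) \<in> D \<Longrightarrow> p w = q w"
    and "(p has_derivative p') (at w)" "(q has_derivative q') (at w)"
  shows "p' = q'"
proof (rule has_derivative_unique)
  show "(p has_derivative q') (at w)"
    by (rule has_derivative_transform_within_open[OF assms(4), of "UNIV - {0}"])
      (use assms in \<open>auto intro: open_Diff\<close>)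
qed (fact assms(3))

lemma g_fundamental:
  assumes "(x, w) \<in> D"
  shows "deriv2_at (\<lambda>u. (F (x, u))\<^sup>2 / 2) w a b = g (x, w) a b"
proof -
  have 1: "deriv_at (\<lambda>u. (F (x, u))\<^sup>2 / 2) w b = deriv_at L (x, w) (0, b)" if "w \<in> UNIV - {0}" for w
    using deriv_at_eqI[OF deriv_at_vertical[OF smooth_L, of x w], of b] assms that by (simp add: L_def)
  have "deriv2_at (\<lambda>u. (F (x, u))\<^sup>2 / 2) w a b = deriv_at (\<lambda>w. deriv_at L (x, w) (0, b)) w a"
    by (rule deriv_at_cong[OF open_Diff[OF open_UNIV closed_singleton]]) (use assms 1 in auto)
  also have "\<dots> = g (x, w) a b"
    using deriv_at_eqI[OF deriv_at_vertical[OF smooth_dL assms], of "(0, b)" a] by (simp add: g_def)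
  finally show ?thesis .
qed

lemma g_pos: "(x, w) \<in> D \<Longrightarrow> a \<noteq> 0 \<Longrightarrow> g (x, w) a a > 0"
  using definite[of x w a] g_fundamental[of x w a a] by auto

lemma g_commute: "z \<in> D \<Longrightarrow> g z a b = g z b a"
  unfolding g_def by (rule deriv_at_commute[OF open_D smooth_L])

lemma linear_Pair0: "linear (\<lambda>a. (0, a))"
  by (rule linearI) auto

lemma bilinear_g:
  assumes "z \<in> D"
  shows "bilinear (g z)"
proof -
  have 1: "linear (\<lambda>a. g z a b)" for b
    using linear_compose[OF linear_Pair0 linear_deriv_at[OF smooth_dL assms]]
    by (simp add: g_def o_def)
  moreover have "linear (\<lambda>b. g z a b)" for a
    using 1[of a] g_commute[OF assms, of a] by simp
  ultimately show ?thesis by (simp add: bilinear_def)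
qed

lemma C_commute1: "z \<in> D \<Longrightarrow> C z b d e = C z b e d"
  unfolding C_def by (rule deriv_at_commute[OF open_D smooth_dL])

lemma C_eq: "C z b d e = deriv_at (\<lambda>z. g z e b) z (0, d)"
  by (simp add: C_def g_def)

lemma C_commute2: "z \<in> D \<Longrightarrow> C z b d e = C z e d b"
  unfolding C_eq by (rule deriv_at_cong[OF open_D]) (auto intro: g_commute)

lemma C_commute3: "z \<in> D \<Longrightarrow> C z b d e = C z d b e"
  using C_commute1 C_commute2 by metis

lemma linear_C:
  assumes "z \<in> D"
  shows "linear (C z b d)" "linear (\<lambda>d. C z b d e)" "linear (\<lambda>b. C z b d e)"
proof -
  show 1: "linear (\<lambda>d. C z b d e)" for b e
    using linear_compose[OF linear_Pair0 linear_deriv_at[OF smooth_on_deriv_at[OF smooth_dL] assms]]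
    by (simp add: C_def o_def)
  show "linear (C z b d)"
  proof -
    have "C z b d = (\<lambda>e. C z b e d)" using C_commute1[OF assms] by auto
    then show ?thesis using 1 by simp
  qed
  show "linear (\<lambda>b. C z b d e)"
    using 1[of d e] C_commute3[OF assms, of _ d e] by simp
qed

text \<open>\<open>L\<close> is homogeneous of degree 2 in the fibre; compare the derivatives of
  \<open>L (x, r *\<^sub>R w)\<close> in \<open>r\<close> at 1.\<close>

lemma euler_L:
  assumes z: "(x, w) \<in> D"
  shows "deriv_at L (x, w) (0, w) = 2 * L (x, w)"
proof -
  have "((\<lambda>r. L (x, r *\<^sub>R w)) has_derivative (\<lambda>r. deriv_at L (x, w) (0, r *\<^sub>R w))) (at 1)"
    by (rule has_derivative_compose[of "\<lambda>r. (x, r *\<^sub>R w)" "\<lambda>r. (0, r *\<^sub>R w)" 1 UNIV L])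
      (use smooth_on_has_derivative[OF smooth_L z] in \<open>auto intro!: derivative_eq_intros\<close>)
  moreover have "((\<lambda>r. L (x, r *\<^sub>R w)) has_derivative (\<lambda>r. r * (2 * L (x, w)))) (at 1)"
  proof (rule has_derivative_transform_within_open)
    show "((\<lambda>r. r * r * L (x, w)) has_derivative (\<lambda>r. r * (2 * L (x, w)))) (at 1)"
      by (auto intro!: derivative_eq_intros simp: algebra_simps)
    show "r * r * L (x, w) = L (x, r *\<^sub>R w)" if "r \<in> {0<..}" for r
      using homogeneous[of x r w] z that by (simp add: L_def power2_eq_square)
  qed auto
  ultimately have "(\<lambda>r. deriv_at L (x, w) (0, r *\<^sub>R w)) = (\<lambda>r. r * (2 * L (x, w)))"
    by (rule has_derivative_unique)
  from fun_cong[OF this, of 1] show ?thesis by simp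
qed

text \<open>The fibre derivative of \<open>euler_L\<close>: its left-hand side contributes one copy
  of the first derivative from the direction \<open>w\<close>, which cancels against one of the two
  on the right.\<close>

lemma euler_dL:
  assumes z: "(x, w) \<in> D"
  shows "g (x, w) b w = deriv_at L (x, w) (0, b)"
proof -
  have "(\<lambda>b. deriv2_at L (x, w) (0, b) (0, w) + deriv_at L (x, w) (0, b)) =
      (\<lambda>b. 2 * deriv_at L (x, w) (0, b))"
    by (rule vertical_eqI[OF z euler_L deriv_at_vertical_linear[OF open_D smooth_L z linear_ident]
          has_derivative_mult_right[OF deriv_at_vertical[OF smooth_L z]]])
  from fun_cong[OF this, of b] show ?thesis by (simp add: g_def)
qed

text \<open>The fibre derivative of \<open>euler_dL\<close>, in which the second-order terms cancel.
  Together with the symmetry of \<open>C\<close> it makes every Cartan term with an entry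
  \<open>w\<close> vanish.\<close>

lemma C_eq_zero:
  assumes z: "(x, w) \<in> D"
  shows "C (x, w) b d w = 0"
proof -
  have "deriv_at (dL b) (x, w) (0, w) = deriv_at L (x, w) (0, b)" if "(x, w) \<in> D" for w
    using euler_dL[OF that, of b] g_commute[OF that, of b w] by (simp add: g_def)
  from vertical_eqI[OF z this deriv_at_vertical_linear[OF open_D smooth_dL z linear_ident]
      deriv_at_vertical[OF smooth_dL z]]
  have "(\<lambda>d. C (x, w) b d w + deriv_at (dL b) (x, w) (0, d)) =
      (\<lambda>d. deriv_at (dL b) (x, w) (0, d))"
    by (simp add: C_def)
  from fun_cong[OF this, of d] show ?thesis by simp
qed

lemma F_pos:
  assumes z: "(x, w) \<in> D"
  shows "F (x, w) > 0"
proof -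
  have "2 * L (x, w) = g (x, w) w w"
    using euler_L[OF z] euler_dL[OF z, of w] by simp
  moreover have "g (x, w) w w > 0" using g_pos[OF z, of w] z by simp
  ultimately have "F (x, w) \<noteq> 0" by (auto simp: L_def)
  then show ?thesis using nonneg[of x w] z by auto
qed

lemma F_zero: "x \<in> \<Omega> \<Longrightarrow> F (x, 0) = 0"
  using homogeneous[of x 2 0] by simp

text \<open>The horizontal lift of \<open>a\<close> at \<open>(x, w)\<close> is
  \<open>(a, - G x a w)\<close>. Vanishing of the derivative of \<open>F\<close> along it is the
  infinitesimal form of invariance under parallel transport.\<close>

definition horizontal :: "('e \<Rightarrow> 'e \<Rightarrow> 'e \<Rightarrow> 'e) \<Rightarrow> bool"
  where "horizontal G \<longleftrightarrow> (\<forall>x w a. (x, w) \<in> D \<longrightarrow>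
    deriv_at F (x, w) (a, 0) = deriv_at F (x, w) (0, G x a w))"

lemma horizontal_L:
  assumes "horizontal G" "(x, w) \<in> D"
  shows "deriv_at L (x, w) (a, 0) = deriv_at L (x, w) (0, G x a w)"
proof -
  have "(L has_derivative (\<lambda>h. F (x, w) * deriv_at F (x, w) h)) (at (x, w))"
    unfolding L_def using smooth_on_has_derivative[OF smooth assms(2)]
    by (auto intro!: derivative_eq_intros)
  from deriv_at_eqI[OF this] show ?thesis
    using assms unfolding horizontal_def by simp
qed

lemma horizontal_dL:
  assumes G: "horizontal G" "linear (G x a)" and z: "(x, w) \<in> D"
  shows "deriv_at (dL b) (x, w) (a, 0) =
    deriv_at (dL b) (x, w) (0, G x a w) + deriv_at L (x, w) (0, G x a b)"
proof -
  from vertical_eqI[OF z horizontal_L[OF G(1)] deriv_at_vertical[OF smooth_dL z]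
      deriv_at_vertical_linear[OF open_D smooth_L z G(2)]]
  have "deriv2_at L (x, w) (0, b) (a, 0) = deriv2_at L (x, w) (0, b) (0, G x a w) +
      deriv_at L (x, w) (0, G x a b)"
    by metis
  then show ?thesis
    by (simp add: deriv_at_commute[OF open_D smooth_L z, of "(0, b)"])
qed

text \<open>Two fibre derivatives of \<open>horizontal_L\<close>, with the mixed derivatives
  interchanged. The result says that \<open>g\<close> is parallel along horizontal lifts; the Cartan
  term accounts for the fibre component of the lift.\<close>

lemma horizontal_d2L:
  assumes G: "horizontal G" "linear (G x a)" and z: "(x, w) \<in> D"
  shows "deriv_at (\<lambda>z. g z b d) (x, w) (a, 0) =
    C (x, w) b d (G x a w) + g (x, w) (G x a b) d + g (x, w) b (G x a d)"
proof -
  have lhs: "((\<lambda>w. deriv_at (dL b) (x, w) (a, 0)) has_derivative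
      (\<lambda>d. deriv2_at (dL b) (x, w) (0, d) (a, 0))) (at w)"
    by (rule deriv_at_vertical[OF smooth_d2L z])
  have rhs: "((\<lambda>w. deriv_at (dL b) (x, w) (0, G x a w) + deriv_at L (x, w) (0, G x a b)) has_derivative
      (\<lambda>d. (C (x, w) b d (G x a w) + deriv_at (dL b) (x, w) (0, G x a d)) + g (x, w) d (G x a b))) (at w)"
    using has_derivative_add[OF deriv_at_vertical_linear[OF open_D smooth_dL z G(2), of "(0, b)"]
        deriv_at_vertical[OF smooth_dL z, of "(0, G x a b)"]]
    by (simp add: C_def g_def)
  have "deriv2_at (dL b) (x, w) (0, d) (a, 0) =
      (C (x, w) b d (G x a w) + deriv_at (dL b) (x, w) (0, G x a d)) + g (x, w) d (G x a b)"
    using fun_cong[OF vertical_eqI[OF z horizontal_dL[OF G] lhs rhs], of d] .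
  moreover have "deriv_at (dL b) (x, w) (0, G x a d) = g (x, w) b (G x a d)"
    using g_commute[OF z] by (simp add: g_def)
  moreover have "deriv2_at (dL b) (x, w) (0, d) (a, 0) = deriv_at (\<lambda>z. g z b d) (x, w) (a, 0)"
  proof -
    have "deriv2_at (dL b) (x, w) (0, d) (a, 0) = deriv_at (\<lambda>z. g z d b) (x, w) (a, 0)"
      using deriv_at_commute[OF open_D smooth_dL z, of "(0, b)" "(0, d)" "(a, 0)"] by (simp add: g_def)
    also have "\<dots> = deriv_at (\<lambda>z. g z b d) (x, w) (a, 0)"
      by (rule deriv_at_cong[OF open_D z g_commute])
    finally show ?thesis .
  qed
  ultimately show ?thesis using g_commute[OF z] by simp
qed

text \<open>The difference \<open>E\<close> of two horizontal symmetric connections satisfies \<open>dL(w) (E a w) = 0\<close>.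
  Differentiating in \<open>w\<close> and putting \<open>a = w\<close> makes \<open>E w w\<close> orthogonal to everything.\<close>

lemma horizontal_unique:
  assumes "horizontal G" "horizontal G'" "x \<in> \<Omega>"
    and "bilinear (G x)" "bilinear (G' x)"
    and sym: "\<And>a b. G x a b = G x b a" "\<And>a b. G' x a b = G' x b a"
  shows "G x = G' x"
proof -
  define E where "E a b = G x a b - G' x a b" for a b
  have lin: "linear (E a)" "linear (\<lambda>a. E a b)" for a b
    using assms(4,5) unfolding E_def by (auto simp: bilinear_def intro: linear_compose_sub)
  have dE: "deriv_at L (x, w) (0, E a w) = 0" if z: "(x, w) \<in> D" for a w
  proof -
    have "deriv_at L (x, w) (0, E a w) = deriv_at L (x, w) ((0, G x a w) - (0, G' x a w))"
      by (simp add: E_def)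
    also have "\<dots> = deriv_at L (x, w) (0, G x a w) - deriv_at L (x, w) (0, G' x a w)"
      by (rule linear_diff[OF linear_deriv_at[OF smooth_L z]])
    finally have "deriv_at L (x, w) (0, E a w) =
        deriv_at L (x, w) (0, G x a w) - deriv_at L (x, w) (0, G' x a w)" .
    then show ?thesis using horizontal_L[OF assms(1) z, of a] horizontal_L[OF assms(2) z, of a] by simp
  qed
  have Eww: "E w w = 0" for w
  proof (cases "w = 0")
    case False
    then have z: "(x, w) \<in> D" using assms(3) by simp
    have 0: "((\<lambda>w. 0 :: real) has_derivative (\<lambda>b. 0)) (at w)" by simp
    have "g (x, w) b (E w w) = 0" for b
    proof -
      have "g (x, w) b (E w w) + deriv_at L (x, w) (0, E w b) = 0"
        using fun_cong[OF vertical_eqI[OF z dE deriv_at_vertical_linear[OF open_D smooth_L z lin(1)] 0], of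
            w b]
        by (simp add: g_def)
      moreover have "E w b = E b w" using sym by (simp add: E_def)
      ultimately show ?thesis using dE[OF z, of b] by simp
    qed
    then show ?thesis using g_pos[OF z, of "E w w"] by (metis less_irrefl)
  qed (use linear_0[OF lin(1)] in auto)
  have "E a b = 0" for a b
  proof -
    have "E (a + b) (a + b) = E a a + E b b + (E a b + E b a)"
      by (simp add: linear_add[OF lin(1)] linear_add[OF lin(2)])
    moreover have "E b a = E a b" using sym by (simp add: E_def)
    ultimately have "2 *\<^sub>R E a b = 0" using Eww by (simp add: scaleR_2)
    then show ?thesis by simp
  qed
  then show ?thesis by (intro ext) (simp add: E_def)
qed

end

section \<open>Ricci curvature\<close>

context finsler_chart
begin

text \<open>The Levi-Civita connection of \<open>g\<^sub>W\<close> differs from \<open>G\<close> by a tensor \<open>T\<close> annihilating \<open>W\<close>.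
  Differentiating \<open>T a W = 0\<close> shows that \<open>T\<close> does not contribute to the curvature in the
  direction of \<open>W\<close>; by \<open>has_derivative_linear_family_zero\<close> continuity of \<open>T\<close> suffices for this.\<close>

lemma ricci_tensor_geodesic_field:
  assumes G: "horizontal G" "\<And>x. x \<in> \<Omega> \<Longrightarrow> bilinear (G x)" "\<And>x a b. x \<in> \<Omega> \<Longrightarrow> G x a b = G x b a"
      "\<And>a b. smooth_on \<Omega> (\<lambda>x. G x a b)"
    and U: "open U" "U \<subseteq> \<Omega>" "x0 \<in> U"
    and W: "smooth_on U W" "\<And>x. x \<in> U \<Longrightarrow> W x \<noteq> 0"
      "\<And>x. x \<in> U \<Longrightarrow> deriv_at W x (W x) + G x (W x) (W x) = 0"
  shows "ricci_tensor (\<lambda>x. deriv2_at (\<lambda>u. (F (x, u))\<^sup>2 / 2) (W x)) x0 (W x0) (W x0) =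
    (\<Sum>i\<in>Basis. curvature G x0 i (W x0) (W x0) \<bullet> i)"
proof -
  define gW where "gW x = deriv2_at (\<lambda>u. (F (x, u))\<^sup>2 / 2) (W x)" for x
  have z: "(x, W x) \<in> D" if "x \<in> U" for x using that U W by auto
  have xO: "x \<in> \<Omega>" if "x \<in> U" for x using that U by auto
  have gW: "gW x a b = g (x, W x) a b" if "x \<in> U" for x a b
    unfolding gW_def by (rule g_fundamental[OF z[OF that]])
  have linG: "linear (G x a)" "linear (\<lambda>a. G x a b)" if "x \<in> U" for x a b
    using G(2)[OF xO[OF that]] by (auto simp: bilinear_def)
  have ling: "linear (g (x, W x) a)" "linear (\<lambda>a. g (x, W x) a b)" if "x \<in> U" for x a b
    using bilinear_g[OF z[OF that]] by (auto simp: bilinear_def)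
  \<comment> \<open>\<open>N x a\<close> is the covariant derivative of \<open>W\<close> in
    direction \<open>a\<close> with respect to \<open>G\<close>; it vanishes in the direction of
    \<open>W\<close> itself.\<close>
  define N where "N x a = deriv_at W x a + G x a (W x)" for x a
  have linN: "linear (N x)" if "x \<in> U" for x
    unfolding N_def using linear_deriv_at[OF W(1) that] linG(2)[OF that]
    by (intro linear_compose_add) auto
  have NW: "N x (W x) = 0" if "x \<in> U" for x using W(3)[OF that] by (simp add: N_def)
  have graph: "((\<lambda>y. (y, W y)) has_derivative (\<lambda>a. (a, deriv_at W x a))) (at x)" if "x \<in> U" for x
    by (intro has_derivative_Pair has_derivative_ident smooth_on_has_derivative[OF W(1) that])
  have smooth_g: "smooth_on D (\<lambda>z. g z b d)" for b d
    unfolding g_def by (rule smooth_d2L)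
  \<comment> \<open>Chain rule along the graph of \<open>W\<close>: the base derivative is given by
    \<open>horizontal_d2L\<close>, the fibre derivative is a Cartan term, and the two Cartan terms
    combine into one with entry \<open>N x a\<close>.\<close>
  have dgW: "deriv_at (\<lambda>y. gW y b d) x a =
      C (x, W x) b d (N x a) + g (x, W x) (G x a b) d + g (x, W x) b (G x a d)" if x: "x \<in> U" for x a b d
  proof -
    have "deriv_at (\<lambda>y. gW y b d) x a = deriv_at (\<lambda>y. g (y, W y) b d) x a"
      by (rule deriv_at_cong[OF U(1) x gW])
    also have "\<dots> = deriv_at (\<lambda>z. g z b d) (x, W x) (a, deriv_at W x a)"
      by (rule deriv_at_eqI[OF has_derivative_compose[OF graph[OF x]
          smooth_on_has_derivative[OF smooth_g z[OF x]]]])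
    also have "\<dots> = deriv_at (\<lambda>z. g z b d) (x, W x) ((a, 0) + (0, deriv_at W x a))" by simp
    also have "\<dots> = deriv_at (\<lambda>z. g z b d) (x, W x) (a, 0) +
        deriv_at (\<lambda>z. g z b d) (x, W x) (0, deriv_at W x a)"
      by (rule linear_add[OF linear_deriv_at[OF smooth_g z[OF x]]])
    also have "deriv_at (\<lambda>z. g z b d) (x, W x) (0, deriv_at W x a) = C (x, W x) b d (deriv_at W x a)"
      using C_eq[of "(x, W x)" d "deriv_at W x a" b] C_commute1[OF z[OF x]] C_commute2[OF z[OF x]] by metis
    also have "deriv_at (\<lambda>z. g z b d) (x, W x) (a, 0) =
        C (x, W x) b d (G x a (W x)) + g (x, W x) (G x a b) d + g (x, W x) b (G x a d)"
      by (rule horizontal_d2L[OF G(1) linG(1)[OF x] z[OF x]])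
    finally show ?thesis
      by (simp add: N_def linear_add[OF linear_C(1)[OF z[OF x]]])
  qed
  \<comment> \<open>The Koszul combination of the Cartan terms in \<open>dgW\<close>. The remaining
    terms add up to twice \<open>g (x, W x) (G x a b) d\<close> because \<open>G\<close> is
    symmetric.\<close>
  define S where "S x a b d = C (x, W x) b d (N x a) + C (x, W x) a d (N x b) - C (x, W x) a b (N x d)"
      for x a b d
  have linS: "linear (S x a b)" "linear (\<lambda>b. S x a b d)" "linear (\<lambda>a. S x a b d)" if "x \<in> U" for x a b d
    unfolding S_def
    using linear_C[OF z[OF that]] linear_compose[OF linN[OF that] linear_C(1)[OF z[OF that]]]
    by (intro linear_compose_add linear_compose_sub; simp add: o_def)+
  define T where "T x a b = levi_civita gW x a b - G x a b" for x a b
  have T: "g (x, W x) (T x a b) d = S x a b d / 2" if x: "x \<in> U" for x a b d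
  proof -
    have "linear (\<lambda>d. g (x, W x) (G x a b) d + S x a b d / 2)"
      using linear_compose_add[OF ling(1)[OF x] linear_compose_scale_right[OF linS(1)[OF x], of "1/2"]]
      by simp
    from positive_definite_ex1[OF bilinear_g[OF z[OF x]] g_pos[OF z[OF x]] this]
    have ex: "\<exists>!u. \<forall>d. g (x, W x) u d = g (x, W x) (G x a b) d + S x a b d / 2" .
    have "2 * gW x u d = deriv_at (\<lambda>y. gW y b d) x a +
        deriv_at (\<lambda>y. gW y a d) x b - deriv_at (\<lambda>y. gW y a b) x d \<longleftrightarrow>
        g (x, W x) u d = g (x, W x) (G x a b) d + S x a b d / 2" for u d
    proof -
      have "g (x, W x) b (G x a d) = g (x, W x) (G x d a) b"
        using g_commute[OF z[OF x]] G(3)[OF xO[OF x]] by metis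
      moreover have "G x b a = G x a b" "G x b d = G x d b"
        using G(3)[OF xO[OF x]] by blast+
      ultimately show ?thesis
        by (simp only: dgW[OF x] gW[OF x] S_def) (simp add: field_simps)
    qed
    then have "levi_civita gW x a b = (THE u. \<forall>d. g (x, W x) u d = g (x, W x) (G x a b) d + S x a b d / 2)"
      unfolding levi_civita_def by simp
    then have "g (x, W x) (levi_civita gW x a b) d = g (x, W x) (G x a b) d + S x a b d / 2"
      using theI'[OF ex] by simp
    then show ?thesis by (simp add: T_def linear_diff[OF ling(2)[OF x]])
  qed
  have g_unique: "u = v" if x: "x \<in> U" and eq: "\<And>d. g (x, W x) u d = g (x, W x) v d" for x u v
  proof -
    have "g (x, W x) (u - v) (u - v) = 0" using eq by (simp add: linear_diff[OF ling(2)[OF x]])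
    then show ?thesis using g_pos[OF z[OF x], of "u - v"] by force
  qed
  have Tsym: "T x a b = T x b a" if x: "x \<in> U" for x a b
    by (rule g_unique[OF x]) (simp add: T[OF x] S_def C_commute3[OF z[OF x], of a b])
  have linT: "linear (T x a)" if x: "x \<in> U" for x a
  proof (rule linearI)
    show "T x a (b + b') = T x a b + T x a b'" for b b'
      by (rule g_unique[OF x])
        (simp add: T[OF x] linear_add[OF ling(2)[OF x]] linear_add[OF linS(2)[OF x]] add_divide_distrib)
    show "T x a (r *\<^sub>R b) = r *\<^sub>R T x a b" for r b
      by (rule g_unique[OF x]) (simp add: T[OF x] linear_scale[OF ling(2)[OF x]]
          linear_scale[OF linS(2)[OF x]])
  qed
  have TW: "T x a (W x) = 0" if x: "x \<in> U" for x a
  proof (rule g_unique[OF x])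
    \<comment> \<open>With \<open>W x\<close> inserted, two terms of \<open>S\<close> contain a
      Cartan tensor with entry \<open>W x\<close>, and the third contains
      \<open>N x (W x) = 0\<close>.\<close>
    have "C (x, W x) b (W x) d = 0" "C (x, W x) (W x) b d = 0" for b d
      using C_eq_zero[OF z[OF x]] C_commute1[OF z[OF x]] C_commute2[OF z[OF x]] by metis+
    then have "S x a (W x) d = 0" for d
      by (simp add: S_def NW[OF x] linear_0[OF linear_C(1)[OF z[OF x]]])
    then show "g (x, W x) (T x a (W x)) d = g (x, W x) 0 d" for d
      by (simp add: T[OF x] linear_0[OF ling(2)[OF x]])
  qed
  have cW: "continuous_on U W" by (rule smooth_on_continuous_on[OF W(1)])
  have cgraph: "continuous_on U (\<lambda>y. f (y, W y))" if "smooth_on D f" for f :: "_ \<Rightarrow> real"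
    by (rule continuous_on_compose2[OF smooth_on_continuous_on[OF that]])
      (use z cW in \<open>auto intro!: continuous_intros\<close>)
  have cG: "continuous_on U (\<lambda>y. G y a b)" for a b
    using smooth_on_continuous_on[OF G(4)] U(2) continuous_on_subset by blast
  have cN: "continuous_on U (\<lambda>y. N y a)" for a
  proof -
    have "continuous_on U (\<lambda>y. deriv_at W y a + (\<Sum>i\<in>Basis. (W y \<bullet> i) *\<^sub>R G y a i))"
      by (intro continuous_intros cW cG smooth_on_continuous_on[OF smooth_on_deriv_at[OF W(1)]])
    then show ?thesis
      by (rule continuous_on_eq) (simp only: N_def linear_expansion[OF linG(1), symmetric])
  qed
  have cC: "continuous_on U (\<lambda>y. C (y, W y) b d (N y a))" for a b d
  proof -
    have "continuous_on U (\<lambda>y. \<Sum>i\<in>Basis. (N y a \<bullet> i) *\<^sub>R C (y, W y) b d i)"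
      unfolding C_def by (intro continuous_intros cN cgraph smooth_on_deriv_at smooth_d2L)
    then show ?thesis
      by (rule continuous_on_eq) (simp only: linear_expansion[OF linear_C(1)[OF z], symmetric])
  qed
  have isCont_U: "isCont f x0" if "continuous_on U f" for f :: "'e \<Rightarrow> real"
    using that U by (simp add: continuous_on_eq_continuous_at)
  have contT: "isCont (\<lambda>y. T y a b) x0" for a b
  proof (rule isCont_positive_definite_solution[OF U(1,3), where B = "\<lambda>y. g (y, W y)" and \<phi> =
      "\<lambda>y d. S y a b d / 2"])
    show "isCont (\<lambda>y. S y a b d / 2) x0" for d
      unfolding S_def by (intro isCont_U continuous_intros cC) simp
    show "isCont (\<lambda>y. g (y, W y) a b) x0" for a b
      by (intro isCont_U cgraph smooth_g)
  qed (use bilinear_g z g_pos U(3) T in auto)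
  define v where "v = W x0"
  have dT: "((\<lambda>y. T y a v) has_derivative (\<lambda>h. - T x0 a (deriv_at W x0 h))) (at x0)" for a
  proof -
    \<comment> \<open>Since \<open>T y a (W y) = 0\<close>, the value \<open>T y a v\<close> equals
      \<open>T y a (v - W y)\<close>, whose last argument vanishes at \<open>x0\<close>; thus no
      derivative of \<open>T\<close> enters.\<close>
    have "((\<lambda>y. v - W y) has_derivative (\<lambda>h. 0 - deriv_at W x0 h)) (at x0)"
      by (intro has_derivative_diff has_derivative_const smooth_on_has_derivative[OF W(1) U(3)])
    from has_derivative_linear_family_zero[OF linT U(1,3) contT this]
    have "((\<lambda>y. T y a (v - W y)) has_derivative (\<lambda>h. T x0 a (0 - deriv_at W x0 h))) (at x0)"
      by (simp add: v_def)
    then have "((\<lambda>y. T y a (v - W y)) has_derivative (\<lambda>h. - T x0 a (deriv_at W x0 h))) (at x0)"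
      by (simp add: linear_neg[OF linT[OF U(3)]])
    then show ?thesis
      by (rule has_derivative_transform_within_open[OF _ U(1,3)])
        (simp add: linear_diff[OF linT] TW)
  qed
  have dGamma: "deriv_at (\<lambda>y. levi_civita gW y a v) x0 h =
      deriv_at (\<lambda>y. G y a v) x0 h - T x0 a (deriv_at W x0 h)" for a h
  proof -
    have "((\<lambda>y. G y a v + T y a v) has_derivative
        (\<lambda>h. deriv_at (\<lambda>y. G y a v) x0 h + - T x0 a (deriv_at W x0 h))) (at x0)"
      by (intro has_derivative_add dT smooth_on_has_derivative[OF G(4) xO[OF U(3)]])
    from deriv_at_eqI[OF this] show ?thesis by (simp add: T_def)
  qed
  have Gamma: "levi_civita gW x0 a b = G x0 a b + T x0 a b" for a b by (simp add: T_def)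
  have Tv: "T x0 a v = 0" "T x0 v a = 0" for a
    using TW[OF U(3)] Tsym[OF U(3)] by (simp_all add: v_def)
  have DWv: "deriv_at W x0 v = - G x0 v v"
    using W(3)[OF U(3)] by (simp add: v_def eq_neg_iff_add_eq_0)
  \<comment> \<open>Two contributions of \<open>T\<close> survive: \<open>T x0 i (G x0 v v)\<close>
    from the product of the symbols, and its negative from the derivative in direction
    \<open>v\<close>, where the geodesic equation gives \<open>DWv\<close>. They cancel.\<close>
  have "curvature (levi_civita gW) x0 i v v = curvature G x0 i v v" for i
    by (simp add: curvature_def dGamma Gamma Tv DWv linear_neg[OF linT[OF U(3)]]
        linear_add[OF linG(1)[OF U(3)]])
  then show ?thesis
    by (simp add: ricci_tensor_def gW_def[abs_def] v_def)
qed

end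

section \<open>From charts to the manifold: the induced connection and Ricci curvature\<close>

context manifold
begin

lemma finsler_chartI:
  assumes F: "finsler A F" and c: "c \<in> A"
  shows "finsler_chart (crange c) (in_chart_pair A F c)"
proof
  show "open (crange c)" by (rule open_crange[OF c])
  show "smooth_on (crange c \<times> (UNIV - {0})) (in_chart_pair A F c)"
    using F c by (simp add: finsler_def in_chart_pair_def)
  fix x assume x: "x \<in> crange c"
  show "in_chart_pair A F c (x, r *\<^sub>R w) = r * in_chart_pair A F c (x, w)" if "r > 0" for w r
    using F that tangent_of_in_tangent_bundle[OF c x]
    by (simp add: finsler_def in_chart_pair_def in_chart_def scale_tangent_tangent_of[OF c x, symmetric])
  show "0 \<le> in_chart_pair A F c (x, w)" for w
    using F tangent_of_in_tangent_bundle[OF c x] by (simp add: finsler_def in_chart_pair_def in_chart_def)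
  show "0 < deriv2_at (\<lambda>u. (in_chart_pair A F c (x, u))\<^sup>2 / 2) w a a" if "w \<noteq> 0" "a \<noteq> 0" for w a
    using F c x that by (simp add: finsler_def in_chart_pair_def fundamental_tensor_def)
qed

lemma horizontal_if_induced:
  assumes F: "finsler A F" and G: "is_induced_connection A F G" and c: "c \<in> A"
  shows "finsler_chart.horizontal (crange c) (in_chart_pair A F c) (G c)"
proof -
  interpret finsler_chart "crange c" "in_chart_pair A F c"
    using finsler_chartI[OF F c] .
  show ?thesis
    using transport_preserves_imp_horizontal[OF F _ _ c] G
    unfolding horizontal_def is_induced_connection_def by auto
qed

lemma affine_connectionD:
  assumes "affine_connection A G" "c \<in> A"
  shows "x \<in> crange c \<Longrightarrow> bilinear (G c x)" "smooth_on (crange c) (\<lambda>x. G c x a b)"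
  using assms by (auto simp: affine_connection_def)

text \<open>Inside the charts, horizontality and symmetry determine the symbols; elsewhere the
  normalization in \<open>affine_connection\<close> does, so that equality holds between
  functions.\<close>

lemma induced_connection_unique:
  assumes F: "finsler A F" and G: "is_induced_connection A F G" "is_induced_connection A F G'"
  shows "G = G'"
proof (intro ext)
  fix c x a b
  show "G c x a b = G' c x a b"
  proof (cases "c \<in> A \<and> x \<in> crange c")
    case True
    then interpret finsler_chart "crange c" "in_chart_pair A F c"
      using finsler_chartI[OF F] by blast
    have "G c x = G' c x"
      by (rule horizontal_unique)
        (use True G horizontal_if_induced[OF F] affine_connectionD in
          \<open>auto simp: is_induced_connection_def torsion_free_def\<close>)
    then show ?thesis by simp
  next
    case False
    then have "G c x = (\<lambda>a b. 0)" "G' c x = (\<lambda>a b. 0)"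
      using G unfolding is_induced_connection_def affine_connection_def by blast+
    then show ?thesis by simp
  qed
qed

lemma is_induced_induced_connection:
  assumes "berwald A F"
  shows "is_induced_connection A F (induced_connection A F)"
proof -
  obtain G where F: "finsler A F" and G: "is_induced_connection A F G"
    using assms by (auto simp: berwald_def)
  show ?thesis
    unfolding induced_connection_def
    by (rule theI[where P = "is_induced_connection A F", OF G induced_connection_unique[OF F _ G]])
qed

text \<open>Feeds the components of \<open>V\<close> into
  \<open>ricci_tensor_geodesic_field\<close>. The right-hand side involves \<open>F\<close> only
  through its connection and does not mention \<open>V\<close>.\<close>

lemma ricci_tensor_geodesic_extension:
  assumes F: "berwald A F" and V: "geodesic_extension A F v U V" and c: "c \<in> A" "base v \<in> cdom c"
  shows "ricci_tensor (\<lambda>x. fundamental_tensor A F c x (comp_in c (V (param c x))))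
      (coord c (base v)) (comp_in c v) (comp_in c v) =
    (\<Sum>i\<in>Basis. curvature (induced_connection A F c) (coord c (base v)) i (comp_in c v) (comp_in c v) \<bullet> i)"
proof -
  define G where "G = induced_connection A F"
  have fin: "finsler A F" and G: "is_induced_connection A F G"
    using F is_induced_induced_connection[OF F] by (auto simp: berwald_def G_def)
  then have aff: "affine_connection A G" and tf: "torsion_free A G"
    by (auto simp: is_induced_connection_def)
  interpret finsler_chart "crange c" "in_chart_pair A F c"
    using finsler_chartI[OF fin c(1)] .
  define S where "S = coord c ` (U \<inter> cdom c)"
  define W where "W x = comp_in c (V (param c x))" for x
  have sv: "smooth_vector_field A U V" and v: "base v \<in> U" "V (base v) = v"
    using V by (auto simp: geodesic_extension_def)
  have S_D: "x \<in> crange c" "param c x \<in> U" if "x \<in> S" for x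
    using that in_coord_image_iff[OF c(1)] unfolding S_def by blast+
  have x0: "coord c (base v) \<in> S" using v c by (auto simp: S_def)
  have Wv: "W (coord c (base v)) = comp_in c v" by (simp add: W_def param_coord c v)
  have "ricci_tensor (\<lambda>x. deriv2_at (\<lambda>u. (in_chart_pair A F c (x, u))\<^sup>2 / 2) (W x))
      (coord c (base v)) (W (coord c (base v))) (W (coord c (base v))) =
    (\<Sum>i\<in>Basis. curvature (G c) (coord c (base v)) i (W (coord c (base v))) (W (coord c (base v))) \<bullet> i)"
  proof (rule ricci_tensor_geodesic_field)
    show "horizontal (G c)" by (rule horizontal_if_induced[OF fin G c(1)])
    show "bilinear (G c x)" if "x \<in> crange c" for x using affine_connectionD(1)[OF aff c(1) that] .
    show "G c x a b = G c x b a" if "x \<in> crange c" for x a b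
      using tf c(1) that by (auto simp: torsion_free_def)
    show "smooth_on (crange c) (\<lambda>x. G c x a b)" for a b using affine_connectionD(2)[OF aff c(1)] .
    show "open S" unfolding S_def
      using sv by (intro open_coord_image c) (auto simp: smooth_vector_field_def)
    show "S \<subseteq> crange c" using S_D by auto
    show "coord c (base v) \<in> S" by (fact x0)
    show "smooth_on S W" using sv c(1) by (simp add: smooth_vector_field_def W_def[abs_def] S_def)
    show "W x \<noteq> 0" if x: "x \<in> S" for x
    proof
      assume "W x = 0"
      have "V (param c x) \<in> tangent_bundle A" "base (V (param c x)) = param c x"
        using sv S_D[OF x] by (auto simp: smooth_vector_field_def)
      then have "V (param c x) = tangent_of A c x 0"
        using tangent_of_comp_in[OF c(1), of "V (param c x)"] \<open>W x = 0\<close> S_D[OF x]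
          param_in_cdom[OF c(1)] coord_param[OF c(1)] by (simp add: W_def)
      then have "V (param c x) = zero_tangent (param c x)"
        using tangent_of_zero[OF c(1) S_D(1)[OF x]] by simp
      then show False using V S_D[OF x] by (auto simp: geodesic_extension_def)
    qed
    show "deriv_at W x (W x) + G c x (W x) (W x) = 0" if "x \<in> S" for x
      unfolding W_def
      by (rule geodesic_field_imp_autoparallel[OF sv _ c(1)])
        (use V that in \<open>auto simp: geodesic_extension_def G_def S_def\<close>)
  qed
  then show ?thesis
    unfolding Wv by (simp add: W_def in_chart_pair_def G_def fundamental_tensor_def[abs_def])
qed

text \<open>The predicates under the two \<open>THE\<close>s are equivalent: \<open>F\<close> enters
  \<open>geodesic_extension\<close> only through the connection, and for a common extension both
  Ricci tensors equal the same trace.\<close>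

lemma finsler_ricci_affine_invariant:
  assumes F: "berwald A F" "berwald A F'" and eq: "affinely_equivalent A F F'"
  shows "finsler_ricci A F v = finsler_ricci A F' v"
proof -
  define Ric where "Ric F V c = ricci_tensor (\<lambda>x. fundamental_tensor A F c x (comp_in c (V (param c x))))
    (coord c (base v)) (comp_in c v) (comp_in c v)" for F V c
  have ge: "geodesic_extension A F v U V = geodesic_extension A F' v U V" for U V
    using eq by (simp add: geodesic_extension_def affinely_equivalent_def)
  have "(\<exists>U V. \<exists>c\<in>A. geodesic_extension A F v U V \<and> base v \<in> cdom c \<and> r = Ric F V c) \<longleftrightarrow>
    (\<exists>U V. \<exists>c\<in>A. geodesic_extension A F' v U V \<and> base v \<in> cdom c \<and> r = Ric F' V c)" for r
  proof (intro ex_cong1 bex_cong refl conj_cong ge)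
    fix U V c
    assume "c \<in> A" "geodesic_extension A F' v U V" "base v \<in> cdom c"
    then have "Ric F V c = Ric F' V c"
      unfolding Ric_def
      using ricci_tensor_geodesic_extension[OF F(1), of v U V c]
        ricci_tensor_geodesic_extension[OF F(2), of v U V c] ge eq
      by (simp add: affinely_equivalent_def)
    then show "(r = Ric F V c) = (r = Ric F' V c)" by simp
  qed
  then show ?thesis by (simp add: finsler_ricci_def Ric_def)
qed

end

section \<open>Linear images in Euclidean spaces\<close>

text \<open>The change of variables formula of the library is stated for \<open>real^'n\<close>. It is transferred to
  an arbitrary Euclidean space along an isometry with \<open>real^'e basis_index\<close>.\<close>

typedef (overloaded) ('e::euclidean_space) basis_index = "Basis :: 'e set"
  using nonempty_Basis by blast

instance basis_index :: (euclidean_space) finite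
proof
  have "finite (Abs_basis_index ` (Basis :: 'a set))" by simp
  moreover have "Abs_basis_index ` Basis = (UNIV :: 'a basis_index set)"
    by (rule type_definition.Abs_image[OF type_definition_basis_index])
  ultimately show "finite (UNIV :: 'a basis_index set)" by simp
qed

definition basis_enum :: "'e::euclidean_space \<Rightarrow> nat"
  where "basis_enum = (SOME f. inj_on f Basis)"

lemma inj_on_basis_enum: "inj_on basis_enum (Basis :: 'e::euclidean_space set)"
proof -
  obtain f :: "'e \<Rightarrow> nat" where "inj_on f Basis"
    using finite_imp_inj_to_nat_seg[OF finite_Basis] by blast
  then show ?thesis unfolding basis_enum_def by (rule someI[of "\<lambda>f. inj_on f Basis"])
qed

text \<open>The change of variables formula is stated for well-ordered index types. Any well-order
  will do; this one is pulled back from the naturals by an injection.\<close>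

instantiation basis_index :: (euclidean_space) wellorder
begin

definition "i \<le> j \<longleftrightarrow> basis_enum (Rep_basis_index i) \<le> basis_enum (Rep_basis_index j)"
definition "i < j \<longleftrightarrow> basis_enum (Rep_basis_index i) < basis_enum (Rep_basis_index j)"

instance
proof
  fix i j :: "'a basis_index"
  show "i = j" if "i \<le> j" "j \<le> i"
    using that inj_onD[OF inj_on_basis_enum, of "Rep_basis_index i" "Rep_basis_index j"] Rep_basis_index
    by (auto simp: less_eq_basis_index_def Rep_basis_index_inject)
next
  fix P :: "'a basis_index \<Rightarrow> bool" and i
  assume step: "\<And>i. (\<And>j. j < i \<Longrightarrow> P j) \<Longrightarrow> P i"
  show "P i"
    by (induction "basis_enum (Rep_basis_index i)" arbitrary: i rule: less_induct)
      (auto intro: step simp: less_basis_index_def)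
qed (auto simp: less_eq_basis_index_def less_basis_index_def)

end

definition to_vec :: "'e::euclidean_space \<Rightarrow> real ^ 'e basis_index"
  where "to_vec x = (\<chi> i. x \<bullet> Rep_basis_index i)"

definition of_vec :: "real ^ ('e::euclidean_space) basis_index \<Rightarrow> 'e"
  where "of_vec v = (\<Sum>i\<in>UNIV. v $ i *\<^sub>R Rep_basis_index i)"

lemma bij_betw_Rep_basis_index: "bij_betw Rep_basis_index UNIV (Basis :: 'e::euclidean_space set)"
  using type_definition.Rep_range[OF type_definition_basis_index] Rep_basis_index_inject
  by (auto simp: bij_betw_def inj_on_def)

lemma sum_basis_index: "(\<Sum>i\<in>UNIV. f (Rep_basis_index i)) = (\<Sum>b\<in>Basis. f b)"
  by (rule sum.reindex_bij_betw[OF bij_betw_Rep_basis_index])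

lemma prod_basis_index: "(\<Prod>i\<in>UNIV. f (Rep_basis_index i)) = (\<Prod>b\<in>Basis. f b)"
  by (rule prod.reindex_bij_betw[OF bij_betw_Rep_basis_index])

lemma of_vec_to_vec: "of_vec (to_vec x) = x"
  using sum_basis_index[of "\<lambda>b. (x \<bullet> b) *\<^sub>R b"]
  by (simp add: of_vec_def to_vec_def euclidean_representation)

lemma inner_Rep_basis_index:
  "Rep_basis_index i \<bullet> Rep_basis_index j = (if i = j then 1 else 0)"
  using inner_Basis[OF Rep_basis_index Rep_basis_index, of i j] by (simp add: Rep_basis_index_inject)

lemma to_vec_of_vec: "to_vec (of_vec v) = v"
  by (simp add: of_vec_def to_vec_def vec_eq_iff inner_sum_left inner_Rep_basis_index
      if_distrib[of "\<lambda>x. _ * x"] cong: if_cong)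

lemma linear_to_vec: "linear to_vec"
  by (rule linearI) (simp_all add: to_vec_def vec_eq_iff inner_add_left)

lemma linear_of_vec: "linear of_vec"
  by (rule linearI) (simp_all add: of_vec_def scaleR_add_left sum.distrib scaleR_sum_right)

lemma to_vec_image: "to_vec ` S = of_vec -` S"
proof (intro set_eqI iffI)
  fix v assume "v \<in> of_vec -` S"
  then have "to_vec (of_vec v) \<in> to_vec ` S" by blast
  then show "v \<in> to_vec ` S" by (simp add: to_vec_of_vec)
qed (auto simp: of_vec_to_vec)

lemma borel_measurable_linear:
  "linear f \<Longrightarrow> f \<in> borel_measurable borel" for f :: "'a::euclidean_space \<Rightarrow> 'b::euclidean_space"
  by (simp add: borel_measurable_continuous_onI linear_continuous_on linear_conv_bounded_linear)

text \<open>\<open>of_vec\<close> only relabels coordinates, so preimages of boxes are boxes with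
  the same side lengths, and \<open>lborel\<close> is determined by its values on boxes.\<close>

lemma distr_of_vec: "distr lborel borel (of_vec :: _ \<Rightarrow> 'e::euclidean_space) = lborel"
proof (rule lborel_eqI[symmetric])
  fix l u :: 'e assume le: "\<And>b. b \<in> Basis \<Longrightarrow> l \<bullet> b \<le> u \<bullet> b"
  have mem: "of_vec v \<bullet> b = v $ Abs_basis_index b" if "b \<in> Basis" for v and b :: 'e
    using that fun_cong[OF arg_cong[OF to_vec_of_vec[of v], of vec_nth], of "Abs_basis_index b"]
    by (simp add: to_vec_def Abs_basis_index_inverse)
  have "of_vec -` box l u = box (to_vec l) (to_vec u)"
  proof (intro set_eqI iffI)
    fix v assume "v \<in> of_vec -` box l u"
    then have "l \<bullet> Rep_basis_index i < v $ i \<and> v $ i < u \<bullet> Rep_basis_index i" for i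
      using mem[OF Rep_basis_index, of v i] Rep_basis_index[of i]
          by (auto simp: mem_box Rep_basis_index_inverse)
    then show "v \<in> box (to_vec l) (to_vec u)" by (simp add: mem_box_cart to_vec_def)
  next
    fix v assume v: "v \<in> box (to_vec l) (to_vec u)"
    have "l \<bullet> b < of_vec v \<bullet> b \<and> of_vec v \<bullet> b < u \<bullet> b" if "b \<in> Basis" for b
      using v that mem[OF that, of v] by (auto simp: mem_box_cart to_vec_def Abs_basis_index_inverse
          dest: spec[of _ "Abs_basis_index b"])
    then show "v \<in> of_vec -` box l u" by (simp add: mem_box)
  qed
  then have "emeasure (distr lborel borel of_vec) (box l u) = emeasure lborel (box (to_vec l) (to_vec u))"
    using borel_measurable_linear[OF linear_of_vec] by (subst emeasure_distr) auto
  also have "\<dots> = (\<Prod>b\<in>Basis. (to_vec u - to_vec l) \<bullet> b)"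
    by (rule emeasure_lborel_box) (auto simp: Basis_vec_def inner_axis to_vec_def le Rep_basis_index)
  also have "(\<Prod>b\<in>Basis. (to_vec u - to_vec l) \<bullet> b) = (\<Prod>i\<in>UNIV. (u - l) \<bullet> Rep_basis_index i)"
    by (rule prod.reindex_cong[of "\<lambda>i. axis i 1"])
      (auto simp: inj_on_def axis_eq_axis Basis_vec_def inner_axis to_vec_def inner_diff_left)
  also have "\<dots> = (\<Prod>b\<in>Basis. (u - l) \<bullet> b)" by (rule prod_basis_index)
  finally show "emeasure (distr lborel borel of_vec) (box l u) = ennreal (\<Prod>b\<in>Basis. (u - l) \<bullet> b)" .
qed simp

section \<open>Measures of linear and affine images, and the derivative of the determinant\<close>

lemma to_vec_image_measure:
  assumes "S \<in> sets borel"
  shows "to_vec ` S \<in> sets borel" "emeasure lborel (to_vec ` S) = emeasure lborel S"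
proof -
  have "of_vec -` S \<inter> space borel \<in> sets borel"
    by (rule measurable_sets[OF borel_measurable_linear[OF linear_of_vec] assms])
  then show "to_vec ` S \<in> sets borel" by (simp add: to_vec_image)
  have "emeasure lborel S = emeasure (distr lborel borel of_vec) S" by (simp add: distr_of_vec)
  also have "\<dots> = emeasure lborel (to_vec ` S)"
    using assms borel_measurable_linear[OF linear_of_vec]
        by (subst emeasure_distr) (auto simp: to_vec_image)
  finally show "emeasure lborel (to_vec ` S) = emeasure lborel S" by simp
qed

definition linear_det :: "('e::euclidean_space \<Rightarrow> 'e) \<Rightarrow> real"
  where "linear_det M = det (matrix (to_vec \<circ> M \<circ> of_vec))"

lemma borel_linear_image:
  fixes M :: "'e::euclidean_space \<Rightarrow> 'e"
  assumes "linear M" "inj M" "S \<in> sets borel"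
  shows "M ` S \<in> sets borel"
proof -
  obtain M' where M': "linear M'" "M' \<circ> M = id" "M \<circ> M' = id"
    using linear_injective_isomorphism[OF assms(1,2)] by (auto simp: fun_eq_iff)
  have "M ` S = M' -` S \<inter> space borel"
    using M'(2,3) by (auto simp: fun_eq_iff image_iff) metis
  then show ?thesis
    using measurable_sets[OF borel_measurable_linear[OF M'(1)] assms(3)] by simp
qed

lemma measure_linear_image_lborel:
  fixes M :: "'e::euclidean_space \<Rightarrow> 'e"
  assumes M: "linear M" "inj M" and S: "S \<in> sets borel" "emeasure lborel S < \<infinity>"
  shows "measure lborel (M ` S) = \<bar>linear_det M\<bar> * measure lborel S"
proof -
  have MS: "M ` S \<in> sets borel" by (rule borel_linear_image[OF M S(1)])
  have "to_vec ` S \<in> lmeasurable"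
    using to_vec_image_measure[OF S(1)] S(2) by (auto simp: fmeasurable_def sets_completionI_sets)
  then have "measure lebesgue ((to_vec \<circ> M \<circ> of_vec) ` (to_vec ` S)) =
      \<bar>linear_det M\<bar> * measure lebesgue (to_vec ` S)"
    unfolding linear_det_def
    by (intro measure_linear_image linear_compose[OF linear_of_vec] linear_compose[OF M(1)] linear_to_vec
        linear_compose[of "M \<circ> of_vec", OF _ linear_to_vec, unfolded o_assoc])
  also have "(to_vec \<circ> M \<circ> of_vec) ` (to_vec ` S) = to_vec ` (M ` S)"
    by (simp add: image_comp o_def of_vec_to_vec)
  finally show ?thesis
    using to_vec_image_measure[OF MS] to_vec_image_measure[OF S(1)]
    by (simp add: measure_def)
qed

lemma emeasure_affine_image_lborel:
  fixes S :: "'e::euclidean_space set"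
  assumes "r > 0" "S \<in> sets borel"
  shows "(\<lambda>w. t + r *\<^sub>R w) ` S \<in> sets borel"
    "emeasure lborel ((\<lambda>w. t + r *\<^sub>R w) ` S) = ennreal (r ^ DIM('e)) * emeasure lborel S"
proof -
  have T: "(\<lambda>w. t + r *\<^sub>R w) \<in> borel_measurable borel" "(\<lambda>w. (1 / r) *\<^sub>R (w - t)) \<in> borel_measurable borel"
    by simp_all
  have "(\<lambda>w. t + r *\<^sub>R w) ` S = (\<lambda>w. (1 / r) *\<^sub>R (w - t)) -` S \<inter> space borel"
    using assms(1) by (force simp: image_iff)
  then show sets: "(\<lambda>w. t + r *\<^sub>R w) ` S \<in> sets borel"
    using measurable_sets[OF T(2) assms(2)] by simp
  have "(\<lambda>w. t + r *\<^sub>R w) -` ((\<lambda>w. t + r *\<^sub>R w) ` S) = S"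
    using assms(1) by auto
  then have "emeasure (distr lborel borel (\<lambda>w. t + r *\<^sub>R w)) ((\<lambda>w. t + r *\<^sub>R w) ` S) = emeasure lborel S"
    using sets by (simp add: emeasure_distr)
  moreover have "emeasure lborel ((\<lambda>w. t + r *\<^sub>R w) ` S) =
      emeasure (density (distr lborel borel (\<lambda>w. t + r *\<^sub>R w)) (\<lambda>_. ennreal (\<bar>r\<bar> ^ DIM('e))))
          ((\<lambda>w. t + r *\<^sub>R w) ` S)"
    using lborel_affine[of r t] assms(1) by simp
  ultimately show "emeasure lborel ((\<lambda>w. t + r *\<^sub>R w) ` S) = ennreal (r ^ DIM('e)) * emeasure lborel S"
    using sets assms(1) by (simp add: emeasure_density_const)
qed

text \<open>In the Leibniz formula a permutation other than the identity moves at least two indices.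
  After differentiating one factor, an off-diagonal entry of the identity matrix, hence a zero, is
  left in the product; only the trace remains.\<close>

lemma has_derivative_det_mat_1:
  fixes A :: "'a::real_normed_vector \<Rightarrow> real^'n^'n"
  assumes A: "\<And>i j. ((\<lambda>x. A x $ i $ j) has_derivative (\<lambda>h. A' h $ i $ j)) (at x)" "A x = mat 1"
  shows "((\<lambda>x. det (A x)) has_derivative (\<lambda>h. \<Sum>i\<in>UNIV. A' h $ i $ i)) (at x)"
proof -
  have "((\<lambda>x. det (A x)) has_derivative (\<lambda>h. \<Sum>p\<in>{p. p permutes (UNIV :: 'n set)}. of_int (sign p) *
      (\<Sum>i\<in>UNIV. A' h $ i $ p i * (\<Prod>j\<in>UNIV - {i}. A x $ j $ p j)))) (at x)"
    unfolding det_def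
    by (intro has_derivative_sum has_derivative_mult_right has_derivative_prod A(1))
  moreover have "(\<Sum>p\<in>{p. p permutes (UNIV :: 'n set)}. of_int (sign p) *
      (\<Sum>i\<in>UNIV. A' h $ i $ p i * (\<Prod>j\<in>UNIV - {i}. A x $ j $ p j))) = (\<Sum>i\<in>UNIV. A' h $ i $ i)" for h
  proof -
    have "(\<Sum>i\<in>UNIV. A' h $ i $ p i * (\<Prod>j\<in>UNIV - {i}. A x $ j $ p j)) = 0"
      if p: "p permutes (UNIV :: 'n set)" "p \<noteq> id" for p
    proof (rule sum.neutral, rule ballI)
      fix i :: 'n
      obtain k where k: "p k \<noteq> k" using p(2) by (auto simp: fun_eq_iff)
      then have "p (p k) \<noteq> p k" using permutes_inj[OF p(1)] by (metis injD)
      then obtain j where "j \<noteq> i" "p j \<noteq> j" using k by metis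
      then have "(\<Prod>j\<in>UNIV - {i}. A x $ j $ p j) = 0"
        by (intro prod_zero bexI[of _ j]) (auto simp: A(2) mat_def)
      then show "A' h $ i $ p i * (\<Prod>j\<in>UNIV - {i}. A x $ j $ p j) = 0" by simp
    qed
    then have "(\<Sum>p\<in>{p. p permutes (UNIV :: 'n set)}. of_int (sign p) *
        (\<Sum>i\<in>UNIV. A' h $ i $ p i * (\<Prod>j\<in>UNIV - {i}. A x $ j $ p j))) =
      (\<Sum>p\<in>{id}. of_int (sign p) * (\<Sum>i\<in>UNIV. A' h $ i $ p i * (\<Prod>j\<in>UNIV - {i}. A x $ j $ p j)))"
      by (intro sum.mono_neutral_right) (auto simp: permutes_id finite_permutations)
    also have "\<dots> = (\<Sum>i\<in>UNIV. A' h $ i $ i)"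
      by (simp add: A(2) mat_def sign_id)
    finally show ?thesis .
  qed
  ultimately show ?thesis by simp
qed

lemma has_derivative_linear_det:
  fixes B :: "'e::euclidean_space \<Rightarrow> 'e \<Rightarrow> 'e"
  assumes "bilinear B"
  shows "((\<lambda>a. linear_det (\<lambda>w. w - B a w)) has_derivative (\<lambda>a. - (\<Sum>i\<in>Basis. B a i \<bullet> i))) (at 0)"
proof -
  have lin: "linear (\<lambda>a. B a w)" "linear (B a)" for a w using assms by (auto simp: bilinear_def)
  have of_axis: "of_vec (axis j 1) = Rep_basis_index j" for j :: "'e basis_index"
    by (simp add: of_vec_def axis_def if_distrib[of "\<lambda>r. r *\<^sub>R _"] cong: if_cong)
  have entry: "matrix (to_vec \<circ> (\<lambda>w. w - B a w) \<circ> of_vec) $ i $ j =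
      Rep_basis_index j \<bullet> Rep_basis_index i - B a (Rep_basis_index j) \<bullet> Rep_basis_index i"
    for a and i j :: "'e basis_index"
    by (simp add: matrix_def of_axis to_vec_def inner_diff_left)
  define A' :: "'e \<Rightarrow> real ^ 'e basis_index ^ 'e basis_index"
    where "A' h = (\<chi> i j. 0 - B h (Rep_basis_index j) \<bullet> Rep_basis_index i)" for h
  have "((\<lambda>a. det (matrix (to_vec \<circ> (\<lambda>w. w - B a w) \<circ> of_vec))) has_derivative
      (\<lambda>h. \<Sum>i\<in>UNIV. A' h $ i $ i)) (at 0)"
  proof (rule has_derivative_det_mat_1)
    show "((\<lambda>a. matrix (to_vec \<circ> (\<lambda>w. w - B a w) \<circ> of_vec) $ i $ j) has_derivative
        (\<lambda>h. A' h $ i $ j)) (at 0)" for i j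
      unfolding entry A'_def vec_lambda_beta
      by (intro has_derivative_diff has_derivative_const has_derivative_inner_left
          linear_imp_has_derivative lin)
    show "matrix (to_vec \<circ> (\<lambda>w. w - B 0 w) \<circ> of_vec) = mat 1"
      by (simp only: vec_eq_iff entry) (auto simp: linear_0[OF lin(1)] inner_Rep_basis_index mat_def)
  qed
  moreover have "(\<Sum>i\<in>UNIV. A' h $ i $ i) = - (\<Sum>i\<in>Basis. B h i \<bullet> i)" for h
    using sum_basis_index[of "\<lambda>b. B h b \<bullet> b"] by (simp add: A'_def sum_negf)
  ultimately show ?thesis by (simp add: linear_det_def)
qed

section \<open>Volume of unit balls\<close>

lemma continuous_on_deriv_at_pair:
  fixes f :: "'a::euclidean_space \<Rightarrow> real"
  assumes "smooth_on D f" "continuous_on K p" "continuous_on K u" "p ` K \<subseteq> D"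
  shows "continuous_on K (\<lambda>z. deriv_at f (p z) (u z))"
proof -
  have "continuous_on K (\<lambda>z. \<Sum>i\<in>Basis. (u z \<bullet> i) *\<^sub>R deriv_at f (p z) i)"
    by (intro continuous_intros assms(3)
        continuous_on_compose2[OF smooth_on_continuous_on[OF smooth_on_deriv_at[OF assms(1)]] assms(2,4)])
  then show ?thesis
  proof (rule continuous_on_eq)
    fix z assume "z \<in> K"
    then have "p z \<in> D" using assms(4) by blast
    from linear_expansion[OF linear_deriv_at[OF assms(1) this], symmetric]
    show "(\<Sum>i\<in>Basis. (u z \<bullet> i) *\<^sub>R deriv_at f (p z) i) = deriv_at f (p z) (u z)" .
  qed
qed

lemma ln_one_plus_minus_le:
  fixes \<eta> :: real
  assumes "0 \<le> \<eta>" "\<eta> \<le> 1 / 2"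
  shows "ln (1 + \<eta>) \<le> 2 * \<eta>" "- ln (1 - \<eta>) \<le> 2 * \<eta>"
proof -
  show "ln (1 + \<eta>) \<le> 2 * \<eta>" using ln_add_one_self_le_self[OF assms(1)] assms by linarith
  have "- ln (1 - \<eta>) = ln (inverse (1 - \<eta>))" using assms by (simp add: ln_inverse)
  also have "\<dots> \<le> inverse (1 - \<eta>) - 1" using assms by (intro ln_le_minus_one) auto
  also have "\<dots> \<le> 2 * \<eta>" using assms using mult_nonneg_nonneg[of "\<eta>" "1 - 2 * \<eta>"] by (simp add: field_simps)
  finally show "- ln (1 - \<eta>) \<le> 2 * \<eta>" .
qed

context finsler_chart
begin

definition unit_ball :: "'e \<Rightarrow> 'e set" where "unit_ball x = {w. F (x, w) < 1}"

definition ball_volume :: "'e \<Rightarrow> real" where "ball_volume x = measure lborel (unit_ball x)"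

text \<open>The extreme values of \<open>F\<close> on the compact unit sphere, which are positive by
  \<open>F_pos\<close>, are spread to all vectors by homogeneity.\<close>

lemma F_norm_bounds:
  assumes x: "x \<in> \<Omega>"
  obtains m M where "m > 0" "M > 0" "\<And>w. m * norm w \<le> F (x, w)" "\<And>w. F (x, w) \<le> M * norm w"
proof -
  have cont: "continuous_on (sphere 0 1) (\<lambda>w. F (x, w))"
    by (rule continuous_on_compose2[OF smooth_on_continuous_on[OF smooth]])
      (use x in \<open>auto intro!: continuous_intros\<close>)
  have ne: "sphere (0::'e) 1 \<noteq> {}" by simp
  obtain u where u: "u \<in> sphere 0 1" "\<forall>v\<in>sphere 0 1. F (x, u) \<le> F (x, v)"
    using continuous_attains_inf[OF compact_sphere ne cont] by blast
  obtain U where U: "U \<in> sphere 0 1" "\<forall>v\<in>sphere 0 1. F (x, v) \<le> F (x, U)"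
    using continuous_attains_sup[OF compact_sphere ne cont] by blast
  have "u \<noteq> 0" "U \<noteq> 0" using u(1) U(1) by auto
  then have pos: "F (x, u) > 0" "F (x, U) > 0"
    using F_pos[of x u] F_pos[of x U] x by auto
  have scale: "F (x, w) = norm w * F (x, w /\<^sub>R norm w)" if "w \<noteq> 0" for w
    using homogeneous[OF x, of "norm w" "w /\<^sub>R norm w"] that by simp
  have sph: "w /\<^sub>R norm w \<in> sphere 0 1" if "w \<noteq> 0" for w :: 'e using that by simp
  show ?thesis
  proof (rule that[OF pos])
    fix w
    show "F (x, u) * norm w \<le> F (x, w)"
    proof (cases "w = 0")
      case False
      show ?thesis unfolding scale[OF False] using u(2) sph[OF False]
          by (subst mult.commute) (intro mult_left_mono, auto)
    qed (simp add: F_zero[OF x])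
    show "F (x, w) \<le> F (x, U) * norm w"
    proof (cases "w = 0")
      case False
      show ?thesis unfolding scale[OF False] using U(2) sph[OF False]
          by (subst (2) mult.commute) (intro mult_left_mono, auto)
    qed (simp add: F_zero[OF x])
  qed
qed

text \<open>Off 0 this is smoothness; at 0 the linear upper bound from \<open>F_norm_bounds\<close>
  takes over.\<close>

lemma continuous_on_F_fibre:
  assumes x: "x \<in> \<Omega>"
  shows "continuous_on UNIV (\<lambda>w. F (x, w))"
proof -
  obtain m M where M: "M > 0" "\<And>w. F (x, w) \<le> M * norm w" using F_norm_bounds[OF x] by metis
  have "isCont (\<lambda>w. F (x, w)) w" for w
  proof (cases "w = 0")
    case True
    have "((\<lambda>w. F (x, w)) \<longlongrightarrow> 0) (at 0)"
    proof (rule tendsto_sandwich[OF _ _ tendsto_const])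
      show "((\<lambda>w::'e. M * norm w) \<longlongrightarrow> 0) (at 0)"
        by (rule tendsto_eq_intros | simp)+
    qed (use M nonneg[OF x] in auto)
    then show ?thesis using True F_zero[OF x] by (simp add: isCont_def)
  next
    case False
    then have "isCont F (x, w)"
      using smooth_on_continuous_on[OF smooth] open_D x by (simp add: continuous_on_eq_continuous_at)
    moreover have "isCont (\<lambda>w. (x, w)) w" by (intro continuous_intros)
    ultimately show ?thesis by (rule isCont_o2[rotated])
  qed
  then show ?thesis by (simp add: continuous_at_imp_continuous_on)
qed

lemma open_unit_ball: "x \<in> \<Omega> \<Longrightarrow> open (unit_ball x)"
  unfolding unit_ball_def by (rule open_Collect_less[OF continuous_on_F_fibre continuous_on_const])

lemma bounded_unit_ball:
  assumes x: "x \<in> \<Omega>"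
  shows "bounded (unit_ball x)"
proof -
  obtain m M where m: "m > 0" "\<And>w. m * norm w \<le> F (x, w)" using F_norm_bounds[OF x] by metis
  have "norm w \<le> 1 / m" if "w \<in> unit_ball x" for w
    using m(2)[of w] that m(1) by (simp add: unit_ball_def field_simps)
  then show ?thesis unfolding bounded_iff by blast
qed

lemma borel_unit_ball: "x \<in> \<Omega> \<Longrightarrow> unit_ball x \<in> sets borel"
  using open_unit_ball by simp

lemma emeasure_unit_ball:
  assumes x: "x \<in> \<Omega>"
  shows "emeasure lborel (unit_ball x) = ennreal (ball_volume x)"
  unfolding ball_volume_def
  using emeasure_bounded_finite[OF bounded_unit_ball[OF x]] by (intro emeasure_eq_ennreal_measure) auto

lemma ball_volume_pos:
  assumes x: "x \<in> \<Omega>"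
  shows "ball_volume x > 0"
proof -
  obtain m M where M: "M > 0" "\<And>w. F (x, w) \<le> M * norm w" using F_norm_bounds[OF x] by metis
  have "ball 0 (1 / M) \<subseteq> unit_ball x"
  proof
    fix w :: 'e assume "w \<in> ball 0 (1 / M)"
    then have "M * norm w < 1" using M(1) by (simp add: field_simps)
    then show "w \<in> unit_ball x" using M(2)[of w] by (simp add: unit_ball_def)
  qed
  then have "measure lborel (ball (0::'e) (1 / M)) \<le> ball_volume x"
    unfolding ball_volume_def
    using borel_unit_ball[OF x] emeasure_bounded_finite[OF bounded_unit_ball[OF x]]
    by (intro measure_mono_fmeasurable) (auto simp: fmeasurable_def)
  moreover have "0 < measure lborel (ball (0::'e) (1 / M))"
    by (rule content_ball_pos) (simp add: M(1))
  ultimately show ?thesis by linarith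
qed

lemma sublevel_scaled_unit_ball:
  assumes x: "x \<in> \<Omega>" and r: "r > 0"
  shows "(\<lambda>w. 0 + r *\<^sub>R w) ` unit_ball x = {w. F (x, w) < r}"
    "measure lborel {w. F (x, w) < r} = r ^ DIM('e) * ball_volume x"
    "emeasure lborel {w. F (x, w) < r} < \<infinity>"
    "{w. F (x, w) < r} \<in> sets borel"
proof -
  show eq: "(\<lambda>w. 0 + r *\<^sub>R w) ` unit_ball x = {w. F (x, w) < r}"
  proof (intro set_eqI iffI)
    fix w assume "w \<in> {w. F (x, w) < r}"
    moreover have "F (x, w /\<^sub>R r) = F (x, w) / r"
      using homogeneous[OF x, of "inverse r" w] r by (simp add: divide_inverse_commute)
    ultimately have "w = 0 + r *\<^sub>R (w /\<^sub>R r)" "w /\<^sub>R r \<in> unit_ball x"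
      using r by (simp_all add: unit_ball_def)
    then show "w \<in> (\<lambda>w. 0 + r *\<^sub>R w) ` unit_ball x" by (rule image_eqI)
  qed (use homogeneous[OF x r] r in \<open>auto simp: unit_ball_def\<close>)
  note em = emeasure_affine_image_lborel[OF r borel_unit_ball[OF x], of 0, unfolded eq
      emeasure_unit_ball[OF x]]
  show "{w. F (x, w) < r} \<in> sets borel" using em(1) .
  have "emeasure lborel {w. F (x, w) < r} = ennreal (r ^ DIM('e) * ball_volume x)"
    using em(2) r ball_volume_pos[OF x] by (simp add: ennreal_mult)
  then show "measure lborel {w. F (x, w) < r} = r ^ DIM('e) * ball_volume x"
      "emeasure lborel {w. F (x, w) < r} < \<infinity>"
    using r ball_volume_pos[OF x] by (simp_all add: measure_def)
qed

text \<open>To first order in \<open>a\<close> the linear map \<open>w \<mapsto> w - G x a w\<close> transports the indicatrix at \<open>x\<close>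
  to the one at \<open>x + a\<close>.\<close>

lemma horizontal_first_order:
  assumes G: "horizontal G" "bilinear (G x)" and x: "x \<in> \<Omega>" and e: "e > 0"
  obtains d where "d > 0" "ball x d \<subseteq> \<Omega>"
    "\<And>a w. norm a < d \<Longrightarrow> \<bar>F (x + a, w - G x a w) - F (x, w)\<bar> \<le> e * norm a * F (x, w)"
proof -
  have bb: "bounded_bilinear (G x)" using G(2) bilinear_conv_bounded_bilinear by blast
  have lin: "linear (G x a)" "linear (\<lambda>a. G x a w)" for a w using G(2) by (auto simp: bilinear_def)
  obtain m M where m: "m > 0" "\<And>w. m * norm w \<le> F (x, w)" using F_norm_bounds[OF x] by metis
  obtain r where r: "r > 0" "cball x r \<subseteq> \<Omega>" using open_base x open_contains_cball by blast
  obtain K where K: "K > 0" "\<And>a w. norm (G x a w) \<le> norm a * norm w * K"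
    using bounded_bilinear.pos_bounded[OF bb] by blast
  \<comment> \<open>For unit vectors \<open>w\<close> the bound \<open>1 / (2 * K)\<close> gives
    \<open>norm (G x a w) \<le> 1 / 2\<close>, so \<open>w - G x a w\<close> stays away from 0 and
    \<open>F\<close> is smooth there.\<close>
  define d0 where "d0 = min r (1 / (2 * K))"
  have d0: "d0 > 0" "d0 \<le> r" "d0 * K \<le> 1 / 2" using r K by (auto simp: d0_def min_def field_simps)
  define p where "p z = (x + fst z, snd z - G x (fst z) (snd z))" for z :: "'e \<times> 'e"
  define Q where "Q = cball (0::'e) d0 \<times> sphere (0::'e) 1"
  have pD: "p z \<in> D" if "z \<in> Q" for z
  proof -
    have n: "norm (fst z) \<le> d0" "norm (snd z) = 1" using that by (auto simp: Q_def)
    have "norm (G x (fst z) (snd z)) \<le> norm (fst z) * K"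
      using K(2)[of "fst z" "snd z"] n(2) by simp
    also have "\<dots> \<le> d0 * K" using n(1) K(1) by (intro mult_right_mono) auto
    finally have "norm (G x (fst z) (snd z)) \<le> d0 * K" .
    then have "snd z - G x (fst z) (snd z) \<noteq> 0" using n d0 by force
    moreover have "x + fst z \<in> \<Omega>" using n d0 r by (auto simp: dist_norm)
    ultimately show ?thesis by (simp add: p_def)
  qed
  have cp: "continuous_on Q p" unfolding p_def
    by (intro continuous_intros bounded_bilinear.continuous_on[OF bb])
  \<comment> \<open>\<open>k i (a, w)\<close> is the derivative of
    \<open>F (x + a, w - G x a w)\<close> with respect to \<open>a\<close> in direction
    \<open>i\<close>. At \<open>a = 0\<close> it is a derivative along a horizontal lift and
    vanishes; uniform continuity on the compact set \<open>Q\<close> makes it small near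
    \<open>a = 0\<close>, uniformly in \<open>w\<close>.\<close>
  define k where "k i z = deriv_at F (p z) (i, - G x i (snd z))" for i z
  have ck: "continuous_on Q (k i)" for i
    unfolding k_def
    by (intro continuous_on_deriv_at_pair[OF smooth cp] continuous_intros
        bounded_bilinear.continuous_on[OF bb])
      (use pD in blast)
  have k0: "k i (0, w) = 0" if "w \<in> sphere 0 1" for i w
  proof -
    have z: "(x, w) \<in> D" using x that by auto
    have "p (0, w) = (x, w)" by (simp add: p_def linear_0[OF lin(2)])
    then have "k i (0, w) = deriv_at F (x, w) ((i, 0) - (0, G x i w))" by (simp add: k_def)
    also have "\<dots> = deriv_at F (x, w) (i, 0) - deriv_at F (x, w) (0, G x i w)"
      by (rule linear_diff[OF linear_deriv_at[OF smooth z]])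
    also have "\<dots> = 0" using G(1) z unfolding horizontal_def by simp
    finally show ?thesis .
  qed
  \<comment> \<open>The error is shared among the basis directions, and the factor \<open>m\<close>
    later converts \<open>norm w\<close> into a bound by \<open>F (x, w)\<close>.\<close>
  define e' where "e' = e * m / DIM('e)"
  have e': "e' > 0" "DIM('e) * e' = e * m" using e m by (auto simp: e'_def)
  have "\<exists>d>0. \<forall>a w. norm a < d \<longrightarrow> (a, w) \<in> Q \<longrightarrow> \<bar>k i (a, w)\<bar> \<le> e'" for i
  proof -
    have "uniformly_continuous_on Q (k i)"
      by (intro compact_uniformly_continuous ck) (simp add: Q_def compact_Times)
    then obtain d where d: "d > 0" "\<And>z z'. z \<in> Q \<Longrightarrow> z' \<in> Q \<Longrightarrow> dist z' z < d \<Longrightarrow> dist (k i z') (k i z) < e'"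
      using e'(1) unfolding uniformly_continuous_on_def by metis
    have "\<bar>k i (a, w)\<bar> \<le> e'" if "norm a < d" "(a, w) \<in> Q" for a w
      using d(2)[of "(0, w)" "(a, w)"] that d0 k0[of w i] by (auto simp: Q_def dist_Pair_Pair dist_norm)
    with d(1) show ?thesis by blast
  qed
  then obtain \<delta> where \<delta>: "\<And>i. \<delta> i > 0" "\<And>i a w. norm a < \<delta> i \<Longrightarrow> (a, w) \<in> Q \<Longrightarrow> \<bar>k i (a, w)\<bar> \<le> e'"
    by metis
  define d where "d = min d0 (Min (\<delta> ` Basis))"
  have d: "d > 0" "d \<le> d0" "\<And>i. i \<in> Basis \<Longrightarrow> d \<le> \<delta> i"
    using d0 \<delta>(1) by (auto simp: d_def min_le_iff_disj)
  have unit: "\<bar>F (x + a, w - G x a w) - F (x, w)\<bar> \<le> e * m * norm a" if a: "norm a < d" and w: "norm w = 1"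
      for a w
  proof -
    have "norm (F (p (a, w)) - F (p (0, w))) \<le> (DIM('e) * e') * norm (a - 0)"
    proof (rule differentiable_bound[of "ball 0 d" "\<lambda>a. F (p (a, w))"])
      fix b :: 'e assume b: "b \<in> ball 0 d"
      then have Q: "(b, w) \<in> Q" using d(2) w by (auto simp: Q_def)
      have "((\<lambda>b. p (b, w)) has_derivative (\<lambda>h. (h, - G x h w))) (at b)"
        unfolding p_def fst_conv snd_conv
        by (auto intro!: derivative_eq_intros linear_imp_has_derivative lin)
      from has_derivative_compose[OF this smooth_on_has_derivative[OF smooth pD[OF Q]]]
      have D: "((\<lambda>b. F (p (b, w))) has_derivative (\<lambda>h. deriv_at F (p (b, w)) (h, - G x h w))) (at b)" .
      then show "((\<lambda>b. F (p (b, w))) has_derivative (\<lambda>h. deriv_at F (p (b, w)) (h, - G x h w)))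
          (at b within ball 0 d)"
        by (rule has_derivative_at_withinI)
      show "onorm (\<lambda>h. deriv_at F (p (b, w)) (h, - G x h w)) \<le> DIM('e) * e'"
      proof (rule onorm_le)
        fix h
        have "\<bar>deriv_at F (p (b, w)) (h, - G x h w)\<bar> = \<bar>\<Sum>i\<in>Basis. (h \<bullet> i) *\<^sub>R k i (b, w)\<bar>"
          using linear_expansion[OF has_derivative_linear[OF D], of h] by (simp add: k_def)
        also have "\<dots> \<le> (\<Sum>i\<in>(Basis::'e set). norm h * e')"
        proof (intro order_trans[OF sum_abs] sum_mono)
          fix i :: 'e assume i: "i \<in> Basis"
          have "\<bar>k i (b, w)\<bar> \<le> e'" using \<delta>(2)[OF _ Q, of i] b d(3)[OF i] by simp
          then show "\<bar>(h \<bullet> i) *\<^sub>R k i (b, w)\<bar> \<le> norm h * e'"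
            using Basis_le_norm[OF i, of h] by (simp add: abs_mult mult_mono)
        qed
        also have "\<dots> = DIM('e) * e' * norm h" by simp
        finally show "norm (deriv_at F (p (b, w)) (h, - G x h w)) \<le> DIM('e) * e' * norm h" by simp
      qed
    qed (use a d in auto)
    then show ?thesis by (simp add: p_def linear_0[OF lin(2)] e'(2))
  qed
  show ?thesis
  proof (rule that[OF d(1)])
    show "ball x d \<subseteq> \<Omega>" using d(2) d0(2) r(2) by (auto simp: subset_iff)
    fix a w :: 'e assume a: "norm a < d"
    then have xa: "x + a \<in> \<Omega>" using d(2) d0(2) r(2) by (auto simp: dist_norm subset_iff)
    show "\<bar>F (x + a, w - G x a w) - F (x, w)\<bar> \<le> e * norm a * F (x, w)"
    proof (cases "w = 0")
      case True
      then show ?thesis using F_zero[OF x] F_zero[OF xa] linear_0[OF lin(1)] by simp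
    next
      case False
      define u where "u = w /\<^sub>R norm w"
      have u: "norm u = 1" "w = norm w *\<^sub>R u" using False by (auto simp: u_def)
      have "w - G x a w = norm w *\<^sub>R (u - G x a u)"
        by (subst (1 2) u(2)) (simp add: linear_scale[OF lin(1)] scaleR_diff_right)
      then have "F (x + a, w - G x a w) = norm w * F (x + a, u - G x a u)"
        using homogeneous[OF xa, of "norm w"] False by simp
      moreover have "F (x, w) = norm w * F (x, u)"
        using homogeneous[OF x, of "norm w" u] u(2) False by simp
      ultimately have "\<bar>F (x + a, w - G x a w) - F (x, w)\<bar> = norm w * \<bar>F (x + a, u - G x a u) - F (x, u)\<bar>"
        by (simp add: abs_mult flip: right_diff_distrib)
      also have "\<dots> \<le> norm w * (e * m * norm a)" using unit[OF a u(1)] by (intro mult_left_mono) auto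
      also have "\<dots> = e * norm a * (m * norm w)" by simp
      also have "\<dots> \<le> e * norm a * F (x, w)" using m(2) e by (intro mult_left_mono) auto
      finally show ?thesis .
    qed
  qed
qed

text \<open>The image of the unit ball at \<open>x\<close> under \<open>w - G x a w\<close> has
  \<open>J a\<close> times its volume when \<open>J a > 0\<close>, and lies between the balls of
  radius \<open>1 - \<eta>\<close> and \<open>1 + \<eta>\<close> at \<open>x + a\<close>, where
  \<open>\<eta>\<close> is of smaller order than \<open>a\<close>. So to first order the logarithmic
  volume changes by \<open>ln (J a)\<close>, and the derivative of a determinant at the identity is
  the trace.\<close>

lemma ln_ball_volume_has_derivative:
  assumes G: "horizontal G" "bilinear (G x)" and x: "x \<in> \<Omega>"
  shows "((\<lambda>x. ln (ball_volume x)) has_derivative (\<lambda>a. - (\<Sum>i\<in>Basis. G x a i \<bullet> i))) (at x)"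
proof -
  define J where "J a = linear_det (\<lambda>w. w - G x a w)" for a
  define tr where "tr a = (\<Sum>i\<in>Basis. G x a i \<bullet> i)" for a
  have lin: "linear (G x a)" "linear (\<lambda>a. G x a w)" for a w using G(2) by (auto simp: bilinear_def)
  have bb: "bounded_bilinear (G x)" using G(2) bilinear_conv_bounded_bilinear by blast
  obtain K where K: "K > 0" "\<And>a w. norm (G x a w) \<le> norm a * norm w * K"
    using bounded_bilinear.pos_bounded[OF bb] by blast
  have DJ: "(J has_derivative (\<lambda>a. - tr a)) (at 0)"
    unfolding J_def tr_def by (rule has_derivative_linear_det[OF G(2)])
  have "linear_det (\<lambda>w::'e. w) = 1"
  proof -
    have "to_vec \<circ> (\<lambda>w::'e. w) \<circ> of_vec = id" by (auto simp: to_vec_of_vec)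
    then show ?thesis by (simp add: linear_det_def matrix_id)
  qed
  then have J0: "J 0 = 1" by (simp add: J_def linear_0[OF lin(2)])
  have "isCont J 0" using has_derivative_continuous[OF DJ] .
  then have "(J \<longlongrightarrow> 1) (at 0)" using J0 by (simp add: isCont_def)
  then have "\<forall>\<^sub>F a in at 0. J a > 0" by (rule order_tendstoD) simp
  then obtain d1 where d1: "d1 > 0" "\<And>a. norm a < d1 \<Longrightarrow> J a > 0"
    using J0 by (auto simp: eventually_at dist_norm) (metis zero_less_one)
  have inj: "inj (\<lambda>w. w - G x a w)" if a: "norm a < 1 / K" for a
  proof (rule linear_injective_0[THEN iffD2, rule_format])
    show "linear (\<lambda>w. w - G x a w)" by (intro linear_compose_sub linear_ident lin)
    fix w assume "w - G x a w = 0"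
    then have "norm w \<le> norm a * K * norm w" using K(2)[of a w] by (simp add: mult_ac)
    moreover have "norm a * K < 1" using a K(1) by (simp add: field_simps)
    ultimately show "w = 0"
      using mult_strict_right_mono[of "norm a * K" 1 "norm w"] by (cases "w = 0") auto
  qed
  define V where "V = ball_volume x"
  have V: "V > 0" using ball_volume_pos[OF x] by (simp add: V_def)
  \<comment> \<open>The change of the logarithmic volume that the determinant does not account for;
    the inclusions \<open>sub1\<close> and \<open>sub2\<close> show that it is of smaller order than
    \<open>a\<close>.\<close>
  define R where "R a = ln (ball_volume (x + a)) - ln V - ln (J a)" for a
  have "(R has_derivative (\<lambda>a. 0)) (at 0)"
    unfolding has_derivative_at_alt
  proof (intro conjI allI impI)
    fix e :: real assume e: "e > 0"
    \<comment> \<open>The dimension enters because volumes scale with power \<open>DIM('e)\<close>,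
      the factor 2 through \<open>ln_one_plus_minus_le\<close>.\<close>
    define e' where "e' = e / (2 * DIM('e))"
    have e': "e' > 0" "2 * DIM('e) * e' = e" using e by (auto simp: e'_def)
    obtain d2 where d2: "d2 > 0" "ball x d2 \<subseteq> \<Omega>"
      "\<And>a w. norm a < d2 \<Longrightarrow> \<bar>F (x + a, w - G x a w) - F (x, w)\<bar> \<le> e' * norm a * F (x, w)"
      using horizontal_first_order[where e = e', OF G x e'(1)] by blast
    \<comment> \<open>The four bounds ensure, in this order, a positive determinant, the first-order
      estimate, injectivity of \<open>M\<close>, and \<open>\<eta> \<le> 1 / 2\<close>.\<close>
    define d where "d = min (min d1 d2) (min (1 / K) (1 / (2 * e')))"
    have d: "d > 0" "d \<le> d1" "d \<le> d2" "d \<le> 1 / K" "d \<le> 1 / (2 * e')"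
      using d1 d2 K e' by (auto simp: d_def)
    show "\<exists>d>0. \<forall>y. norm (y - 0) < d \<longrightarrow> norm (R y - R 0 - 0) \<le> e * norm (y - 0)"
    proof (intro exI[of _ d] conjI d(1) allI impI)
      fix a :: 'e assume "norm (a - 0) < d"
      then have a: "norm a < d" by simp
      define \<eta> where "\<eta> = e' * norm a"
      have \<eta>: "0 \<le> \<eta>" "\<eta> \<le> 1 / 2"
      proof -
        show "0 \<le> \<eta>" using e' by (simp add: \<eta>_def)
        have "e' * norm a \<le> e' * (1 / (2 * e'))" using a d(5) e' by (intro mult_left_mono) auto
        then show "\<eta> \<le> 1 / 2" using e' by (simp add: \<eta>_def)
      qed
      have xa: "x + a \<in> \<Omega>" using a d(3) d2(2) by (auto simp: dist_norm subset_iff)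
      have Ja: "J a > 0" using a d(2) d1(2) by simp
      define M where "M w = w - G x a w" for w
      have M: "linear M" "inj M" unfolding M_def
        using inj[of a] a d(4) by (auto intro: linear_compose_sub linear_ident lin)
      have FM: "\<bar>F (x + a, M w) - F (x, w)\<bar> \<le> \<eta> * F (x, w)" for w
        using d2(3)[of a w] a d(3) by (simp add: M_def \<eta>_def)
      have Mvol: "measure lborel (M ` unit_ball x) = J a * V"
        using measure_linear_image_lborel[OF M borel_unit_ball[OF x]] emeasure_unit_ball[OF x] Ja
        by (simp add: J_def M_def[abs_def] V_def ball_volume_def)
      have Mborel: "M ` unit_ball x \<in> sets borel" by (rule borel_linear_image[OF M borel_unit_ball[OF x]])
      define V' where "V' = ball_volume (x + a)"
      have V': "V' > 0" using ball_volume_pos[OF xa] by (simp add: V'_def)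
      have sub1: "M ` unit_ball x \<subseteq> {w. F (x + a, w) < 1 + \<eta>}"
      proof clarify
        fix w assume w: "w \<in> unit_ball x"
        have "F (x + a, M w) \<le> (1 + \<eta>) * F (x, w)" using FM[of w] by (simp add: algebra_simps)
        also have "\<dots> < (1 + \<eta>) * 1" using w \<eta> by (intro mult_strict_left_mono) (auto simp: unit_ball_def)
        finally show "F (x + a, M w) < 1 + \<eta>" by simp
      qed
      have sub2: "{w. F (x + a, w) < 1 - \<eta>} \<subseteq> M ` unit_ball x"
      proof clarify
        fix u assume u: "F (x + a, u) < 1 - \<eta>"
        obtain w where w: "u = M w" using linear_injective_imp_surjective[OF M] by (metis surjD)
        have "(1 - \<eta>) * F (x, w) \<le> F (x + a, M w)" using FM[of w] by (simp add: algebra_simps)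
        then have "(1 - \<eta>) * F (x, w) < (1 - \<eta>) * 1" using u w by simp
        then have "w \<in> unit_ball x" using \<eta> by (simp add: unit_ball_def)
        then show "u \<in> M ` unit_ball x" using w by simp
      qed
      have r: "1 + \<eta> > 0" "1 - \<eta> > 0" using \<eta> by auto
      have fin: "emeasure lborel (M ` unit_ball x) < \<infinity>"
        using emeasure_mono[OF sub1, of lborel] sublevel_scaled_unit_ball(3,4)[OF xa r(1)]
            by (auto intro: le_less_trans)
      have "J a * V \<le> (1 + \<eta>) ^ DIM('e) * V'"
        using measure_mono_fmeasurable[OF sub1, of lborel] Mborel sublevel_scaled_unit_ball[OF xa r(1)]
        by (auto simp: Mvol V'_def fmeasurable_def)
      then have "ln (J a * V) \<le> ln ((1 + \<eta>) ^ DIM('e) * V')" using Ja V V' r by simp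
      then have 1: "ln (J a) + ln V \<le> DIM('e) * ln (1 + \<eta>) + ln V'"
        using Ja V V' r by (simp add: ln_mult ln_realpow)
      have "(1 - \<eta>) ^ DIM('e) * V' \<le> J a * V"
        using measure_mono_fmeasurable[OF sub2, of lborel] Mborel fin sublevel_scaled_unit_ball[OF xa r(2)]
        by (auto simp: Mvol V'_def fmeasurable_def)
      then have "ln ((1 - \<eta>) ^ DIM('e) * V') \<le> ln (J a * V)" using Ja V V' r by simp
      then have 2: "DIM('e) * ln (1 - \<eta>) + ln V' \<le> ln (J a) + ln V"
        using Ja V V' r by (simp add: ln_mult ln_realpow)
      have "DIM('e) * ln (1 + \<eta>) \<le> DIM('e) * (2 * \<eta>)" "DIM('e) * (- ln (1 - \<eta>)) \<le> DIM('e) * (2 * \<eta>)"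
        by (intro mult_left_mono ln_one_plus_minus_le[OF \<eta>]; simp)+
      then have "\<bar>R a\<bar> \<le> DIM('e) * (2 * \<eta>)" using 1 2 unfolding R_def V'_def by linarith
      also have "\<dots> = e * norm a" using e'(2) by (simp add: \<eta>_def mult_ac)
      finally show "norm (R a - R 0 - 0) \<le> e * norm (a - 0)" by (simp add: R_def J0 V_def)
    qed
  qed simp
  moreover have "((\<lambda>a. ln (J a)) has_derivative (\<lambda>a. - tr a)) (at 0)"
    using has_derivative_ln[OF _ DJ] J0 by simp
  ultimately have "((\<lambda>a. R a + ln V + ln (J a)) has_derivative (\<lambda>a. 0 + 0 + - tr a)) (at 0)"
    by (intro has_derivative_add has_derivative_const)
  then have *: "((\<lambda>a. ln (ball_volume (x + a))) has_derivative (\<lambda>a. - tr a)) (at (x - x))"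
    by (simp add: R_def)
  have "((\<lambda>y. y - x) has_derivative (\<lambda>a. a)) (at x)"
    by (auto intro!: derivative_eq_intros)
  from has_derivative_compose[OF this *] show ?thesis by (simp add: tr_def)
qed

text \<open>The derivative just computed is the negative trace of the smooth symbols
  \<open>G\<close>, so a single derivative formula yields smoothness of every order.\<close>

lemma smooth_on_ln_ball_volume:
  assumes G: "horizontal G" "\<And>x. x \<in> \<Omega> \<Longrightarrow> bilinear (G x)" "\<And>a b. smooth_on \<Omega> (\<lambda>x. G x a b)"
  shows "smooth_on \<Omega> (\<lambda>x. ln (ball_volume x))"
  by (rule smooth_onI[OF open_base ln_ball_volume_has_derivative[OF G(1,2)]])
    (auto intro!: smooth_on_minus smooth_on_sum open_base G
      smooth_on_bounded_linear_compose[OF open_base bounded_linear_inner_left])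

end

section \<open>Densities and the weight function\<close>

context manifold
begin

lemma param_image_open:
  assumes c: "c \<in> A" and E: "open E" "E \<subseteq> crange c"
  shows "open (param c ` E)" "param c ` E \<subseteq> cdom c" "coord c ` param c ` E = E"
proof -
  have "param c ` E = cdom c \<inter> coord c -` E"
  proof (intro set_eqI iffI)
    fix p assume "p \<in> cdom c \<inter> coord c -` E"
    then have "p = param c (coord c p)" "coord c p \<in> E" using param_coord[OF c] by auto
    then show "p \<in> param c ` E" by (rule image_eqI)
  qed (use E param_in_cdom[OF c] coord_param[OF c] in auto)
  then show "open (param c ` E)"
    using continuous_open_preimage[OF continuous_on_coord[OF c] open_cdom[OF c] E(1)] by simp
  show "param c ` E \<subseteq> cdom c" using E(2) param_in_cdom[OF c] by blast
  show "coord c ` param c ` E = E" using E(2) coord_param[OF c] by (force simp: image_image)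
qed

lemma smooth_densityD:
  assumes "smooth_density \<mu> c \<rho>"
  shows "smooth_on (crange c) \<rho>" "\<And>x. x \<in> crange c \<Longrightarrow> 0 < \<rho> x"
    "\<And>B. B \<in> sets borel \<Longrightarrow> B \<subseteq> cdom c \<Longrightarrow>
      emeasure \<mu> B = (\<integral>\<^sup>+x. ennreal (\<rho> x) * indicator (coord c ` B) x \<partial>lborel)"
  using assms by (auto simp: smooth_density_def)

section \<open>Comparison of densities in overlapping charts\<close>

abbreviation chart_volume :: "(('m, 'e) tangent \<Rightarrow> real) \<Rightarrow> ('m, 'e) chart \<Rightarrow> 'e \<Rightarrow> real"
  where "chart_volume F c \<equiv> finsler_chart.ball_volume (in_chart_pair A F c)"

lemma in_chart_pair_transition:
  assumes "c \<in> A" "c' \<in> A" "x \<in> overlap c c'"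
  shows "in_chart_pair A F c' (transition c c' x, deriv_at (transition c c') x w) =
      in_chart_pair A F c (x, w)"
  using tangent_of_transition[OF assms] by (simp add: in_chart_pair_def in_chart_def)

text \<open>The differential of the coordinate change preserves \<open>F\<close>, and the remainder
  is small compared with \<open>r\<close>. Hence the rescaled displacement \<open>u\<close> is close
  to the image of \<open>w\<close> and has \<open>F\<close> at most slightly above 1.\<close>

lemma transition_small_ball:
  assumes F: "finsler A F" and c: "c \<in> A" "c' \<in> A" and x: "x \<in> overlap c c'" and e: "e > 0"
  shows "\<exists>r0>0. \<forall>r w. 0 < r \<longrightarrow> r < r0 \<longrightarrow> in_chart_pair A F c (x, w) < 1 \<longrightarrow>
    x + r *\<^sub>R w \<in> overlap c c' \<and>
    (\<exists>u. transition c c' (x + r *\<^sub>R w) = transition c c' x + r *\<^sub>R u \<and>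
      in_chart_pair A F c' (transition c c' x, u) < 1 + e)"
proof -
  interpret fc: finsler_chart "crange c" "in_chart_pair A F c"
    by (rule finsler_chartI[OF F c(1)])
  interpret fc': finsler_chart "crange c'" "in_chart_pair A F c'"
    by (rule finsler_chartI[OF F c(2)])
  define T where "T = transition c c'"
  note xx = overlapD[OF c x]
  have DT: "(T has_derivative deriv_at T x) (at x)"
    unfolding T_def by (rule smooth_on_has_derivative[OF smooth_on_transition[OF c] x])
  obtain B where B: "B > 0" "\<And>w. w \<in> fc.unit_ball x \<Longrightarrow> norm w \<le> B"
    using fc.bounded_unit_ball[OF xx(1)] bounded_pos by blast
  obtain L where L: "L > 0" "\<And>w. norm (deriv_at T x w) \<le> norm w * L"
    using bounded_linear.pos_bounded[OF has_derivative_bounded_linear[OF DT]] by blast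
  define Q where "Q = cball (0::'e) (B * L + 1)"
  have "uniformly_continuous_on Q (\<lambda>u. in_chart_pair A F c' (T x, u))"
    using fc'.continuous_on_F_fibre[OF xx(4)] continuous_on_subset
    by (intro compact_uniformly_continuous) (auto simp: Q_def T_def)
  then obtain k where k: "k > 0" "\<And>u v. u \<in> Q \<Longrightarrow> v \<in> Q \<Longrightarrow> dist v u < k \<Longrightarrow>
      dist (in_chart_pair A F c' (T x, v)) (in_chart_pair A F c' (T x, u)) < e"
    using e unfolding uniformly_continuous_on_def by metis
  \<comment> \<open>The accuracy demanded of the linear approximation: \<open>h * B \<le> 1\<close>
    keeps \<open>u\<close> in \<open>Q\<close>, and \<open>h * B < k\<close> lets the uniform
    continuity apply.\<close>
  define h where "h = min 1 (k / 2) / B"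
  have h: "h > 0" "h * B \<le> 1" "h * B < k" using k B(1) by (auto simp: h_def)
  obtain d1 where d1: "d1 > 0" "\<And>y. norm (y - x) < d1 \<Longrightarrow> norm (T y - T x - deriv_at T x (y - x)) \<le>
      h * norm (y - x)"
    using DT h(1) unfolding has_derivative_at_alt by metis
  obtain d2 where d2: "d2 > 0" "ball x d2 \<subseteq> overlap c c'"
    using open_overlap[OF c] x open_contains_ball by blast
  show ?thesis
  proof (intro exI[of _ "min d1 d2 / B"] conjI allI impI)
    show "0 < min d1 d2 / B" using d1 d2 B by simp
    fix r w assume r: "0 < r" "r < min d1 d2 / B" and w: "in_chart_pair A F c (x, w) < 1"
    have wB: "norm w \<le> B" using w B(2) by (simp add: fc.unit_ball_def)
    have "r * norm w \<le> r * B" using r wB by simp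
    also have "\<dots> < min d1 d2" using r(2) B(1) by (simp add: pos_less_divide_eq)
    finally have rw: "norm (r *\<^sub>R w) < min d1 d2" using r by simp
    then show "x + r *\<^sub>R w \<in> overlap c c'" using d2(2) by (auto simp: dist_norm subset_iff)
    define u where "u = (T (x + r *\<^sub>R w) - T x) /\<^sub>R r"
    have Tu: "T (x + r *\<^sub>R w) = T x + r *\<^sub>R u" using r by (simp add: u_def)
    have "norm (T (x + r *\<^sub>R w) - T x - deriv_at T x (r *\<^sub>R w)) \<le> h * norm (r *\<^sub>R w)"
      using d1(2)[of "x + r *\<^sub>R w"] rw by simp
    moreover have "T (x + r *\<^sub>R w) - T x - deriv_at T x (r *\<^sub>R w) = r *\<^sub>R (u - deriv_at T x w)"
      by (simp add: Tu linear_scale[OF has_derivative_linear[OF DT]] scaleR_diff_right)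
    ultimately have "r * norm (u - deriv_at T x w) \<le> r * (h * norm w)" using r by simp
    then have "norm (u - deriv_at T x w) \<le> h * norm w" using r by simp
    also have "\<dots> \<le> h * B" using wB h by (intro mult_left_mono) auto
    finally have du: "norm (u - deriv_at T x w) \<le> h * B" .
    have "norm w * L \<le> B * L" using wB L(1) by (intro mult_right_mono) auto
    then have Dw: "norm (deriv_at T x w) \<le> B * L" using L(2)[of w] by linarith
    have "norm u \<le> norm (deriv_at T x w) + norm (u - deriv_at T x w)"
      using norm_triangle_ineq[of "deriv_at T x w" "u - deriv_at T x w"] by simp
    then have "u \<in> Q" "deriv_at T x w \<in> Q" using Dw du h(2) by (auto simp: Q_def)
    moreover have "dist u (deriv_at T x w) < k" using du h(3) by (simp add: dist_norm)
    ultimately have "dist (in_chart_pair A F c' (T x, u)) (in_chart_pair A F c' (T x, deriv_at T x w)) < e"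
      using k(2) by blast
    moreover have "in_chart_pair A F c' (T x, deriv_at T x w) < 1"
      using in_chart_pair_transition[OF c x] w by (simp add: T_def)
    ultimately have "in_chart_pair A F c' (T x, u) < 1 + e" by (simp add: dist_real_def)
    then show "\<exists>u. transition c c' (x + r *\<^sub>R w) = transition c c' x + r *\<^sub>R u \<and>
        in_chart_pair A F c' (transition c c' x, u) < 1 + e"
      using Tu unfolding T_def by blast
  qed
qed

text \<open>Compares the \<open>\<mu>\<close>-measures of the small balls \<open>x + r B\<close> in the two charts as \<open>r \<rightarrow> 0\<close>; this replaces
  the transformation formula for integrals.\<close>

lemma density_volume_le:
  assumes F: "finsler A F" and c: "c \<in> A" "c' \<in> A" and x: "x \<in> overlap c c'"
    and \<rho>: "smooth_density \<mu> c \<rho>" and \<rho>': "smooth_density \<mu> c' \<rho>'"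
  shows "\<rho> x * chart_volume F c x \<le> \<rho>' (transition c c' x) * chart_volume F c' (transition c c' x)"
proof -
  interpret fc: finsler_chart "crange c" "in_chart_pair A F c"
    by (rule finsler_chartI[OF F c(1)])
  interpret fc': finsler_chart "crange c'" "in_chart_pair A F c'"
    by (rule finsler_chartI[OF F c(2)])
  define T where "T = transition c c'"
  define V V' where "V = fc.ball_volume x" and "V' = fc'.ball_volume (T x)"
  note xx = overlapD[OF c x]
  have V: "V > 0" "V' > 0" using fc.ball_volume_pos[OF xx(1)] fc'.ball_volume_pos[OF xx(4)]
    by (simp_all add: V_def V'_def T_def)
  have rpos: "\<rho> x > 0" "\<rho>' (T x) > 0"
    using smooth_densityD(2)[OF \<rho> xx(1)] smooth_densityD(2)[OF \<rho>' xx(4)] by (simp_all add: T_def)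
  \<comment> \<open>On the small ball \<open>\<rho>\<close> is at least \<open>\<rho> x - e\<close>,
    on its image \<open>\<rho>'\<close> is at most \<open>\<rho>' (T x) + e\<close>, and both
    integrals equal the same value of \<open>\<mu>\<close>. The common factor
    \<open>r ^ DIM('e)\<close> cancels, after which only \<open>e\<close> has to tend to 0.\<close>
  have main: "(\<rho> x - e) * V \<le> (\<rho>' (T x) + e) * ((1 + e) ^ DIM('e) * V')" if e: "e > 0" "e < \<rho> x" for e
  proof -
    have "isCont \<rho> x" "isCont \<rho>' (T x)"
      using smooth_on_continuous_on[OF smooth_densityD(1)[OF \<rho>]]
          smooth_on_continuous_on[OF smooth_densityD(1)[OF \<rho>']]
        open_crange c xx by (auto simp: continuous_on_eq_continuous_at T_def)
    then obtain d d' where d: "d > 0" "\<And>y. dist y x < d \<Longrightarrow> dist (\<rho> y) (\<rho> x) < e"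
      and d': "d' > 0" "\<And>y. dist y (T x) < d' \<Longrightarrow> dist (\<rho>' y) (\<rho>' (T x)) < e"
      using e(1) unfolding continuous_at_eps_delta by (metis dist_real_def)
    have "isCont T x"
      unfolding T_def using has_derivative_continuous[OF
          smooth_on_has_derivative[OF smooth_on_transition[OF c] x]] .
    then obtain d'' where d'': "d'' > 0" "\<And>y. dist y x < d'' \<Longrightarrow> dist (T y) (T x) < d'"
      using d'(1) unfolding continuous_at_eps_delta by metis
    obtain B where B: "B > 0" "\<And>w. w \<in> fc.unit_ball x \<Longrightarrow> norm w \<le> B"
      using fc.bounded_unit_ball[OF xx(1)] bounded_pos by blast
    obtain r0 where r0: "r0 > 0" "\<And>r w. 0 < r \<Longrightarrow> r < r0 \<Longrightarrow> in_chart_pair A F c (x, w) < 1 \<Longrightarrow>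
      x + r *\<^sub>R w \<in> overlap c c' \<and> (\<exists>u. T (x + r *\<^sub>R w) = T x + r *\<^sub>R u \<and> in_chart_pair A F c' (T x, u) < 1 +
          e)"
      using transition_small_ball[OF F c x e(1)] unfolding T_def by blast
    \<comment> \<open>Small enough for \<open>transition_small_ball\<close> and for both densities
      to vary by less than \<open>e\<close>.\<close>
    define r where "r = min (r0 / 2) (min d d'' / (2 * B))"
    have r: "r > 0" "r < r0" "r * B < d" "r * B < d''"
    proof -
      show "r > 0" "r < r0" using r0 d d'' B by (auto simp: r_def)
      have "r * B \<le> min d d'' / (2 * B) * B" using B by (intro mult_right_mono) (auto simp: r_def)
      also have "\<dots> = min d d'' / 2" using B by simp
      finally show "r * B < d" "r * B < d''" using d d'' by (auto simp: min_def split: if_splits)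
    qed
    \<comment> \<open>\<open>E\<close> is the ball of radius \<open>r\<close> about
      \<open>x\<close>, measured by \<open>F\<close> in the fibre at \<open>x\<close>;
      \<open>E'\<close> is the slightly larger ball about \<open>T x\<close> that contains the image
      of \<open>E\<close>.\<close>
    define E where "E = (\<lambda>w. x + r *\<^sub>R w) ` fc.unit_ball x"
    define E' where "E' = (\<lambda>w. T x + r *\<^sub>R w) ` {u. in_chart_pair A F c' (T x, u) < 1 + e}"
    have Eov: "E \<subseteq> overlap c c'" using r0(2)[OF r(1,2)] by (auto simp: E_def fc.unit_ball_def)
    have En: "dist y x < d" "dist y x < d''" if y: "y \<in> E" for y
    proof -
      obtain w where w: "w \<in> fc.unit_ball x" "y = x + r *\<^sub>R w" using y by (auto simp: E_def)
      have "dist y x \<le> r * B" using B(2)[OF w(1)] w(2) r(1) by (simp add: dist_norm)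
      then show "dist y x < d" "dist y x < d''" using r by linarith+
    qed
    have TE: "T ` E \<subseteq> E'"
    proof (clarsimp simp: E_def fc.unit_ball_def)
      fix w assume "in_chart_pair A F c (x, w) < 1"
      then obtain u where "T (x + r *\<^sub>R w) = T x + r *\<^sub>R u" "in_chart_pair A F c' (T x, u) < 1 + e"
        using r0(2)[OF r(1,2)] by blast
      then show "T (x + r *\<^sub>R w) \<in> E'" by (auto simp: E'_def)
    qed
    have "open E"
    proof -
      have "E = (+) x ` ((*\<^sub>R) r ` fc.unit_ball x)" by (simp add: E_def image_image)
      then show ?thesis using fc.open_unit_ball[OF xx(1)] r(1)
        by (simp add: open_translation open_scaling)
    qed
    have Ecr: "E \<subseteq> crange c" using Eov by (auto simp: overlap_def)
    note pE = param_image_open[OF c(1) \<open>open E\<close> Ecr]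
    have pE': "param c ` E \<subseteq> cdom c'" using Eov by (auto simp: overlap_def)
    have cE': "coord c' ` param c ` E = T ` E" by (auto simp: T_def transition_def image_image)
    have bE: "param c ` E \<in> sets borel" using pE(1) by simp
    have eE: "emeasure lborel E = ennreal (r ^ DIM('e)) * ennreal V"
      unfolding E_def V_def
      using emeasure_affine_image_lborel(2)[OF r(1) fc.borel_unit_ball[OF xx(1)]]
      by (simp add: fc.emeasure_unit_ball[OF xx(1)])
    have e1: "1 + e > 0" using e by simp
    have xx4: "T x \<in> crange c'" using xx(4) by (simp add: T_def)
    have eE': "E' \<in> sets borel" "emeasure lborel E' =
        ennreal (r ^ DIM('e)) * ennreal ((1 + e) ^ DIM('e) * V')"
      unfolding E'_def V'_def
      using emeasure_affine_image_lborel[OF r(1) fc'.sublevel_scaled_unit_ball(4)[OF xx4 e1], of "T x"]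
        fc'.sublevel_scaled_unit_ball(2,3)[OF xx4 e1]
      by (auto simp: emeasure_eq_ennreal_measure less_top)
    have "ennreal (\<rho> x - e) * emeasure lborel E = (\<integral>\<^sup>+y. ennreal (\<rho> x - e) * indicator E y \<partial>lborel)"
      using \<open>open E\<close> by (subst nn_integral_cmult_indicator) auto
    also have "\<dots> \<le> (\<integral>\<^sup>+y. ennreal (\<rho> y) * indicator (coord c ` param c ` E) y \<partial>lborel)"
      unfolding pE(3)
    proof (rule nn_integral_mono)
      fix y show "ennreal (\<rho> x - e) * indicator E y \<le> ennreal (\<rho> y) * indicator E y"
        using d(2)[OF En(1), of y] by (auto simp: dist_real_def indicator_def intro!: ennreal_leI)
    qed
    also have "\<dots> = emeasure \<mu> (param c ` E)"
      by (rule smooth_densityD(3)[OF \<rho> bE pE(2), symmetric])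
    also have "\<dots> = (\<integral>\<^sup>+y. ennreal (\<rho>' y) * indicator (T ` E) y \<partial>lborel)"
      using smooth_densityD(3)[OF \<rho>' bE pE'] by (simp only: cE')
    also have "\<dots> \<le> (\<integral>\<^sup>+y. ennreal (\<rho>' (T x) + e) * indicator E' y \<partial>lborel)"
    proof (rule nn_integral_mono)
      fix y
      show "ennreal (\<rho>' y) * indicator (T ` E) y \<le> ennreal (\<rho>' (T x) + e) * indicator E' y"
      proof (cases "y \<in> T ` E")
        case True
        then obtain z where z: "z \<in> E" "y = T z" by blast
        then have "\<rho>' y \<le> \<rho>' (T x) + e" using d'(2)[OF d''(2)[OF En(2)[OF z(1)]]]
            by (simp add: dist_real_def)
        moreover have "y \<in> E'" using True TE by blast
        ultimately show ?thesis using True by (simp add: ennreal_leI)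
      qed simp
    qed
    also have "\<dots> = ennreal (\<rho>' (T x) + e) * emeasure lborel E'"
      using eE'(1) by (subst nn_integral_cmult_indicator) auto
    finally have le: "ennreal (\<rho> x - e) * ennreal (r ^ DIM('e) * V) \<le>
        ennreal (\<rho>' (T x) + e) * ennreal (r ^ DIM('e) * ((1 + e) ^ DIM('e) * V'))"
      unfolding eE eE' using r V e1 by (simp add: ennreal_mult)
    have "ennreal ((\<rho> x - e) * (r ^ DIM('e) * V)) = ennreal (\<rho> x - e) * ennreal (r ^ DIM('e) * V)"
      using e r V by (intro ennreal_mult) auto
    moreover have "ennreal ((\<rho>' (T x) + e) * (r ^ DIM('e) * ((1 + e) ^ DIM('e) * V'))) =
        ennreal (\<rho>' (T x) + e) * ennreal (r ^ DIM('e) * ((1 + e) ^ DIM('e) * V'))"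
      using e r V rpos by (intro ennreal_mult) auto
    ultimately have le: "ennreal ((\<rho> x - e) * (r ^ DIM('e) * V)) \<le>
        ennreal ((\<rho>' (T x) + e) * (r ^ DIM('e) * ((1 + e) ^ DIM('e) * V')))"
      using le by (simp only:)
    have "0 \<le> (\<rho>' (T x) + e) * (r ^ DIM('e) * ((1 + e) ^ DIM('e) * V'))"
      using e r V rpos by simp
    from ennreal_le_iff[OF this, THEN iffD1, OF le]
    have "(\<rho> x - e) * (r ^ DIM('e) * V) \<le> (\<rho>' (T x) + e) * (r ^ DIM('e) * ((1 + e) ^ DIM('e) * V'))" .
    then have "r ^ DIM('e) * ((\<rho> x - e) * V) \<le> r ^ DIM('e) * ((\<rho>' (T x) + e) * ((1 + e) ^ DIM('e) * V'))"
      by (simp only: mult_ac)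
    then show ?thesis using r(1) by (simp only: mult_le_cancel_left_pos[OF zero_less_power])
  qed
  have "\<rho> x * V \<le> \<rho>' (T x) * V'"
  proof (rule tendsto_le[OF _ _ _ _])
    show "((\<lambda>e. (\<rho> x - e) * V) \<longlongrightarrow> \<rho> x * V) (at_right 0)"
      by (rule tendsto_eq_intros | simp)+
    show "((\<lambda>e. (\<rho>' (T x) + e) * ((1 + e) ^ DIM('e) * V')) \<longlongrightarrow> \<rho>' (T x) * V') (at_right 0)"
      by (rule tendsto_eq_intros | simp)+
    show "\<forall>\<^sub>F e in at_right 0. (\<rho> x - e) * V \<le> (\<rho>' (T x) + e) * ((1 + e) ^ DIM('e) * V')"
      using eventually_at_right[of 0 "\<rho> x"] rpos(1) main by (auto simp: eventually_at_right[of 0 "\<rho> x"])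
  qed simp
  then show ?thesis by (simp add: V_def V'_def T_def)
qed

text \<open>The inequality for both orders of the charts. Up to the Euclidean unit volume, the
  product is the density of \<open>\<mu>\<close> relative to the Busemann-Hausdorff measure, and so
  a function on the manifold.\<close>

lemma density_volume_eq:
  assumes F: "finsler A F" and c: "c \<in> A" "c' \<in> A" and x: "x \<in> overlap c c'"
    and \<rho>: "smooth_density \<mu> c \<rho>" and \<rho>': "smooth_density \<mu> c' \<rho>'"
  shows "\<rho> x * chart_volume F c x = \<rho>' (transition c c' x) * chart_volume F c' (transition c c' x)"
proof (rule antisym)
  have "transition c' c (transition c c' x) = x"
    using transition_transition[OF c x, of c] transition_self[OF c(1)] overlapD(1)[OF c x] by simp
  then show "\<rho>' (transition c c' x) * chart_volume F c' (transition c c' x) \<le> \<rho> x * chart_volume F c x"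
    using density_volume_le[OF F c(2,1) overlapD(5)[OF c x] \<rho>' \<rho>] by simp
qed (rule density_volume_le[OF assms])

text \<open>The case \<open>c' = c\<close> of \<open>density_volume_eq\<close>, divided by the
  positive ball volume.\<close>

lemma smooth_density_unique:
  assumes F: "finsler A F" and c: "c \<in> A" and x: "x \<in> crange c"
    and \<rho>: "smooth_density \<mu> c \<rho>" "smooth_density \<mu> c \<rho>'"
  shows "\<rho> x = \<rho>' x"
proof -
  interpret fc: finsler_chart "crange c" "in_chart_pair A F c"
    by (rule finsler_chartI[OF F c])
  show ?thesis
    using density_volume_eq[OF F c c _ \<rho>, of x] x overlap_self[OF c] transition_self[OF c x]
      fc.ball_volume_pos[OF x] by simp
qed

text \<open>By second countability, countably many chart domains cover the manifold. Making them
  disjoint splits a Borel set into countably many pieces, each inside one chart.\<close>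

lemma measure_eqI_charts:
  assumes sets: "sets \<mu> = sets borel" "sets \<nu> = sets borel"
    and eq: "\<And>c B. c \<in> A \<Longrightarrow> B \<in> sets borel \<Longrightarrow> B \<subseteq> cdom c \<Longrightarrow> emeasure \<mu> B = emeasure \<nu> B"
  shows "\<mu> = \<nu>"
proof (rule measure_eqI)
  show "sets \<mu> = sets \<nu>" using sets by simp
  fix B assume "B \<in> sets \<mu>"
  then have B: "B \<in> sets borel" using sets by simp
  have cov: "\<Union>(cdom ` A) = UNIV" using smooth_manifold by (simp add: smooth_manifold_def)
  obtain \<F> where \<F>: "\<F> \<subseteq> cdom ` A" "countable \<F>" "\<Union>\<F> = UNIV"
    using Lindelof[of "cdom ` A"] open_cdom cov by (metis (no_types, lifting) imageE)
  have ne: "\<F> \<noteq> {}" using \<F>(3) by auto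
  define U where "U = from_nat_into \<F>"
  have U: "range U = \<F>" unfolding U_def by (rule range_from_nat_into[OF ne \<F>(2)])
  have Ub: "range U \<subseteq> sets borel" using U \<F>(1) open_cdom by auto
  define D where "D n = B \<inter> disjointed U n" for n
  have Db: "D n \<in> sets borel" for n
    using sets.range_disjointed_sets[OF Ub] B by (auto simp: D_def)
  have "(\<Union>n. disjointed U n) = UNIV" using U \<F>(3) by (simp add: UN_disjointed_eq)
  then have DB: "(\<Union>n. D n) = B" by (auto simp: D_def)
  have disj: "disjoint_family D"
    using disjoint_family_disjointed[of U] by (auto simp: disjoint_family_on_def D_def)
  have "emeasure \<mu> (D n) = emeasure \<nu> (D n)" for n
  proof -
    obtain c where "c \<in> A" "U n = cdom c" using U \<F>(1) by blast
    moreover from this have "D n \<subseteq> cdom c" using disjointed_subset[of U n] by (auto simp: D_def)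
    ultimately show ?thesis using eq[OF _ Db] by blast
  qed
  moreover have "(\<Sum>n. emeasure \<mu> (D n)) = emeasure \<mu> B" "(\<Sum>n. emeasure \<nu> (D n)) = emeasure \<nu> B"
    using suminf_emeasure[of D \<mu>, OF _ disj] suminf_emeasure[of D \<nu>, OF _ disj] Db DB sets by auto
  ultimately show "emeasure \<mu> B = emeasure \<nu> B" by simp
qed

lemma smooth_fun_continuous_on:
  assumes "smooth_fun A \<Psi>"
  shows "continuous_on UNIV \<Psi>"
proof -
  have "isCont \<Psi> p" for p
  proof -
    obtain c where c: "c \<in> A" "p \<in> cdom c" using ex_chart .
    have sm: "smooth_on (crange c) (\<Psi> \<circ> param c)" using assms c(1) by (simp add: smooth_fun_def)
    have "continuous_on (cdom c) (\<lambda>p. (\<Psi> \<circ> param c) (coord c p))"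
      by (rule continuous_on_compose2[OF smooth_on_continuous_on[OF sm] continuous_on_coord[OF c(1)]])
        (simp add: crange_def)
    then have "continuous_on (cdom c) \<Psi>"
      by (rule continuous_on_eq) (simp add: param_coord[OF c(1)])
    then show ?thesis using open_cdom[OF c(1)] c(2) by (simp add: continuous_on_eq_continuous_at)
  qed
  then show ?thesis by (simp add: continuous_at_imp_continuous_on)
qed

text \<open>A smooth density prescribes \<open>\<mu>\<close> on Borel subsets of the chart domain.
  This is read as an equality of measures: \<open>\<mu>\<close> restricted to \<open>cdom c\<close>
  is the image under \<open>param c\<close> of a density measure. The integral formulas for image
  measures and densities then apply.\<close>

lemma nn_integral_chart:
  assumes \<mu>: "sets \<mu> = sets borel" and c: "c \<in> A" and \<rho>: "smooth_density \<mu> c \<rho>"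
    and f: "f \<in> borel_measurable borel" and B: "B \<in> sets borel" "B \<subseteq> cdom c"
  shows "(\<integral>\<^sup>+p. f p * indicator B p \<partial>\<mu>) =
    (\<integral>\<^sup>+x. ennreal (\<rho> x) * f (param c x) * indicator (coord c ` B) x \<partial>lborel)"
proof -
  \<comment> \<open>A version of \<open>param c\<close> that is measurable on the whole space; the
    density \<open>r\<close> vanishes where the two may differ.\<close>
  define P where "P x = (if x \<in> crange c then param c x else undefined)" for x
  have P: "P \<in> borel_measurable borel"
  proof (rule borel_measurableI)
    fix S :: "'m set" assume "open S"
    have "P -` S \<inter> space borel = coord c ` (S \<inter> cdom c) \<union> (if undefined \<in> S then - crange c else {})"
      by (intro set_eqI) (unfold Un_iff in_coord_image_iff[OF c], auto simp: P_def)
    moreover have "coord c ` (S \<inter> cdom c) \<in> sets borel" "- crange c \<in> sets borel"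
      using open_coord_image[OF c \<open>open S\<close>] open_crange[OF c] by (auto intro: borel_closed)
    ultimately show "P -` S \<inter> space borel \<in> sets borel" by auto
  qed
  define r where "r x = ennreal (\<rho> x) * indicator (crange c) x" for x
  have "(\<lambda>x. indicator (crange c) x *\<^sub>R \<rho> x) \<in> borel_measurable borel"
    using borel_measurable_continuous_on_indicator[OF _
        smooth_on_continuous_on[OF smooth_densityD(1)[OF \<rho>]]]
      open_crange[OF c] by auto
  then have "(\<lambda>x. ennreal (indicator (crange c) x *\<^sub>R \<rho> x)) \<in> borel_measurable borel" by measurable
  moreover have "(\<lambda>x. ennreal (indicator (crange c) x *\<^sub>R \<rho> x)) = r"
    by (auto simp: r_def indicator_def)
  ultimately have r: "r \<in> borel_measurable borel" by simp
  have dens: "density \<mu> (indicator (cdom c)) = distr (density lborel r) borel P"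
  proof (rule measure_eqI)
    fix S assume "S \<in> sets (density \<mu> (indicator (cdom c)))"
    then have S: "S \<in> sets borel" using \<mu> by simp
    have SI: "S \<inter> cdom c \<in> sets borel" using S open_cdom[OF c] by auto
    have cd: "cdom c \<in> sets \<mu>" using \<mu> open_cdom[OF c] by simp
    have "emeasure (density \<mu> (indicator (cdom c))) S = (\<integral>\<^sup>+p. indicator (cdom c) p * indicator S p \<partial>\<mu>)"
      by (rule emeasure_density[OF borel_measurable_indicator[OF cd]]) (simp add: S \<mu>)
    also have "\<dots> = (\<integral>\<^sup>+p. indicator (S \<inter> cdom c) p \<partial>\<mu>)"
      by (intro nn_integral_cong) (auto simp: indicator_def)
    also have "\<dots> = emeasure \<mu> (S \<inter> cdom c)" using SI \<mu> by (intro nn_integral_indicator) simp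
    also have "\<dots> = (\<integral>\<^sup>+x. ennreal (\<rho> x) * indicator (coord c ` (S \<inter> cdom c)) x \<partial>lborel)"
      by (rule smooth_densityD(3)[OF \<rho> SI]) simp
    also have "\<dots> = (\<integral>\<^sup>+x. r x * indicator (P -` S) x \<partial>lborel)"
    proof (rule nn_integral_cong)
      fix x
      show "ennreal (\<rho> x) * indicator (coord c ` (S \<inter> cdom c)) x = r x * indicator (P -` S) x"
        using in_coord_image_iff[OF c, of x S]
            by (cases "x \<in> crange c") (auto simp: r_def P_def indicator_def)
    qed
    also have "\<dots> = emeasure (density lborel r) (P -` S)"
      using r measurable_sets[OF P S] by (subst emeasure_density) auto
    also have "\<dots> = emeasure (distr (density lborel r) borel P) S"
      using P S by (subst emeasure_distr) auto
    finally show "emeasure (density \<mu> (indicator (cdom c))) S =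
        emeasure (distr (density lborel r) borel P) S" .
  qed (use \<mu> in simp)
  have fB: "(\<lambda>p. f p * indicator B p) \<in> borel_measurable borel" using f B by measurable
  have "(\<integral>\<^sup>+p. f p * indicator B p \<partial>\<mu>) = (\<integral>\<^sup>+p. indicator (cdom c) p * (f p * indicator B p) \<partial>\<mu>)"
    using B(2) by (intro nn_integral_cong) (auto simp: indicator_def)
  also have "\<dots> = (\<integral>\<^sup>+p. f p * indicator B p \<partial>density \<mu> (indicator (cdom c)))"
    using fB \<mu> open_cdom[OF c] by (subst nn_integral_density) (auto cong: measurable_cong_sets)
  also have "\<dots> = (\<integral>\<^sup>+x. f (P x) * indicator B (P x) \<partial>density lborel r)"
    unfolding dens using P fB by (subst nn_integral_distr) auto
  also have "\<dots> = (\<integral>\<^sup>+x. r x * (f (P x) * indicator B (P x)) \<partial>lborel)"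
    using r measurable_compose[OF P fB] by (subst nn_integral_density) auto
  also have "\<dots> = (\<integral>\<^sup>+x. ennreal (\<rho> x) * f (param c x) * indicator (coord c ` B) x \<partial>lborel)"
  proof (rule nn_integral_cong)
    fix x
    have "B \<inter> cdom c = B" using B(2) by auto
    then show "r x * (f (P x) * indicator B (P x)) =
        ennreal (\<rho> x) * f (param c x) * indicator (coord c ` B) x"
      using in_coord_image_iff[OF c, of x B]
          by (cases "x \<in> crange c") (auto simp: r_def P_def indicator_def)
  qed
  finally show ?thesis .
qed

lemma smooth_density_density:
  assumes \<mu>: "sets \<mu> = sets borel" and c: "c \<in> A" and \<rho>: "smooth_density \<mu> c \<rho>"
    and \<Psi>: "smooth_fun A \<Psi>"
  shows "smooth_density (density \<mu> (\<lambda>p. ennreal (exp (\<Psi> p)))) c (\<lambda>x. \<rho> x * exp (\<Psi> (param c x)))"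
  unfolding smooth_density_def
proof (intro conjI ballI impI)
  have "smooth_on (crange c) (\<Psi> \<circ> param c)" using \<Psi> c by (simp add: smooth_fun_def)
  from smooth_on_compose[OF open_crange[OF c] open_UNIV _ smooth_on_exp this]
  show "smooth_on (crange c) (\<lambda>x. \<rho> x * exp (\<Psi> (param c x)))"
    by (intro smooth_on_mult open_crange[OF c] smooth_densityD(1)[OF \<rho>]) simp
  show "0 < \<rho> x * exp (\<Psi> (param c x))" if "x \<in> crange c" for x
    using smooth_densityD(2)[OF \<rho> that] by simp
  fix B :: "'m set" assume B: "B \<in> sets borel" "B \<subseteq> cdom c"
  have f: "(\<lambda>p. ennreal (exp (\<Psi> p))) \<in> borel_measurable borel"
    using borel_measurable_continuous_onI[OF smooth_fun_continuous_on[OF \<Psi>]] by measurable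
  have "emeasure (density \<mu> (\<lambda>p. ennreal (exp (\<Psi> p)))) B = (\<integral>\<^sup>+p. ennreal (exp (\<Psi> p)) * indicator B p \<partial>\<mu>)"
    using f B \<mu> by (subst emeasure_density) (auto cong: measurable_cong_sets)
  also have "\<dots> = (\<integral>\<^sup>+x. ennreal (\<rho> x) * ennreal (exp (\<Psi> (param c x))) * indicator (coord c ` B) x \<partial>lborel)"
    by (rule nn_integral_chart[OF \<mu> c \<rho> f B])
  also have "\<dots> = (\<integral>\<^sup>+x. ennreal (\<rho> x * exp (\<Psi> (param c x))) * indicator (coord c ` B) x \<partial>lborel)"
    by (intro nn_integral_cong) (simp add: ennreal_mult'')
  finally show "emeasure (density \<mu> (\<lambda>p. ennreal (exp (\<Psi> p)))) B =
    (\<integral>\<^sup>+x. ennreal (\<rho> x * exp (\<Psi> (param c x))) * indicator (coord c ` B) x \<partial>lborel)" .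
qed

end

text \<open>As an equality of functions it also rewrites inside the second derivative. It holds at
  points without a derivative too, since both descriptions have the same predicate.\<close>

lemma deriv_add_const: "deriv (\<lambda>t. f t + k) = deriv f" for f :: "real \<Rightarrow> real"
proof
  fix x
  have "((\<lambda>t. f t + k) has_field_derivative D) (at x) \<longleftrightarrow> (f has_field_derivative D) (at x)" for D
    using DERIV_add[of f D x UNIV "\<lambda>t. k" 0] DERIV_add[of "\<lambda>t. f t + k" D x UNIV "\<lambda>t. - k" 0]
    by auto
  then show "deriv (\<lambda>t. f t + k) x = deriv f x" by (simp add: deriv_def)
qed

section \<open>The Busemann-Hausdorff measure and the weight function\<close>

context manifold
begin

context
  fixes F :: "('m, 'e) tangent \<Rightarrow> real" and m :: "'m measure"
  assumes F: "berwald A F" and m: "smooth_measure A m"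
begin

lemma finsler_F: "finsler A F"
  using F by (simp add: berwald_def)

lemma sets_m: "sets m = sets borel"
  using m by (simp add: smooth_measure_def)

lemma chart_volume_pos: "c \<in> A \<Longrightarrow> x \<in> crange c \<Longrightarrow> chart_volume F c x > 0"
  using finsler_chart.ball_volume_pos[OF finsler_chartI[OF finsler_F]] .

lemma smooth_on_ln_chart_volume:
  assumes c: "c \<in> A"
  shows "smooth_on (crange c) (\<lambda>x. ln (chart_volume F c x))"
proof -
  have G: "is_induced_connection A F (induced_connection A F)"
    by (rule is_induced_induced_connection[OF F])
  then have "affine_connection A (induced_connection A F)" by (simp add: is_induced_connection_def)
  note aff = affine_connectionD[OF this c]
  show ?thesis
    by (rule finsler_chart.smooth_on_ln_ball_volume[OF finsler_chartI[OF finsler_F c]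
          horizontal_if_induced[OF finsler_F G c] aff])
qed

definition \<rho>m :: "('m, 'e) chart \<Rightarrow> 'e \<Rightarrow> real"
  where "\<rho>m c = (SOME \<rho>. smooth_density m c \<rho>)"

lemma \<rho>m:
  assumes "c \<in> A"
  shows "smooth_density m c (\<rho>m c)"
proof -
  have "\<exists>\<rho>. smooth_density m c \<rho>" using m assms by (simp add: smooth_measure_def)
  then show ?thesis unfolding \<rho>m_def by (rule someI_ex)
qed

text \<open>In a chart, the density of the Busemann-Hausdorff measure is the Euclidean unit volume divided
  by the volume of the unit ball of \<open>F\<close>; its quotient by the density of \<open>m\<close> is \<open>exp log_density\<close>.\<close>

definition log_density :: "'m \<Rightarrow> real"
  where "log_density p = (let c = SOME c. c \<in> A \<and> p \<in> cdom c in
    ln (measure lborel (ball (0 :: 'e) 1)) - ln (\<rho>m c (coord c p)) - ln (chart_volume F c (coord c p)))"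

text \<open>Independence of the chart selected in the definition, and of the density chosen for
  \<open>m\<close>, is \<open>density_volume_eq\<close> after taking logarithms.\<close>

lemma log_density:
  assumes c: "c \<in> A" and x: "x \<in> crange c" and \<rho>: "smooth_density m c \<rho>"
  shows "log_density (param c x) =
      ln (measure lborel (ball (0 :: 'e) 1)) - ln (\<rho> x) - ln (chart_volume F c x)"
proof -
  define c' where "c' = (SOME c'. c' \<in> A \<and> param c x \<in> cdom c')"
  have c': "c' \<in> A" "param c x \<in> cdom c'"
    unfolding c'_def using someI[of "\<lambda>c'. c' \<in> A \<and> param c x \<in> cdom c'" c] c param_in_cdom[OF c x] by auto
  have ov: "x \<in> overlap c c'" using x c' by (simp add: overlap_def)
  define y where "y = transition c c' x"
  have y: "y \<in> crange c'" "coord c' (param c x) = y"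
    using overlapD(4)[OF c c'(1) ov] by (simp_all add: y_def transition_def)
  have "\<rho> x * chart_volume F c x = \<rho>m c' y * chart_volume F c' y"
    unfolding y_def by (rule density_volume_eq[OF finsler_F c c'(1) ov \<rho> \<rho>m[OF c'(1)]])
  then have "ln (\<rho> x * chart_volume F c x) = ln (\<rho>m c' y * chart_volume F c' y)" by simp
  then show ?thesis
    using smooth_densityD(2)[OF \<rho> x] chart_volume_pos[OF c x] smooth_densityD(2)[OF \<rho>m[OF c'(1)] y(1)]
      chart_volume_pos[OF c'(1) y(1)]
    by (simp add: log_density_def c'_def[symmetric] y(2) ln_mult)
qed

lemma smooth_fun_log_density: "smooth_fun A log_density"
  unfolding smooth_fun_def
proof
  fix c assume c: "c \<in> A"
  have "smooth_on (crange c) (\<lambda>x. ln (\<rho>m c x))"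
    using smooth_densityD(1,2)[OF \<rho>m[OF c]]
    by (intro smooth_on_compose[OF open_crange[OF c] _ _ smooth_on_ln]) auto
  then have "smooth_on (crange c) (\<lambda>x. ln (measure lborel (ball (0 :: 'e) 1)) - ln (\<rho>m c x) - ln
      (chart_volume F c x))"
    by (intro smooth_on_diff open_crange[OF c] smooth_on_const smooth_on_ln_chart_volume[OF c])
  then show "smooth_on (crange c) (log_density \<circ> param c)"
    by (rule smooth_on_cong[OF open_crange[OF c], rotated]) (simp add: log_density[OF c _ \<rho>m[OF c]])
qed

lemma density_exp_log_density:
  assumes c: "c \<in> A" and x: "x \<in> crange c" and \<rho>: "smooth_density m c \<rho>"
  shows "\<rho> x * exp (log_density (param c x)) = measure lborel (ball (0 :: 'e) 1) / chart_volume F c x"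
  using smooth_densityD(2)[OF \<rho> x] chart_volume_pos[OF c x] content_ball_pos[of 1 "0 :: 'e"]
  by (simp add: log_density[OF assms] exp_diff)

lemma chart_volume_eq: "chart_volume F c x = measure lborel {w. in_chart A F c x w < 1}"
  if "c \<in> A"
  using that finsler_chart.ball_volume_def[OF finsler_chartI[OF finsler_F]]
    finsler_chart.unit_ball_def[OF finsler_chartI[OF finsler_F]]
  by (simp add: in_chart_pair_def)

text \<open>The normalization on the fibres determines the density in every chart because ball
  volumes are positive, and the charts determine the measure by \<open>measure_eqI_charts\<close>.
  Existence comes from reweighting \<open>m\<close>.\<close>

lemma busemann_hausdorff_eq:
  "busemann_hausdorff A F = density m (\<lambda>p. ennreal (exp (log_density p)))" (is "_ = ?\<mu>")
proof -
  define P where "P \<nu> c \<rho> \<longleftrightarrow> smooth_density \<nu> c \<rho> \<and>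
    (\<forall>x\<in>crange c. \<rho> x * chart_volume F c x = measure lborel (ball (0 :: 'e) 1))" for \<nu> c \<rho>
  have ex: "P ?\<mu> c (\<lambda>x. \<rho>m c x * exp (log_density (param c x)))" if c: "c \<in> A" for c
    unfolding P_def using smooth_density_density[OF sets_m c \<rho>m[OF c] smooth_fun_log_density]
      density_exp_log_density[OF c _ \<rho>m[OF c]] chart_volume_pos[OF c] by force
  have unique: "\<nu> = ?\<mu>" if \<nu>: "sets \<nu> = sets borel" "\<forall>c\<in>A. \<exists>\<rho>. P \<nu> c \<rho>" for \<nu>
  proof (rule measure_eqI_charts)
    fix c B assume c: "c \<in> A" and B: "B \<in> sets borel" "B \<subseteq> cdom c"
    obtain \<rho> where \<rho>: "P \<nu> c \<rho>" using \<nu> c by blast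
    obtain \<rho>' where \<rho>': "P ?\<mu> c \<rho>'" using ex[OF c] by blast
    have "\<rho> x = \<rho>' x" if "x \<in> crange c" for x
    proof -
      have "\<rho> x * chart_volume F c x = \<rho>' x * chart_volume F c x" using \<rho> \<rho>' that by (simp add: P_def)
      then show ?thesis using chart_volume_pos[OF c that] by simp
    qed
    moreover have "coord c ` B \<subseteq> crange c" using B(2) by (auto simp: crange_def)
    ultimately have "(\<integral>\<^sup>+x. ennreal (\<rho> x) * indicator (coord c ` B) x \<partial>lborel) =
        (\<integral>\<^sup>+x. ennreal (\<rho>' x) * indicator (coord c ` B) x \<partial>lborel)"
      by (intro nn_integral_cong) (auto simp: indicator_def)
    then show "emeasure \<nu> B = emeasure ?\<mu> B"
      using smooth_densityD(3)[OF _ B, of \<nu> \<rho>] smooth_densityD(3)[OF _ B, of ?\<mu> \<rho>'] \<rho> \<rho>'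
      by (simp add: P_def)
  qed (use \<nu> sets_m in auto)
  have "busemann_hausdorff A F = (THE \<nu>. sets \<nu> = sets borel \<and> (\<forall>c\<in>A. \<exists>\<rho>. P \<nu> c \<rho>))"
    unfolding busemann_hausdorff_def P_def by (simp add: chart_volume_eq cong: ball_cong)
  also have "\<dots> = ?\<mu>"
    by (rule the_equality) (use ex unique sets_m in auto)
  finally show ?thesis .
qed

text \<open>Existence holds because the two exponential weights cancel. For uniqueness, a competitor
  \<open>\<Psi>\<close> provides a second smooth density of \<open>m\<close> in a chart, which must
  agree with \<open>\<rho>m\<close> by \<open>smooth_density_unique\<close>.\<close>

lemma weight_function_eq: "weight_function A F m = log_density"
  unfolding weight_function_def
proof (rule the_equality, intro conjI smooth_fun_log_density)
  have f: "(\<lambda>p. ennreal (exp (log_density p))) \<in> borel_measurable m"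
      "(\<lambda>p. ennreal (exp (- log_density p))) \<in> borel_measurable m"
    using borel_measurable_continuous_onI[OF smooth_fun_continuous_on[OF smooth_fun_log_density]]
    by (simp_all cong: measurable_cong_sets add: sets_m)
  have "density (busemann_hausdorff A F) (\<lambda>p. ennreal (exp (- log_density p))) =
      density m (\<lambda>p. ennreal (exp (log_density p)) * ennreal (exp (- log_density p)))"
    unfolding busemann_hausdorff_eq by (rule density_density_eq[OF f])
  also have "(\<lambda>p. ennreal (exp (log_density p)) * ennreal (exp (- log_density p))) = (\<lambda>p. 1)"
    by (simp add: ennreal_mult[symmetric] exp_minus)
  finally show "m = density (busemann_hausdorff A F) (\<lambda>p. ennreal (exp (- log_density p)))"
    by (simp add: density_1)
next
  fix \<Psi> assume \<Psi>: "smooth_fun A \<Psi> \<and> m = density (busemann_hausdorff A F) (\<lambda>p. ennreal (exp (- \<Psi> p)))"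
  show "\<Psi> = log_density"
  proof
    fix p
    obtain c where c: "c \<in> A" "p \<in> cdom c" using ex_chart .
    define x where "x = coord c p"
    have x: "x \<in> crange c" "param c x = p" using coord_in_crange[OF c(2)] param_coord[OF c]
        by (auto simp: x_def)
    define \<rho> where "\<rho> x = \<rho>m c x * exp (log_density (param c x))" for x
    have \<rho>: "smooth_density (busemann_hausdorff A F) c \<rho>"
      unfolding busemann_hausdorff_eq \<rho>_def
      by (rule smooth_density_density[OF sets_m c(1) \<rho>m[OF c(1)] smooth_fun_log_density])
    have minus: "smooth_fun A (\<lambda>p. - \<Psi> p)"
      unfolding smooth_fun_def
    proof
      fix c assume c: "c \<in> A"
      then have "smooth_on (crange c) (\<Psi> \<circ> param c)" using \<Psi> by (simp add: smooth_fun_def)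
      from smooth_on_minus[OF open_crange[OF c] this]
      show "smooth_on (crange c) ((\<lambda>p. - \<Psi> p) \<circ> param c)" by (simp add: o_def)
    qed
    have "sets (busemann_hausdorff A F) = sets borel" by (simp add: busemann_hausdorff_eq sets_m)
    from smooth_density_density[OF this c(1) \<rho> minus]
    have "smooth_density m c (\<lambda>x. \<rho> x * exp (- \<Psi> (param c x)))"
      by (subst conjunct2[OF \<Psi>])
    then have "\<rho> x * exp (- \<Psi> (param c x)) = \<rho>m c x"
      by (rule smooth_density_unique[OF finsler_F c(1) x(1) _ \<rho>m[OF c(1)]])
    then have "\<rho>m c x * (exp (log_density p) * exp (- \<Psi> p)) = \<rho>m c x * 1" by (simp add: \<rho>_def x(2))
    then have "exp (log_density p) * exp (- \<Psi> p) = 1"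
      using smooth_densityD(2)[OF \<rho>m[OF c(1)] x(1)] by simp
    then have "exp (log_density p - \<Psi> p) = 1" by (simp add: exp_diff exp_minus divide_inverse)
    then show "\<Psi> p = log_density p" by simp
  qed
qed

lemma weight_function_param:
  assumes "c \<in> A" "x \<in> crange c"
  shows "weight_function A F m (param c x) =
      ln (measure lborel (ball (0 :: 'e) 1)) - ln (\<rho>m c x) - ln (chart_volume F c x)"
  unfolding weight_function_eq by (rule log_density[OF assms \<rho>m[OF assms(1)]])

end

text \<open>In a chart the density of \<open>m\<close> drops out of the difference, and the two
  remaining logarithmic volumes have the same derivative because the connection is common. So the
  difference is locally constant, and the manifold is connected.\<close>

lemma weight_function_differ_by_constant:
  assumes F: "berwald A F" "berwald A F'" and eq: "affinely_equivalent A F F'" and m: "smooth_measure A m"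
  shows "\<exists>k. \<forall>p. weight_function A F' m p = weight_function A F m p + k"
proof -
  define G where "G = induced_connection A F"
  have G: "is_induced_connection A F G" "is_induced_connection A F' G"
    using is_induced_induced_connection[OF F(1)] is_induced_induced_connection[OF F(2)] eq
    by (simp_all add: G_def affinely_equivalent_def)
  then have aff: "affine_connection A G" by (simp add: is_induced_connection_def)
  define f where "f p = weight_function A F' m p - weight_function A F m p" for p
  have "\<forall>\<^sub>F q in at p. f p = f q" for p
  proof -
    obtain c where c: "c \<in> A" "p \<in> cdom c" using ex_chart .
    obtain e where e: "e > 0" "ball (coord c p) e \<subseteq> crange c"
      using open_crange[OF c(1)] coord_in_crange[OF c(2)] open_contains_ball by blast
    have fc: "f (param c x) = ln (chart_volume F c x) - ln (chart_volume F' c x)" if "x \<in> crange c" for x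
      unfolding f_def using weight_function_param[OF F(1) m c(1) that]
          weight_function_param[OF F(2) m c(1) that] by simp
    have "\<exists>k. \<forall>x\<in>ball (coord c p) e. ln (chart_volume F c x) - ln (chart_volume F' c x) = k"
    proof (rule has_derivative_zero_constant[OF convex_ball])
      fix x assume "x \<in> ball (coord c p) e"
      then have x: "x \<in> crange c" using e by blast
      have "((\<lambda>x. ln (chart_volume F c x)) has_derivative (\<lambda>a. - (\<Sum>i\<in>Basis. G c x a i \<bullet> i))) (at x)"
        "((\<lambda>x. ln (chart_volume F' c x)) has_derivative (\<lambda>a. - (\<Sum>i\<in>Basis. G c x a i \<bullet> i))) (at x)"
        using finsler_F[OF F(1) m] finsler_F[OF F(2) m] G c(1)
        by (auto intro!: finsler_chart.ln_ball_volume_has_derivative[OF finsler_chartI[OF _ c(1)]]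
            horizontal_if_induced affine_connectionD(1)[OF aff c(1)] x)
      from has_derivative_diff[OF this]
      show "((\<lambda>x. ln (chart_volume F c x) - ln (chart_volume F' c x)) has_derivative (\<lambda>a. 0))
          (at x within ball (coord c p) e)"
        by (simp add: has_derivative_at_withinI)
    qed
    then obtain k where k: "\<And>x. x \<in> ball (coord c p) e \<Longrightarrow>
        ln (chart_volume F c x) - ln (chart_volume F' c x) = k"
      by blast
    define U where "U = cdom c \<inter> coord c -` ball (coord c p) e"
    have U: "open U" "p \<in> U"
      using continuous_open_preimage[OF continuous_on_coord[OF c(1)] open_cdom[OF c(1)] open_ball] c(2) e(1)
      by (auto simp: U_def)
    have "f q = k" if "q \<in> U" for q
      using fc[OF coord_in_crange, of q] k[of "coord c q"] that param_coord[OF c(1), of q]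
          by (auto simp: U_def)
    then show ?thesis
      using U unfolding eventually_at_topological by metis
  qed
  then have "f p = f q" for p q
    using connected_local_const[of UNIV p q f] smooth_manifold by (simp add: smooth_manifold_def)
  then have "\<forall>p. weight_function A F' m p = weight_function A F m p + f undefined"
    unfolding f_def by (metis add.commute diff_add_cancel)
  then show ?thesis by blast
qed

end

theorem proposition29:
  fixes A :: "('m::{t2_space,second_countable_topology}, 'e::euclidean_space) chart set"
    and F F' :: "('m, 'e) tangent \<Rightarrow> real"
    and m :: "'m measure"
    and N :: ereal
    and v :: "('m, 'e) tangent"
  assumes "smooth_manifold A"
    and "berwald A F"
    and "berwald A F'"
    and "affinely_equivalent A F F'"
    and "smooth_measure A m"
    and "ereal (real DIM('e)) \<le> N"
    and "v \<in> tangent_bundle A"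
  shows "weighted_ricci A F m N v = weighted_ricci A F' m N v"
proof -
  interpret manifold A by unfold_locales (fact assms(1))
  have ricci: "finsler_ricci A F v = finsler_ricci A F' v"
    by (rule finsler_ricci_affine_invariant[OF assms(2-4)])
  obtain k where k: "\<And>p. weight_function A F' m p = weight_function A F m p + k"
    using weight_function_differ_by_constant[OF assms(2-5)] by blast
  \<comment> \<open>\<open>F\<close> enters the predicate under \<open>SOME\<close> only through the
    induced connection, so the same curve is selected.\<close>
  have geo: "geodesic_from A F' v = geodesic_from A F v"
    using assms(4) by (simp add: geodesic_from_def affinely_equivalent_def)
  define h where "h = weight_function A F m \<circ> geodesic_from A F v"
  have "weight_function A F' m \<circ> geodesic_from A F' v = (\<lambda>t. h t + k)"
    by (simp add: fun_eq_iff h_def geo k)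
  then show ?thesis
    by (simp add: weighted_ricci_def Let_def ricci deriv_add_const flip: h_def)
qed

end
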